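(* Suppose $G$ is a compact Lie group with a bi-invariant metric, so that the action of $G\times G$ on $G$ defined by $(h_1,h_2)\cdot g=h_1\cdot g\cdot h_2^{-1}$ is isometric. Then for any closed subgroup $H<G\times G$, the bi-quotient space $G/\!\!/H$ satisfies all tree comparisons (that is, the $T$-tree comparison for every finite tree $T$).
   Context: $|a-b|_X$ denotes the distance between $a,b$ in a metric space $X$; $\mathbb{H}$ denotes an infinite-dimensional real Hilbert space. The bi-invariant metric on $G$ is a bi-invariant Riemannian metric, and $G$ is regarded as a metric space with the induced distance. $G$ is not assumed connected; points in different connected components are at infinite distance. The bi-quotient $G/\!\!/H$ is the space of orbits of the restriction to $H$ of the action of $G\times G$ on $G$ defined by $(h_1,h_2)\cdot g=h_1\cdot g\cdot h_2^{-1}$, with the quotient metric, in which the distance between two orbits is the distance between them as subsets of $G$. This distance is finite whenever $G/\!\!/H$ is connected (for example, if $G$ is connected); if $G/\!\!/H$ is disconnected, the comparison is understood for arrays of points at finite distance from each other. Tree comparison: let $T$ be a finite (combinatorial) tree with $n$ vertices. A point array $(a_1,\dots,a_n)$ in a metric space $X$ labeled by the vertices of $T$ (repetitions of points allowed) satisfies the $T$-tree comparison if there is a point array $(\tilde a_1,\dots,\tilde a_n)$ in $\mathbb{H}$ such that $|\tilde a_i-\tilde a_j|_{\mathbb{H}}\ge |a_i-a_j|_X$ for all $i,j$, with equality whenever $a_i$ and $a_j$ label adjacent vertices of $T$. The metric space $X$ satisfies the $T$-tree comparison if every $n$-point array in $X$ labeled by the vertices of $T$ satisfies it. *)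

theory Defs
  imports "HOL-Analysis.Analysis" "HOL-Algebra.Group_Action"
begin

section \<open>Smooth manifolds\<close>

fun Ck_on :: "nat \<Rightarrow> 'e::real_normed_vector set \<Rightarrow> ('e \<Rightarrow> 'f::real_normed_vector) \<Rightarrow> bool" where
  "Ck_on 0 S f \<longleftrightarrow> continuous_on S f"
| "Ck_on (Suc k) S f \<longleftrightarrow> (\<forall>x\<in>S. f differentiable (at x)) \<and>
     (\<forall>v. Ck_on k S (\<lambda>x. frechet_derivative f (at x) v))"

text \<open>Only used for open sets in finite-dimensional spaces, where testing the derivative on each
  fixed vector \<open>v\<close> is the usual condition on all directional derivatives.\<close>

definition smooth_on :: "'e::real_normed_vector set \<Rightarrow> ('e \<Rightarrow> 'f::real_normed_vector) \<Rightarrow> bool" where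
  "smooth_on S f \<longleftrightarrow> (\<forall>k. Ck_on k S f)"

text \<open>A chart is a pair of its domain and its coordinate map (irrelevant outside the domain).\<close>

type_synonym ('a, 'e) chart = "'a set \<times> ('a \<Rightarrow> 'e)"

abbreviation chart_inv :: "('a, 'e) chart \<Rightarrow> 'e \<Rightarrow> 'a" where
  "chart_inv c \<equiv> inv_into (fst c) (snd c)"

definition in_coords :: "('a, 'e) chart \<Rightarrow> ('b, 'f) chart \<Rightarrow> ('a \<Rightarrow> 'b) \<Rightarrow> 'e \<Rightarrow> 'f" where
  "in_coords c c' f = snd c' \<circ> f \<circ> chart_inv c"

definition smooth_map ::
  "'a topology \<Rightarrow> ('a, 'e::real_normed_vector) chart set \<Rightarrow>
   'b topology \<Rightarrow> ('b, 'f::real_normed_vector) chart set \<Rightarrow> ('a \<Rightarrow> 'b) \<Rightarrow> bool" where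
  "smooth_map T A T' A' f \<longleftrightarrow> continuous_map T T' f \<and>
     (\<forall>c\<in>A. \<forall>c'\<in>A'. smooth_on (snd c ` {p \<in> fst c. f p \<in> fst c'}) (in_coords c c' f))"

definition prod_atlas ::
  "('a, 'e) chart set \<Rightarrow> ('b, 'f) chart set \<Rightarrow> ('a \<times> 'b, 'e \<times> 'f) chart set" where
  "prod_atlas A A' = (\<lambda>(c, c'). (fst c \<times> fst c', map_prod (snd c) (snd c'))) ` (A \<times> A')"

text \<open>The model space is a finite-dimensional \<^class>\<open>real_normed_vector\<close> type and not a
  \<^class>\<open>euclidean_space\<close> type, because the latter always has positive dimension, whereas manifolds
  of dimension 0 (for instance finite groups) are to be allowed.\<close>

locale smooth_manifold =
  fixes T :: "'a topology" and A :: "('a, 'e::real_normed_vector) chart set"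
  assumes finite_dim: "\<exists>B::'e set. finite B \<and> span B = UNIV"
    and Hausdorff: "Hausdorff_space T"
    and second_countable: "second_countable T"
    and chart_domain: "c \<in> A \<Longrightarrow> openin T (fst c)"
    and chart_image: "c \<in> A \<Longrightarrow> open (snd c ` fst c)"
    and chart_homeomorphic: "c \<in> A \<Longrightarrow>
      homeomorphic_map (subtopology T (fst c)) (top_of_set (snd c ` fst c)) (snd c)"
    and charts_cover: "(\<Union>c\<in>A. fst c) = topspace T"
    and charts_compatible: "c \<in> A \<Longrightarrow> c' \<in> A \<Longrightarrow>
      smooth_on (snd c ` (fst c \<inter> fst c')) (in_coords c c' id)"

locale lie_group = group G + smooth_manifold T A
  for G :: "('a, 'b) monoid_scheme" (structure)
    and T :: "'a topology" and A :: "('a, 'e::real_normed_vector) chart set" +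
  assumes topspace_eq_carrier: "topspace T = carrier G"
    and smooth_mult: "smooth_map (prod_topology T T) (prod_atlas A A) T A (\<lambda>(x, y). x \<otimes> y)"
    and smooth_inv: "smooth_map T A T A (\<lambda>x. inv x)"


section \<open>Riemannian metrics and the induced distance\<close>

text \<open>A metric tensor \<open>g\<close> is given by its coordinate expressions: \<open>g c p v w\<close> is the inner product
  of the two tangent vectors at \<open>p\<close> whose coordinates in the chart \<open>c\<close> around \<open>p\<close> are \<open>v\<close> and \<open>w\<close>.
  The map \<open>f\<close> preserves \<open>g\<close> if its differential is a linear isometry at every point; for
  \<open>f = id\<close> this is the transformation rule between charts.\<close>

type_synonym ('a, 'e) metric_tensor = "('a, 'e) chart \<Rightarrow> 'a \<Rightarrow> 'e \<Rightarrow> 'e \<Rightarrow> real"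

definition preserves_metric ::
  "('a, 'e::real_normed_vector) chart set \<Rightarrow> ('a, 'e) metric_tensor \<Rightarrow> ('a \<Rightarrow> 'a) \<Rightarrow> bool" where
  "preserves_metric A g f \<longleftrightarrow>
     (\<forall>c\<in>A. \<forall>c'\<in>A. \<forall>p. p \<in> fst c \<and> f p \<in> fst c' \<longrightarrow>
        (let D = frechet_derivative (in_coords c c' f) (at (snd c p))
         in \<forall>v w. g c' (f p) (D v) (D w) = g c p v w))"

locale riemannian_manifold = smooth_manifold T A
  for T :: "'a topology" and A :: "('a, 'e::real_normed_vector) chart set" +
  fixes g :: "('a, 'e) metric_tensor"
  assumes metric_bilinear: "c \<in> A \<Longrightarrow> p \<in> fst c \<Longrightarrow> bilinear (g c p)"
    and metric_symmetric: "c \<in> A \<Longrightarrow> p \<in> fst c \<Longrightarrow> g c p v w = g c p w v"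
    and metric_pos_def: "c \<in> A \<Longrightarrow> p \<in> fst c \<Longrightarrow> v \<noteq> 0 \<Longrightarrow> g c p v v > 0"
    and metric_smooth: "c \<in> A \<Longrightarrow> smooth_on (snd c ` fst c) (\<lambda>x. g c (chart_inv c x) v w)"
    and metric_transforms: "preserves_metric A g id"

definition C1_curve_on ::
  "'a topology \<Rightarrow> ('a, 'e::real_normed_vector) chart set \<Rightarrow> real \<Rightarrow> real \<Rightarrow> (real \<Rightarrow> 'a) \<Rightarrow> bool" where
  "C1_curve_on T A s t \<gamma> \<longleftrightarrow> continuous_map (top_of_set {s..t}) T \<gamma> \<and>
     (\<forall>c\<in>A. \<exists>D. continuous_on {r \<in> {s..t}. \<gamma> r \<in> fst c} D \<and>
        (\<forall>r\<in>{s..t}. \<gamma> r \<in> fst c \<longrightarrow>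
           ((snd c \<circ> \<gamma>) has_vector_derivative D r) (at r within {s..t})))"

definition piecewise_C1_curve ::
  "'a topology \<Rightarrow> ('a, 'e::real_normed_vector) chart set \<Rightarrow> (real \<Rightarrow> 'a) \<Rightarrow> bool" where
  "piecewise_C1_curve T A \<gamma> \<longleftrightarrow>
     (\<exists>P. finite P \<and> {0, 1} \<subseteq> P \<and> P \<subseteq> {0..1} \<and>
        (\<forall>s\<in>P. \<forall>t\<in>P. s < t \<and> P \<inter> {s<..<t} = {} \<longrightarrow> C1_curve_on T A s t \<gamma>))"

text \<open>By \<open>metric_transforms\<close> the speed does not depend on the chart that is chosen. It is only
  meaningful off the finitely many breakpoints, which do not affect the length.\<close>

definition speed ::
  "('a, 'e::real_normed_vector) chart set \<Rightarrow> ('a, 'e) metric_tensor \<Rightarrow> (real \<Rightarrow> 'a) \<Rightarrow> real \<Rightarrow> real" where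
  "speed A g \<gamma> t =
     (let c = (SOME c. c \<in> A \<and> \<gamma> t \<in> fst c);
          v = vector_derivative (snd c \<circ> \<gamma>) (at t)
      in sqrt (g c (\<gamma> t) v v))"

definition curve_length ::
  "('a, 'e::real_normed_vector) chart set \<Rightarrow> ('a, 'e) metric_tensor \<Rightarrow> (real \<Rightarrow> 'a) \<Rightarrow> real" where
  "curve_length A g \<gamma> = integral {0..1} (speed A g \<gamma>)"

text \<open>Points in different components have distance \<open>\<infinity>\<close>, the infimum of the empty set.\<close>

definition riemannian_dist ::
  "'a topology \<Rightarrow> ('a, 'e::real_normed_vector) chart set \<Rightarrow> ('a, 'e) metric_tensor \<Rightarrow>
   'a \<Rightarrow> 'a \<Rightarrow> ennreal" where
  "riemannian_dist T A g p q =
     (INF \<gamma>\<in>{\<gamma>. piecewise_C1_curve T A \<gamma> \<and> \<gamma> 0 = p \<and> \<gamma> 1 = q}. ennreal (curve_length A g \<gamma>))"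

definition bi_invariant ::
  "('a, 'b) monoid_scheme \<Rightarrow> ('a, 'e::real_normed_vector) chart set \<Rightarrow> ('a, 'e) metric_tensor \<Rightarrow> bool" where
  "bi_invariant G A g \<longleftrightarrow>
     (\<forall>a\<in>carrier G. preserves_metric A g (\<lambda>x. a \<otimes>\<^bsub>G\<^esub> x) \<and> preserves_metric A g (\<lambda>x. x \<otimes>\<^bsub>G\<^esub> a))"


section \<open>Bi-quotients\<close>

definition two_sided_action :: "('a, 'b) monoid_scheme \<Rightarrow> 'a \<times> 'a \<Rightarrow> 'a \<Rightarrow> 'a" where
  "two_sided_action G = (\<lambda>(h\<^sub>1, h\<^sub>2) x. h\<^sub>1 \<otimes>\<^bsub>G\<^esub> x \<otimes>\<^bsub>G\<^esub> inv\<^bsub>G\<^esub> h\<^sub>2)"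

definition biquotient :: "('a, 'b) monoid_scheme \<Rightarrow> ('a \<times> 'a) set \<Rightarrow> 'a set set" where
  "biquotient G H = orbits ((G \<times>\<times> G)\<lparr>carrier := H\<rparr>) (carrier G) (two_sided_action G)"

definition subset_dist :: "('a \<Rightarrow> 'a \<Rightarrow> ennreal) \<Rightarrow> 'a set \<Rightarrow> 'a set \<Rightarrow> ennreal" where
  "subset_dist d X Y = (INF (x, y)\<in>X \<times> Y. d x y)"


section \<open>Tree comparison\<close>

definition adj_rel :: "'v set set \<Rightarrow> ('v \<times> 'v) set" where
  "adj_rel E = {(i, j). {i, j} \<in> E}"

definition graph_cycle :: "'v set set \<Rightarrow> 'v list \<Rightarrow> bool" where
  "graph_cycle E vs \<longleftrightarrow> length vs \<ge> 3 \<and> distinct vs \<and>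
     (\<forall>k<length vs. (vs ! k, vs ! (Suc k mod length vs)) \<in> adj_rel E)"

definition finite_tree :: "'v set \<Rightarrow> 'v set set \<Rightarrow> bool" where
  "finite_tree V E \<longleftrightarrow> finite V \<and> V \<noteq> {} \<and> (\<forall>e\<in>E. e \<subseteq> V \<and> card e = 2) \<and>
     (\<forall>i\<in>V. \<forall>j\<in>V. (i, j) \<in> (adj_rel E)\<^sup>*) \<and> (\<nexists>vs. graph_cycle E vs)"

text \<open>The distance \<open>d\<close> on \<open>X\<close> may take the value \<open>\<infinity>\<close>; only arrays of points at finite distance from
  each other are compared. The type \<open>'h\<close> is the Hilbert space containing the model arrays.\<close>

definition satisfies_tree_comparison ::
  "'h::{real_inner, complete_space} itself \<Rightarrow> 'x set \<Rightarrow> ('x \<Rightarrow> 'x \<Rightarrow> ennreal) \<Rightarrow>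
   'v set \<Rightarrow> 'v set set \<Rightarrow> bool" where
  "satisfies_tree_comparison _ X d V E \<longleftrightarrow>
     (\<forall>a. (\<forall>i\<in>V. a i \<in> X) \<and> (\<forall>i\<in>V. \<forall>j\<in>V. d (a i) (a j) < \<infinity>) \<longrightarrow>
        (\<exists>b :: 'v \<Rightarrow> 'h. \<forall>i\<in>V. \<forall>j\<in>V.
           ennreal (dist (b i) (b j)) \<ge> d (a i) (a j) \<and>
           ((i, j) \<in> adj_rel E \<longrightarrow> ennreal (dist (b i) (b j)) = d (a i) (a j))))"

end

theory Submission
  imports Defs "HOL-Real_Asymp.Real_Asymp"
begin

text \<open>
  A bi-quotient of \<open>G\<close> is, up to arbitrarily small errors, the image of a Euclidean space under a
  submetry, and along a tree a submetry can be lifted edge by edge.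

  Give \<open>G\<close> to the power \<open>N\<close> the product metric in which every factor carries the distance of \<open>G\<close>
  multiplied by the square root of \<open>N\<close>. The product map onto \<open>G\<close> is a submetry. It is
  1-Lipschitz, since bi-invariance gives \<open>d(x\<^sub>1\<cdots>x\<^sub>N, y\<^sub>1\<cdots>y\<^sub>N) \<le> \<Sum> d(x\<^sub>k, y\<^sub>k)\<close> and the
  Cauchy-Schwarz inequality bounds this sum by the product distance (\<open>d_le_sum_increments\<close>). And a
  curve of length \<open>l\<close> that starts at a product splits into \<open>N\<close> pieces of length \<open>l / N\<close>, each of
  which can be spent on one factor (\<open>lift_to_increments\<close>). The orbit map from \<open>G\<close> to the bi-quotient
  is a submetry because the acting group preserves the distance (\<open>biquotient_lift\<close>).

  Hence an array labelled by the vertices of a tree lifts to the power of \<open>G\<close>: start at a root and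
  continue along the edges. Distances along edges are kept up to \<open>\<epsilon>\<close>, and no distance decreases.
  The choices do not interfere with each other because a tree has no cycles (\<open>tree_labelling\<close>).
  After a translation all factors of the root are the unit, so all factors of all lifted points lie
  within \<open>O(1/N)\<close> of the unit. There a chart distorts the distance of \<open>G\<close> only by factors \<open>1 \<plusminus> \<epsilon>\<close>
  compared with the norm of the metric tensor at the unit (\<open>locally_flat\<close>), so the lifted array is
  almost an array in a Euclidean space (\<open>approximate_gram_biquotient\<close>).

  The Gram matrices of these Euclidean arrays stay bounded as \<open>\<epsilon>\<close> tends to \<open>0\<close>. A limit point is
  positive semidefinite, hence the Gram matrix of an array in the infinite-dimensional Hilbert space,
  and this array satisfies the comparison exactly (\<open>gram_of_approximate_gram\<close>).

  Since each step may lose a factor close to 1, curves of almost minimal length take the place of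
  geodesics, and an arbitrary chart takes the place of the exponential map.
\<close>

section \<open>Positive semidefinite matrices as Gram matrices\<close>

lemma finite_family_convergent_subseq:
  fixes f :: "'i \<Rightarrow> nat \<Rightarrow> real"
  assumes "finite S" and "\<And>i. i \<in> S \<Longrightarrow> bounded (range (f i))"
  shows "\<exists>r. strict_mono r \<and> (\<forall>i\<in>S. convergent (f i \<circ> r))"
  using assms
proof (induction S rule: finite_induct)
  case empty
  show ?case by (auto intro!: exI[of _ id] strict_mono_id)
next
  case (insert s S)
  have "\<exists>r. strict_mono r \<and> (\<forall>i\<in>S. convergent (f i \<circ> r))"
    by (rule insert.IH) (simp add: insert.prems)
  then obtain r where r: "strict_mono r" "\<forall>i\<in>S. convergent (f i \<circ> r)" by blast
  have "bounded (range (f s \<circ> r))"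
    by (rule bounded_subset[OF insert.prems[of s]]) auto
  then obtain l q where q: "strict_mono q" "((f s \<circ> r) \<circ> q) \<longlonglongrightarrow> l"
    using bounded_imp_convergent_subsequence by blast
  have "convergent (f i \<circ> (r \<circ> q))" if "i \<in> S" for i
    using convergent_subseq_convergent[of "f i \<circ> r" q] r q(1) that by (simp add: o_assoc)
  moreover have "convergent (f s \<circ> (r \<circ> q))"
    using q(2) by (auto simp: convergent_def o_assoc)
  ultimately show ?case
    using strict_mono_o[OF r(1) q(1)] by blast
qed

text \<open>A vector outside the span, minus its projection to the span, normalised.\<close>

lemma unit_vector_orthogonal_to_finite_set:
  fixes S :: "'h::real_inner set"
  assumes infinite_dim: "\<nexists>B::'h set. finite B \<and> span B = UNIV" and "finite S"
  obtains f where "norm f = 1" "\<And>x. x \<in> S \<Longrightarrow> inner f x = 0"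
proof -
  obtain C where C: "finite C" "span C = span S" "pairwise orthogonal C"
    using basis_orthogonal[OF \<open>finite S\<close>] by auto
  obtain x where x: "x \<notin> span C"
    using infinite_dim C(1) by blast
  define y where "y = x - (\<Sum>b\<in>C. (inner b x / inner b b) *\<^sub>R b)"
  have orth: "inner y c = 0" if "c \<in> C" for c
  proof -
    have "inner (\<Sum>b\<in>C. (inner b x / inner b b) *\<^sub>R b) c
        = (\<Sum>b\<in>C. (inner b x / inner b b) * inner b c)"
      by (simp add: inner_sum_left)
    also have "\<dots> = (inner c x / inner c c) * inner c c"
      by (subst sum.remove[OF C(1) that])
         (use C(3) that in \<open>auto simp: pairwise_def orthogonal_def intro!: sum.neutral\<close>)
    also have "\<dots> = inner x c"
      by (cases "c = 0") (auto simp: inner_commute)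
    finally show ?thesis by (simp add: y_def inner_diff_left)
  qed
  have "y \<noteq> 0"
  proof
    assume "y = 0"
    then have "x = (\<Sum>b\<in>C. (inner b x / inner b b) *\<^sub>R b)" by (simp add: y_def)
    also have "\<dots> \<in> span C" by (intro span_sum span_scale span_base)
    finally show False using x by simp
  qed
  have "orthogonal y z" if "z \<in> S" for z
    by (rule orthogonal_to_span[of z C]) (use that orth C(2) in \<open>auto simp: orthogonal_def span_base\<close>)
  then show ?thesis
    using \<open>y \<noteq> 0\<close> by (intro that[of "y /\<^sub>R norm y"]) (auto simp: orthogonal_def)
qed

definition psd_on :: "'v set \<Rightarrow> ('v \<Rightarrow> 'v \<Rightarrow> real) \<Rightarrow> bool" where
  "psd_on V M \<longleftrightarrow> (\<forall>i\<in>V. \<forall>j\<in>V. M i j = M j i) \<and>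
     (\<forall>c. 0 \<le> (\<Sum>i\<in>V. \<Sum>j\<in>V. c i * c j * M i j))"

lemma psd_onD_sym: "psd_on V M \<Longrightarrow> i \<in> V \<Longrightarrow> j \<in> V \<Longrightarrow> M i j = M j i"
  unfolding psd_on_def by blast

lemma psd_onD_nonneg: "psd_on V M \<Longrightarrow> 0 \<le> (\<Sum>i\<in>V. \<Sum>j\<in>V. c i * c j * M i j)"
  unfolding psd_on_def by (elim conjE allE)

lemma psd_on_sum_insert:
  fixes M :: "'v \<Rightarrow> 'v \<Rightarrow> real"
  assumes "finite V" "v \<notin> V" "\<forall>i\<in>insert v V. \<forall>j\<in>insert v V. M i j = M j i"
  shows "(\<Sum>i\<in>insert v V. \<Sum>j\<in>insert v V. c i * c j * M i j)
    = c v ^ 2 * M v v + 2 * c v * (\<Sum>i\<in>V. c i * M v i) + (\<Sum>i\<in>V. \<Sum>j\<in>V. c i * c j * M i j)"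
proof -
  have "(\<Sum>i\<in>V. c i * c v * M i v) = c v * (\<Sum>i\<in>V. c i * M v i)"
    unfolding sum_distrib_left
  proof (intro sum.cong refl)
    fix i assume "i \<in> V"
    then have "M i v = M v i" using assms(3) by blast
    then show "c i * c v * M i v = c v * (c i * M v i)" by simp
  qed
  moreover have "(\<Sum>i\<in>V. c v * c i * M v i) = c v * (\<Sum>i\<in>V. c i * M v i)"
    unfolding sum_distrib_left by (intro sum.cong) auto
  ultimately show ?thesis
    using assms(1,2) by (simp add: sum.distrib power2_eq_square algebra_simps)
qed

lemma affine_nonneg_imp_zero:
  fixes a b :: real
  assumes "\<And>t. 0 \<le> a * t + b"
  shows "a = 0"
proof (rule ccontr)
  assume "a \<noteq> 0"
  then have "a * (- (b + 1) / a) + b < 0" by simp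
  with assms show False by (meson not_less)
qed

text \<open>Minimising the quadratic form over the coordinate of \<open>v\<close> leaves the form of the Schur complement.
  When \<open>M v v = 0\<close>, division by zero makes the complement the restriction of \<open>M\<close> to \<open>V\<close>, which is
  right since the row of \<open>v\<close> vanishes then.\<close>

lemma psd_on_schur_complement:
  assumes V: "finite V" "v \<notin> V" and psd: "psd_on (insert v V) M"
  shows "M v v \<ge> 0" and "M v v = 0 \<Longrightarrow> \<forall>i\<in>V. M v i = 0"
    and "psd_on V (\<lambda>i j. M i j - M v i * M v j / M v v)"
proof -
  have sym: "\<forall>i\<in>insert v V. \<forall>j\<in>insert v V. M i j = M j i"
    using psd unfolding psd_on_def by (rule conjunct1)
  have nonneg: "0 \<le> c v ^ 2 * M v v + 2 * c v * (\<Sum>i\<in>V. c i * M v i) + (\<Sum>i\<in>V. \<Sum>j\<in>V. c i * c j * M i j)"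
      for c
    unfolding psd_on_sum_insert[OF V sym, symmetric]
    using psd unfolding psd_on_def by (elim conjE allE)
  show vv: "M v v \<ge> 0"
  proof -
    define c where "c = (\<lambda>i. if i = v then 1 else 0::real)"
    have c: "c v = 1" "\<And>i. i \<in> V \<Longrightarrow> c i = 0"
      using V by (auto simp: c_def)
    then show ?thesis using nonneg[of c] by simp
  qed
  show zero: "\<forall>i\<in>V. M v i = 0" if "M v v = 0"
  proof
    fix i assume i: "i \<in> V"
    have "0 \<le> (2 * M v i) * t + M i i" for t
    proof -
      define c where "c = (\<lambda>j. if j = v then t else if j = i then 1 else 0::real)"
      have c: "c v = t" "\<And>j. j \<in> V \<Longrightarrow> c j = (if j = i then 1 else 0)"
        using V by (auto simp: c_def)
      have "(\<Sum>j\<in>V. c j * M v j) = (\<Sum>j\<in>V. if j = i then M v i else 0)"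
        by (intro sum.cong) (auto simp: c)
      moreover have "(\<Sum>j\<in>V. \<Sum>k\<in>V. c j * c k * M j k)
          = (\<Sum>j\<in>V. if j = i then (\<Sum>k\<in>V. if k = i then M i i else 0) else 0)"
        by (intro sum.cong) (auto simp: c intro!: sum.cong)
      ultimately show ?thesis
        using nonneg[of c] i V(1) that by (simp add: c algebra_simps)
    qed
    from affine_nonneg_imp_zero[OF this] show "M v i = 0" by simp
  qed
  show "psd_on V (\<lambda>i j. M i j - M v i * M v j / M v v)"
    unfolding psd_on_def
  proof (intro conjI ballI allI)
    fix i j assume "i \<in> V" "j \<in> V"
    then have "M i j = M j i" using sym by blast
    then show "M i j - M v i * M v j / M v v = M j i - M v j * M v i / M v v"
      by simp
  next
    fix c :: "'a \<Rightarrow> real"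
    define s where "s = (\<Sum>i\<in>V. c i * M v i)"
    have s2: "(\<Sum>i\<in>V. \<Sum>j\<in>V. c i * c j * (M v i * M v j / M v v)) = s ^ 2 / M v v"
      unfolding s_def power2_eq_square sum_product sum_divide_distrib
      by (intro sum.cong) (auto simp: algebra_simps)
    define e where "e = (\<lambda>i. if i = v then - s / M v v else c i)"
    have e: "e v = - s / M v v" "\<And>i. i \<in> V \<Longrightarrow> e i = c i"
      using V by (auto simp: e_def)
    have "0 \<le> e v ^ 2 * M v v + 2 * e v * s + (\<Sum>i\<in>V. \<Sum>j\<in>V. c i * c j * M i j)"
      using nonneg[of e] e(2) by (simp add: s_def cong: sum.cong)
    also have "e v ^ 2 * M v v + 2 * e v * s = - (s ^ 2 / M v v)"
      by (cases "M v v = 0") (auto simp: e(1) field_simps power2_eq_square)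
    finally show "0 \<le> (\<Sum>i\<in>V. \<Sum>j\<in>V. c i * c j * (M i j - M v i * M v j / M v v))"
      using s2 by (simp add: right_diff_distrib sum_subtractf)
  qed
qed

text \<open>Cholesky decomposition: realise the Schur complement of the new diagonal entry by induction, and
  use one new direction, orthogonal to all previous vectors, for the row of the new index. Infinite
  dimension guarantees that such a direction is always left.\<close>

lemma psd_on_imp_gram:
  assumes infinite_dim: "\<nexists>B::'h::real_inner set. finite B \<and> span B = UNIV"
    and "finite V" and "psd_on V M"
  shows "\<exists>b::'v \<Rightarrow> 'h. \<forall>i\<in>V. \<forall>j\<in>V. inner (b i) (b j) = M i j"
  using assms(2,3)
proof (induction V arbitrary: M rule: finite_induct)
  case empty
  show ?case by simp
next
  case (insert v V)
  note schur = psd_on_schur_complement[OF insert.hyps insert.prems]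
  obtain b :: "'v \<Rightarrow> 'h" where b: "\<forall>i\<in>V. \<forall>j\<in>V. inner (b i) (b j) = M i j - M v i * M v j / M v v"
    using insert.IH[OF schur(3)] by blast
  obtain f :: 'h where f: "norm f = 1" "\<And>i. i \<in> V \<Longrightarrow> inner f (b i) = 0"
    using unit_vector_orthogonal_to_finite_set[OF infinite_dim finite_imageI[OF insert.hyps(1)], of b]
    by (metis imageI)
  have ff: "inner f f = 1" using f(1) by (simp add: norm_eq_1)
  have bf: "inner (b i) f = 0" if "i \<in> V" for i using f(2)[OF that] by (simp add: inner_commute)
  define c where "c = (\<lambda>i. if i = v then sqrt (M v v) *\<^sub>R f else b i + (M v i / sqrt (M v v)) *\<^sub>R f)"
  have sq: "sqrt (M v v) * sqrt (M v v) = M v v" using schur(1) by simp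
  have sym: "M i v = M v i" if "i \<in> V" for i
    using insert.prems that unfolding psd_on_def by blast
  have vi: "sqrt (M v v) * M v i / sqrt (M v v) = M v i" if "i \<in> V" for i
    using schur(2) that by (cases "M v v = 0") auto
  have "inner (c i) (c j) = M i j" if ij: "i \<in> insert v V" "j \<in> insert v V" for i j
  proof (cases "i = v"; cases "j = v")
    assume "i = v" "j = v"
    then show ?thesis using sq by (simp add: c_def ff)
  next
    assume "i = v" "j \<noteq> v"
    then show ?thesis using ij f(2) vi by (simp add: c_def ff inner_add_right)
  next
    assume "i \<noteq> v" "j = v"
    then show ?thesis using ij bf vi sym by (simp add: c_def ff inner_add_left)
  next
    assume "i \<noteq> v" "j \<noteq> v"
    then have "i \<in> V" "j \<in> V" using ij by auto
    then show ?thesis using \<open>i \<noteq> v\<close> \<open>j \<noteq> v\<close> f(2) bf b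
      by (simp add: c_def ff inner_add_left inner_add_right sq schur(1) mult.commute)
  qed
  then show ?case by blast
qed

lemma bilinear_sum_scaled:
  fixes B :: "'e::real_vector \<Rightarrow> 'e \<Rightarrow> real"
  assumes "bilinear B"
  shows "B (\<Sum>i\<in>V. c i *\<^sub>R u i) (\<Sum>j\<in>W. c' j *\<^sub>R u' j) = (\<Sum>i\<in>V. \<Sum>j\<in>W. c i * c' j * B (u i) (u' j))"
proof -
  have l: "linear (\<lambda>x. B x y)" and r: "linear (B x)" for x y
    using assms by (auto simp: bilinear_def)
  have "B (\<Sum>i\<in>V. c i *\<^sub>R u i) (\<Sum>j\<in>W. c' j *\<^sub>R u' j)
      = (\<Sum>i\<in>V. B (c i *\<^sub>R u i) (\<Sum>j\<in>W. c' j *\<^sub>R u' j))"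
    by (simp only: linear_sum[OF l])
  also have "\<dots> = (\<Sum>i\<in>V. \<Sum>j\<in>W. B (c i *\<^sub>R u i) (c' j *\<^sub>R u' j))"
    by (simp only: linear_sum[OF r])
  also have "\<dots> = (\<Sum>i\<in>V. \<Sum>j\<in>W. c i * c' j * B (u i) (u' j))"
    by (simp add: bilinear_lmul[OF assms] bilinear_rmul[OF assms] mult.assoc mult.left_commute)
  finally show ?thesis .
qed

lemma bilinear_diff_self:
  fixes B :: "'e::real_vector \<Rightarrow> 'e \<Rightarrow> real"
  assumes "bilinear B" and "\<And>v w. B v w = B w v"
  shows "B (u - v) (u - v) = B u u + B v v - 2 * B u v"
  using assms(2)[of v u] by (simp add: bilinear_lsub[OF assms(1)] bilinear_rsub[OF assms(1)])

lemma psd_on_bilinear: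
  assumes "bilinear B" and "\<And>v w. B v w = B w v" and "\<And>v. 0 \<le> B v v"
  shows "psd_on V (\<lambda>i j. B (u i) (u j) :: real)"
  unfolding psd_on_def bilinear_sum_scaled[OF assms(1), symmetric] using assms(2,3) by blast

lemma psd_on_sum_scaled:
  assumes "\<And>k. k \<in> K \<Longrightarrow> psd_on V (M k)" and "0 \<le> c"
  shows "psd_on V (\<lambda>i j. c * (\<Sum>k\<in>K. M k i j))"
proof -
  have eq: "(\<Sum>i\<in>V. \<Sum>j\<in>V. e i * e j * (c * (\<Sum>k\<in>K. M k i j)))
      = c * (\<Sum>k\<in>K. \<Sum>i\<in>V. \<Sum>j\<in>V. e i * e j * M k i j)" for e
  proof -
    have "(\<Sum>i\<in>V. \<Sum>j\<in>V. e i * e j * (c * (\<Sum>k\<in>K. M k i j)))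
        = c * (\<Sum>i\<in>V. \<Sum>j\<in>V. \<Sum>k\<in>K. e i * e j * M k i j)"
      by (simp add: sum_distrib_left mult.left_commute)
    also have "(\<Sum>i\<in>V. \<Sum>j\<in>V. \<Sum>k\<in>K. e i * e j * M k i j) = (\<Sum>i\<in>V. \<Sum>k\<in>K. \<Sum>j\<in>V. e i * e j * M k i j)"
      by (intro sum.cong refl sum.swap)
    also have "\<dots> = (\<Sum>k\<in>K. \<Sum>i\<in>V. \<Sum>j\<in>V. e i * e j * M k i j)"
      by (rule sum.swap)
    finally show ?thesis .
  qed
  have nonneg: "0 \<le> (\<Sum>k\<in>K. \<Sum>i\<in>V. \<Sum>j\<in>V. e i * e j * M k i j)" for e
    by (rule sum_nonneg) (rule psd_onD_nonneg[OF assms(1)])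
  have sym: "(\<Sum>k\<in>K. M k i j) = (\<Sum>k\<in>K. M k j i)" if "i \<in> V" "j \<in> V" for i j
  proof (intro sum.cong refl)
    fix k assume "k \<in> K"
    from assms(1)[OF this] that show "M k i j = M k j i" unfolding psd_on_def by blast
  qed
  show ?thesis
    unfolding psd_on_def
  proof (intro conjI ballI allI)
    fix i j assume ij: "i \<in> V" "j \<in> V"
    show "c * (\<Sum>k\<in>K. M k i j) = c * (\<Sum>k\<in>K. M k j i)" by (simp only: sym[OF ij])
  next
    fix e
    show "0 \<le> (\<Sum>i\<in>V. \<Sum>j\<in>V. e i * e j * (c * (\<Sum>k\<in>K. M k i j)))"
      unfolding eq by (intro mult_nonneg_nonneg assms(2) nonneg)
  qed
qed

lemma psd_on_abs_le:
  assumes "psd_on V M" "finite V" "i \<in> V" "j \<in> V"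
  shows "\<bar>M i j\<bar> \<le> (M i i + M j j) / 2"
proof (cases "i = j")
  case True
  define c where "c k = (if k = i then 1 else 0::real)" for k
  have "(\<Sum>k\<in>V. \<Sum>l\<in>V. c k * c l * M k l) = (\<Sum>k\<in>V. if k = i then (\<Sum>l\<in>V. if l = i then M i i else 0) else 0)"
    by (intro sum.cong refl) (auto simp: c_def intro!: sum.cong)
  also have "\<dots> = M i i" using assms by simp
  finally have "0 \<le> M i i" using psd_onD_nonneg[OF assms(1), of c] by simp
  then show ?thesis using True by simp
next
  case False
  have sym: "M i j = M j i" by (rule psd_onD_sym[OF assms(1,3,4)])
  have "0 \<le> M i i + M j j + 2 * s * M i j" if s: "s * s = 1" for s
  proof -
    define c where "c k = (if k = i then 1 else if k = j then s else 0::real)" for k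
    have in1: "(\<Sum>l\<in>V. c k * c l * M k l) = c k * (M k i + s * M k j)" for k
    proof -
      have "(\<Sum>l\<in>V. c k * c l * M k l)
          = (\<Sum>l\<in>V. (if l = i then c k * M k i else 0) + (if l = j then c k * s * M k j else 0))"
        by (intro sum.cong refl) (use False in \<open>auto simp: c_def\<close>)
      then show ?thesis using assms by (simp add: sum.distrib algebra_simps)
    qed
    have "(\<Sum>k\<in>V. c k * (M k i + s * M k j))
        = (\<Sum>k\<in>V. (if k = i then M i i + s * M i j else 0) + (if k = j then s * (M j i + s * M j j) else 0))"
      by (intro sum.cong refl) (use False in \<open>auto simp: c_def\<close>)
    also have "\<dots> = M i i + s * M i j + s * (M j i + s * M j j)"
      using assms by (simp add: sum.distrib)
    also have "\<dots> = M i i + (s * s) * M j j + 2 * s * M i j" using sym by (simp add: algebra_simps)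
    finally show ?thesis
      using psd_onD_nonneg[OF assms(1), of c] s unfolding in1 by simp
  qed
  from this[of 1] this[of "-1"] show ?thesis by simp
qed

lemma psd_on_limit:
  assumes "\<And>n. psd_on V (M n)" and "\<And>i j. i \<in> V \<Longrightarrow> j \<in> V \<Longrightarrow> (\<lambda>n. M n i j) \<longlonglongrightarrow> L i j"
  shows "psd_on V L"
  unfolding psd_on_def
proof (intro conjI ballI allI)
  fix i j assume ij: "i \<in> V" "j \<in> V"
  have "M n i j = M n j i" for n using assms(1)[of n] ij unfolding psd_on_def by blast
  then show "L i j = L j i"
    using assms(2)[OF ij] assms(2)[OF ij(2,1)] by (simp add: LIMSEQ_unique)
next
  fix c :: "'a \<Rightarrow> real"
  have "(\<lambda>n. \<Sum>i\<in>V. \<Sum>j\<in>V. c i * c j * M n i j) \<longlonglongrightarrow> (\<Sum>i\<in>V. \<Sum>j\<in>V. c i * c j * L i j)"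
    by (intro tendsto_sum tendsto_mult tendsto_const assms(2))
  then show "0 \<le> (\<Sum>i\<in>V. \<Sum>j\<in>V. c i * c j * L i j)"
    by (rule LIMSEQ_le_const) (use assms(1) in \<open>auto simp: psd_on_def\<close>)
qed

text \<open>The squared distances in an array with Gram matrix \<open>M\<close> satisfy the comparison with \<open>D\<close> up to \<open>\<epsilon>\<close>;
  \<open>F\<close> is the set of pairs on which equality is aimed at.\<close>

definition almost_gram ::
  "'v set \<Rightarrow> ('v \<times> 'v) set \<Rightarrow> ('v \<Rightarrow> 'v \<Rightarrow> real) \<Rightarrow> real \<Rightarrow> ('v \<Rightarrow> 'v \<Rightarrow> real) \<Rightarrow> bool" where
  "almost_gram V F D \<epsilon> M \<longleftrightarrow> psd_on V M \<and>
     (\<forall>i\<in>V. \<forall>j\<in>V. ((1 - \<epsilon>) * D i j)\<^sup>2 \<le> M i i + M j j - 2 * M i j \<and>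
          ((i, j) \<in> F \<longrightarrow> M i i + M j j - 2 * M i j \<le> ((1 + \<epsilon>) * (D i j + \<epsilon>))\<^sup>2))"

text \<open>Bounded diagonals bound all entries of positive semidefinite matrices, so the approximating Gram
  matrices have a limit point. This turns the approximate comparison, with an error \<open>\<epsilon>\<close>, into the
  exact one without bounding the dimension in which the approximations live.\<close>

lemma gram_of_approximate_gram:
  fixes D :: "'v \<Rightarrow> 'v \<Rightarrow> real"
  assumes infinite_dim: "\<nexists>B::'h::real_inner set. finite B \<and> span B = UNIV" and V: "finite V"
    and D: "\<And>i j. i \<in> V \<Longrightarrow> j \<in> V \<Longrightarrow> 0 \<le> D i j"
    and approx: "\<And>\<epsilon>. 0 < \<epsilon> \<Longrightarrow> \<epsilon> < 1 \<Longrightarrow> \<exists>M. almost_gram V F D \<epsilon> M \<and> (\<forall>i\<in>V. M i i \<le> K)"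
  shows "\<exists>b::'v \<Rightarrow> 'h. \<forall>i\<in>V. \<forall>j\<in>V. D i j \<le> dist (b i) (b j) \<and>
      ((i, j) \<in> F \<longrightarrow> dist (b i) (b j) = D i j)"
proof -
  \<comment> \<open>the shift by 2 keeps \<open>e n\<close> below 1 for all \<open>n\<close>\<close>
  define e where "e n = 1 / (real n + 2)" for n
  have e: "0 < e n" "e n < 1" for n by (auto simp: e_def)
  have e_lim: "e \<longlonglongrightarrow> 0" unfolding e_def by real_asymp
  obtain M where M: "\<And>n. psd_on V (M n)" "\<And>n i. i \<in> V \<Longrightarrow> M n i i \<le> K"
    and lower: "\<And>n i j. i \<in> V \<Longrightarrow> j \<in> V \<Longrightarrow> ((1 - e n) * D i j)\<^sup>2 \<le> M n i i + M n j j - 2 * M n i j"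
    and upper: "\<And>n i j. i \<in> V \<Longrightarrow> j \<in> V \<Longrightarrow> (i, j) \<in> F \<Longrightarrow>
        M n i i + M n j j - 2 * M n i j \<le> ((1 + e n) * (D i j + e n))\<^sup>2"
  proof -
    have "\<forall>n. \<exists>M. almost_gram V F D (e n) M \<and> (\<forall>i\<in>V. M i i \<le> K)"
      using approx[OF e] by blast
    then obtain M where "\<forall>n. almost_gram V F D (e n) (M n) \<and> (\<forall>i\<in>V. M n i i \<le> K)"
      by (auto dest: choice)
    then show ?thesis by (intro that[of M]) (simp_all add: almost_gram_def)
  qed
  have "bounded (range (\<lambda>n. M n i j))" if "i \<in> V" "j \<in> V" for i j
  proof (rule boundedI)
    fix x assume "x \<in> range (\<lambda>n. M n i j)"
    then obtain n where "x = M n i j" by auto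
    then show "norm x \<le> K"
      using psd_on_abs_le[OF M(1) V that, of n] M(2)[of i n] M(2)[of j n] that by simp
  qed
  then have "\<exists>r. strict_mono r \<and> (\<forall>p\<in>V \<times> V. convergent ((\<lambda>n. M n (fst p) (snd p)) \<circ> r))"
    using V by (intro finite_family_convergent_subseq) auto
  then obtain r where r: "strict_mono r" "\<And>i j. i \<in> V \<Longrightarrow> j \<in> V \<Longrightarrow> convergent (\<lambda>n. M (r n) i j)"
    by (auto simp: o_def)
  define L where "L i j = lim (\<lambda>n. M (r n) i j)" for i j
  have L: "(\<lambda>n. M (r n) i j) \<longlonglongrightarrow> L i j" if "i \<in> V" "j \<in> V" for i j
    using r(2)[OF that] by (simp add: L_def convergent_LIMSEQ_iff)
  have "psd_on V L" by (rule psd_on_limit[OF M(1) L])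
  then obtain b :: "'v \<Rightarrow> 'h" where b: "\<forall>i\<in>V. \<forall>j\<in>V. inner (b i) (b j) = L i j"
    using psd_on_imp_gram[OF infinite_dim V] by blast
  have er: "(\<lambda>n. e (r n)) \<longlonglongrightarrow> 0"
    using LIMSEQ_subseq_LIMSEQ[OF e_lim r(1)] by (simp add: o_def)
  show ?thesis
  proof (intro exI[of _ b] ballI conjI impI)
    fix i j assume ij: "i \<in> V" "j \<in> V"
    have dist2: "(dist (b i) (b j))\<^sup>2 = L i i + L j j - 2 * L i j"
    proof -
      have "L j i = L i j" using b ij by (metis inner_commute)
      then show ?thesis
        using b ij by (simp add: dist_norm power2_norm_eq_inner inner_diff_left inner_diff_right)
    qed
    have lim: "(\<lambda>n. M (r n) i i + M (r n) j j - 2 * M (r n) i j) \<longlonglongrightarrow> (dist (b i) (b j))\<^sup>2"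
      unfolding dist2 using ij by (intro tendsto_intros L)
    have "(\<lambda>n. ((1 - e (r n)) * D i j)\<^sup>2) \<longlonglongrightarrow> ((1 - 0) * D i j)\<^sup>2"
      by (intro tendsto_intros er)
    then have "((1 - 0) * D i j)\<^sup>2 \<le> (dist (b i) (b j))\<^sup>2"
      by (rule LIMSEQ_le[OF _ lim]) (use lower ij in blast)
    then have "(D i j)\<^sup>2 \<le> (dist (b i) (b j))\<^sup>2" by simp
    then show ge: "D i j \<le> dist (b i) (b j)"
      by (rule power2_le_imp_le) (rule zero_le_dist)
    assume F: "(i, j) \<in> F"
    have "(\<lambda>n. ((1 + e (r n)) * (D i j + e (r n)))\<^sup>2) \<longlonglongrightarrow> ((1 + 0) * (D i j + 0))\<^sup>2"
      by (intro tendsto_intros er)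
    then have "(dist (b i) (b j))\<^sup>2 \<le> ((1 + 0) * (D i j + 0))\<^sup>2"
      by (rule LIMSEQ_le[OF lim]) (use upper ij F in blast)
    then have "dist (b i) (b j) \<le> D i j"
      using D[OF ij] by (auto intro: power2_le_imp_le)
    then show "dist (b i) (b j) = D i j" using ge by simp
  qed
qed

section \<open>Labellings of trees\<close>

lemma sym_adj_rel: "sym (adj_rel E)"
  by (auto simp: adj_rel_def sym_def insert_commute)

lemma rtrancl_imp_simple_path:
  assumes "(a, b) \<in> r\<^sup>*"
  shows "\<exists>vs. vs \<noteq> [] \<and> hd vs = a \<and> last vs = b \<and> distinct vs \<and> successively (\<lambda>x y. (x, y) \<in> r) vs"
  using assms
proof (induction rule: converse_rtrancl_induct)
  case base
  show ?case by (intro exI[of _ "[b]"]) auto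
next
  case (step a a')
  then obtain vs where vs: "vs \<noteq> []" "hd vs = a'" "last vs = b" "distinct vs"
    "successively (\<lambda>x y. (x, y) \<in> r) vs" by blast
  show ?case
  proof (cases "a \<in> set vs")
    case True
    then obtain ys zs where "vs = ys @ a # zs" by (meson split_list)
    then show ?thesis using vs
      by (intro exI[of _ "a # zs"]) (auto simp: successively_append_iff)
  next
    case False
    then show ?thesis using vs step(1)
      by (intro exI[of _ "a # vs"]) (auto simp: successively_Cons)
  qed
qed

text \<open>Two neighbours of \<open>j\<close> in \<open>U\<close> would be joined by a simple path inside \<open>U\<close>, and \<open>j\<close> would close
  this path to a cycle.\<close>

lemma unique_neighbour_in_connected_subset:
  assumes acyclic: "\<nexists>vs. graph_cycle E vs" and "j \<notin> U" and U: "i \<in> U" "i' \<in> U"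
    and conn: "(i, i') \<in> (adj_rel E \<inter> U \<times> U)\<^sup>*"
    and adj: "(i, j) \<in> adj_rel E" "(i', j) \<in> adj_rel E"
  shows "i = i'"
proof (rule ccontr)
  assume "i \<noteq> i'"
  obtain vs where vs: "vs \<noteq> []" "hd vs = i" "last vs = i'" "distinct vs"
    and succ: "successively (\<lambda>x y. (x, y) \<in> adj_rel E \<inter> U \<times> U) vs"
    using rtrancl_imp_simple_path[OF conn] by blast
  have "length vs \<ge> 2"
    using vs \<open>i \<noteq> i'\<close> by (cases vs; cases "tl vs") auto
  have "set vs \<subseteq> U"
  proof
    fix x assume "x \<in> set vs"
    then obtain k where k: "k < length vs" "x = vs ! k" by (auto simp: in_set_conv_nth)
    show "x \<in> U"
    proof (cases k)
      case 0
      then show ?thesis using vs k U by (simp add: hd_conv_nth)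
    next
      case (Suc l)
      then show ?thesis using succ k by (auto simp: successively_conv_nth)
    qed
  qed
  have succ': "successively (\<lambda>x y. (x, y) \<in> adj_rel E) (vs @ [j])"
    using succ vs adj by (auto simp: successively_append_iff elim: successively_mono)
  have "graph_cycle E (vs @ [j])"
    unfolding graph_cycle_def
  proof (intro conjI allI impI)
    show "3 \<le> length (vs @ [j])" using \<open>length vs \<ge> 2\<close> by simp
    show "distinct (vs @ [j])" using vs \<open>set vs \<subseteq> U\<close> \<open>j \<notin> U\<close> by auto
    fix k assume k: "k < length (vs @ [j])"
    show "((vs @ [j]) ! k, (vs @ [j]) ! (Suc k mod length (vs @ [j]))) \<in> adj_rel E"
    proof (cases "Suc k < length (vs @ [j])")
      case True
      then show ?thesis using succ' by (simp only: successively_conv_nth mod_less)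
    next
      case False
      then have "k = length vs" using k by simp
      moreover have "(j, i) \<in> adj_rel E" using adj(1) sym_adj_rel by (rule symD[rotated])
      ultimately show ?thesis using vs by (simp add: nth_append hd_conv_nth)
    qed
  qed
  then show False using acyclic by blast
qed

text \<open>Grow a connected set of labelled vertices from the root, one vertex at a time. A new vertex has
  exactly one neighbour in the set, so its label has to satisfy a single constraint.\<close>

lemma tree_labelling:
  assumes tree: "finite_tree V E" and r: "r \<in> V" "u0 \<in> S r"
    and step: "\<And>i j u. (i, j) \<in> adj_rel E \<Longrightarrow> u \<in> S i \<Longrightarrow> \<exists>w\<in>S j. R i j u w"
    and sym: "\<And>i j u w. (i, j) \<in> adj_rel E \<Longrightarrow> u \<in> S i \<Longrightarrow> w \<in> S j \<Longrightarrow> R i j u w \<Longrightarrow> R j i w u"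
  obtains x where "x r = u0" "\<forall>i\<in>V. x i \<in> S i" "\<forall>(i, j)\<in>adj_rel E. R i j (x i) (x j)"
proof -
  have finV: "finite V" and edges: "\<And>e. e \<in> E \<Longrightarrow> e \<subseteq> V \<and> card e = 2"
    and conn: "\<And>i j. i \<in> V \<Longrightarrow> j \<in> V \<Longrightarrow> (i, j) \<in> (adj_rel E)\<^sup>*"
    and acyclic: "\<nexists>vs. graph_cycle E vs"
    using tree by (auto simp: finite_tree_def)
  define good where "good U x \<longleftrightarrow> r \<in> U \<and> U \<subseteq> V \<and> (\<forall>i\<in>U. (r, i) \<in> (adj_rel E \<inter> U \<times> U)\<^sup>*) \<and>
      x r = u0 \<and> (\<forall>i\<in>U. x i \<in> S i) \<and> (\<forall>(i, j)\<in>adj_rel E \<inter> U \<times> U. R i j (x i) (x j))" for U x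
  have extend: "\<exists>U' x'. good U' x' \<and> card U' = Suc (card U)" if good: "good U x" and ne: "U \<noteq> V" for U x
  proof -
    have finU: "finite U" using good finV finite_subset by (auto simp: good_def)
    have "\<exists>i\<in>U. \<exists>j\<in>V - U. (i, j) \<in> adj_rel E"
    proof (rule ccontr)
      assume "\<not> ?thesis"
      then have closed: "j \<in> U" if "i \<in> U" "(i, j) \<in> adj_rel E" for i j
        using that edges by (auto simp: adj_rel_def)
      have "k \<in> U" if "(r, k) \<in> (adj_rel E)\<^sup>*" for k
        using that by (induction rule: rtrancl_induct) (use good closed in \<open>auto simp: good_def\<close>)
      then have "V \<subseteq> U" using conn r by blast
      then show False using ne good by (auto simp: good_def)
    qed
    then obtain i j where ij: "i \<in> U" "j \<in> V" "j \<notin> U" "(i, j) \<in> adj_rel E" by auto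
    have r_conn: "(r, k) \<in> (adj_rel E \<inter> U \<times> U)\<^sup>*" if "k \<in> U" for k
      using good that by (auto simp: good_def)
    have "sym (adj_rel E \<inter> U \<times> U)"
      using sym_adj_rel[of E] by (auto simp: sym_def)
    then have "(k, r) \<in> (adj_rel E \<inter> U \<times> U)\<^sup>*" if "k \<in> U" for k
      using r_conn[OF that] by (meson sym_rtrancl symD)
    then have unique: "k = i" if "k \<in> U" "(k, j) \<in> adj_rel E" for k
      using unique_neighbour_in_connected_subset[OF acyclic ij(3) that(1) ij(1) _ that(2) ij(4)]
        r_conn[OF ij(1)] that(1) by (meson rtrancl_trans)
    obtain w where w: "w \<in> S j" "R i j (x i) w"
      using step[OF ij(4), of "x i"] good ij(1) unfolding good_def by blast
    have no_loop: "(j, j) \<notin> adj_rel E" using edges[of "{j, j}"] by (auto simp: adj_rel_def)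
    have "good (insert j U) (x(j := w))"
      unfolding good_def
    proof (intro conjI ballI)
      show "r \<in> insert j U" "insert j U \<subseteq> V" using good ij by (auto simp: good_def)
      show "(x(j := w)) r = u0" using good ij by (auto simp: good_def)
      show "(x(j := w)) k \<in> S k" if "k \<in> insert j U" for k
        using that good w by (auto simp: good_def)
      have mono: "(adj_rel E \<inter> U \<times> U)\<^sup>* \<subseteq> (adj_rel E \<inter> insert j U \<times> insert j U)\<^sup>*"
        by (intro rtrancl_mono) auto
      show "(r, k) \<in> (adj_rel E \<inter> insert j U \<times> insert j U)\<^sup>*" if "k \<in> insert j U" for k
      proof (cases "k = j")
        case True
        have "(r, i) \<in> (adj_rel E \<inter> insert j U \<times> insert j U)\<^sup>*" using r_conn[OF ij(1)] mono by blast
        then show ?thesis using True ij by (auto intro: rtrancl_into_rtrancl)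
      next
        case False
        then show ?thesis using that r_conn mono by blast
      qed
      fix p assume p: "p \<in> adj_rel E \<inter> insert j U \<times> insert j U"
      obtain k l where kl: "p = (k, l)" by (cases p)
      consider "k \<in> U" "l \<in> U" | "k \<in> U" "l = j" | "k = j" "l \<in> U" | "k = j" "l = j"
        using p kl by auto
      then show "case p of (k, l) \<Rightarrow> R k l ((x(j := w)) k) ((x(j := w)) l)"
      proof cases
        case 1
        then show ?thesis using p kl good ij by (auto simp: good_def)
      next
        case 2
        then have "k = i" using unique p kl by auto
        then show ?thesis using 2 w kl ij by auto
      next
        case 3
        moreover have "(l, j) \<in> adj_rel E" using 3 p kl sym_adj_rel[of E] by (auto dest: symD)
        ultimately have "l = i" using unique 3 by blast
        moreover have "R j i w (x i)"
          using good ij(1) by (intro sym[OF ij(4) _ w]) (auto simp: good_def)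
        ultimately show ?thesis using 3 kl ij by auto
      next
        case 4
        then show ?thesis using no_loop p kl by auto
      qed
    qed
    then show ?thesis using ij finU by (intro exI[of _ "insert j U"]) auto
  qed
  have "\<exists>U x. good U x \<and> card U = Suc n" if "Suc n \<le> card V" for n
    using that
  proof (induction n)
    case 0
    have "good {r} (\<lambda>_. u0)"
      using r edges[of "{r, r}"] by (auto simp: good_def adj_rel_def)
    then show ?case by (intro exI[of _ "{r}"]) auto
  next
    case (Suc n)
    then obtain U x where U: "good U x" "card U = Suc n" by auto
    with Suc.prems have "U \<noteq> V" by auto
    then show ?case using extend U by metis
  qed
  from this[of "card V - 1"] obtain U x where U: "good U x" "card U = card V"
    using r finV by (metis card_gt_0_iff Suc_pred' empty_iff le_refl)
  then have "U = V" using finV by (simp add: card_subset_eq good_def)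
  then show ?thesis
    using U edges by (intro that[of x]) (fastforce simp: good_def adj_rel_def)+
qed

section \<open>Groups with a locally flat bi-invariant length metric\<close>

text \<open>The properties of a bi-invariant Riemannian distance that the comparison rests on. The length
  property is stated as the possibility to subdivide; it makes the product map a submetry. Flatness
  to first order at the unit is stated with a map \<open>\<phi>\<close> to a vector space with the form \<open>B\<close>; for a Lie
  group these are a chart and the metric tensor at the unit. The distance is allowed to be infinite,
  but is finite near the unit by \<open>d_sym\<close> and \<open>d_triangle\<close>, so that \<open>enn2real\<close> loses nothing in \<open>flat\<close>.\<close>

locale locally_flat_length_group = group G for G (structure) +
  fixes d :: "'a \<Rightarrow> 'a \<Rightarrow> ennreal" and \<phi> :: "'a \<Rightarrow> 'e::real_vector" and B :: "'e \<Rightarrow> 'e \<Rightarrow> real"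
  assumes d_refl: "x \<in> carrier G \<Longrightarrow> d x x = 0"
    and d_sym: "x \<in> carrier G \<Longrightarrow> y \<in> carrier G \<Longrightarrow> d x y = d y x"
    and d_triangle: "x \<in> carrier G \<Longrightarrow> y \<in> carrier G \<Longrightarrow> z \<in> carrier G \<Longrightarrow> d x z \<le> d x y + d y z"
    and d_left: "a \<in> carrier G \<Longrightarrow> x \<in> carrier G \<Longrightarrow> y \<in> carrier G \<Longrightarrow> d (a \<otimes> x) (a \<otimes> y) = d x y"
    and d_right: "a \<in> carrier G \<Longrightarrow> x \<in> carrier G \<Longrightarrow> y \<in> carrier G \<Longrightarrow> d (x \<otimes> a) (y \<otimes> a) = d x y"
    and d_subdivide: "x \<in> carrier G \<Longrightarrow> y \<in> carrier G \<Longrightarrow> d x y < ennreal L \<Longrightarrow> 0 < N \<Longrightarrow>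
      \<exists>q. (\<forall>k. q k \<in> carrier G) \<and> q 0 = x \<and> q N = y \<and>
          (\<forall>k<N. d (q k) (q (Suc k)) < ennreal (L / real N))"
    and bilinear_B: "bilinear B" and B_sym: "B v w = B w v" and B_nonneg: "0 \<le> B v v"
    and flat: "0 < \<epsilon> \<Longrightarrow> \<epsilon> < 1 \<Longrightarrow> \<exists>\<delta>>0. \<forall>p\<in>carrier G. \<forall>q\<in>carrier G.
      d \<one> p < ennreal \<delta> \<longrightarrow> d \<one> q < ennreal \<delta> \<longrightarrow>
        (1 - \<epsilon>) * enn2real (d p q) \<le> sqrt (B (\<phi> p - \<phi> q) (\<phi> p - \<phi> q)) \<and>
        sqrt (B (\<phi> p - \<phi> q) (\<phi> p - \<phi> q)) \<le> (1 + \<epsilon>) * enn2real (d p q)"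
begin

lemma two_sided_action_closed:
  "h \<in> carrier (G \<times>\<times> G) \<Longrightarrow> x \<in> carrier G \<Longrightarrow> two_sided_action G h x \<in> carrier G"
  by (cases h) (simp add: two_sided_action_def)

lemma two_sided_action_mult:
  assumes "h \<in> carrier (G \<times>\<times> G)" "k \<in> carrier (G \<times>\<times> G)" "x \<in> carrier G"
  shows "two_sided_action G (h \<otimes>\<^bsub>G \<times>\<times> G\<^esub> k) x = two_sided_action G h (two_sided_action G k x)"
  using assms by (cases h; cases k) (simp add: two_sided_action_def inv_mult_group m_assoc)

lemma d_two_sided_action:
  assumes "h \<in> carrier (G \<times>\<times> G)" "x \<in> carrier G" "y \<in> carrier G"
  shows "d (two_sided_action G h x) (two_sided_action G h y) = d x y"
  using assms by (cases h) (simp add: two_sided_action_def d_left d_right)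

lemma biquotient_subset:
  assumes "subgroup H (G \<times>\<times> G)" "X \<in> biquotient G H"
  shows "X \<subseteq> carrier G" and "X \<noteq> {}"
proof -
  interpret H: subgroup H "G \<times>\<times> G" by fact
  obtain x where "x \<in> carrier G" "X = {two_sided_action G h x |h. h \<in> H}"
    using assms(2) by (auto simp: biquotient_def orbits_def orbit_def)
  then show "X \<subseteq> carrier G" "X \<noteq> {}"
    using H.subset H.one_closed two_sided_action_closed by blast+
qed

lemma biquotient_invariant:
  assumes "subgroup H (G \<times>\<times> G)" "X \<in> biquotient G H" "h \<in> H" "x \<in> X"
  shows "two_sided_action G h x \<in> X"
proof -
  interpret H: subgroup H "G \<times>\<times> G" by fact
  obtain x0 where x0: "x0 \<in> carrier G" "X = {two_sided_action G h x0 |h. h \<in> H}"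
    using assms(2) by (auto simp: biquotient_def orbits_def orbit_def)
  then obtain k where k: "k \<in> H" "x = two_sided_action G k x0" using assms(4) by auto
  have "two_sided_action G h x = two_sided_action G (h \<otimes>\<^bsub>G \<times>\<times> G\<^esub> k) x0"
    using two_sided_action_mult x0(1) k assms(3) H.mem_carrier by simp
  then show ?thesis using x0(2) H.m_closed[OF assms(3) k(1)] by blast
qed

lemma biquotient_transitive:
  assumes "subgroup H (G \<times>\<times> G)" "X \<in> biquotient G H" "x \<in> X" "y \<in> X"
  shows "\<exists>h\<in>H. two_sided_action G h x = y"
proof -
  interpret GG: group "G \<times>\<times> G" by (intro DirProd_group is_group)
  interpret H: subgroup H "G \<times>\<times> G" by fact
  obtain x0 where x0: "x0 \<in> carrier G" "X = {two_sided_action G h x0 |h. h \<in> H}"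
    using assms(2) by (auto simp: biquotient_def orbits_def orbit_def)
  then obtain k l where k: "k \<in> H" "x = two_sided_action G k x0"
    and l: "l \<in> H" "y = two_sided_action G l x0" using assms(3,4) by auto
  let ?h = "l \<otimes>\<^bsub>G \<times>\<times> G\<^esub> inv\<^bsub>G \<times>\<times> G\<^esub> k"
  have h: "?h \<in> H" using k l H.m_closed H.m_inv_closed by blast
  have "two_sided_action G ?h x = two_sided_action G (?h \<otimes>\<^bsub>G \<times>\<times> G\<^esub> k) x0"
    using two_sided_action_mult[of ?h k x0] x0(1) k h H.mem_carrier by simp
  also have "?h \<otimes>\<^bsub>G \<times>\<times> G\<^esub> k = l"
    using k(1) l(1) H.mem_carrier by (simp add: GG.m_assoc del: inv_DirProd)
  finally show ?thesis using h l by blast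
qed

text \<open>The orbit map is a submetry: a pair of points that almost realises the distance of two orbits can
  be moved by \<open>H\<close> so that its first point becomes any given point of the first orbit.\<close>

lemma biquotient_lift:
  assumes H: "subgroup H (G \<times>\<times> G)" and XY: "X \<in> biquotient G H" "Y \<in> biquotient G H"
    and "p \<in> X" and less: "subset_dist d X Y < L"
  shows "\<exists>q\<in>Y. d p q < L"
proof -
  obtain x y where xy: "x \<in> X" "y \<in> Y" "d x y < L"
    using less by (auto simp: subset_dist_def INF_less_iff)
  obtain h where h: "h \<in> H" "two_sided_action G h x = p"
    using biquotient_transitive[OF H XY(1) xy(1) \<open>p \<in> X\<close>] by blast
  have "h \<in> carrier (G \<times>\<times> G)" using h(1) H by (rule subgroup.mem_carrier[rotated])
  then have "d p (two_sided_action G h y) = d x y"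
    using d_two_sided_action[of h x y] xy biquotient_subset(1)[OF H] XY h(2) by auto
  then show ?thesis using biquotient_invariant[OF H XY(2) h(1) xy(2)] xy(3)
    by (intro bexI[of _ "two_sided_action G h y"]) simp_all
qed

lemma subset_dist_le: "x \<in> X \<Longrightarrow> y \<in> Y \<Longrightarrow> subset_dist d X Y \<le> d x y"
  unfolding subset_dist_def by (rule INF_lower2[of "(x, y)"]) auto

lemma subset_dist_sym:
  assumes "X \<subseteq> carrier G" "Y \<subseteq> carrier G"
  shows "subset_dist d X Y = subset_dist d Y X"
proof -
  have le: "subset_dist d X Y \<le> subset_dist d Y X" if "X \<subseteq> carrier G" "Y \<subseteq> carrier G" for X Y
    unfolding subset_dist_def[of _ Y X]
  proof (rule INF_greatest, clarify)
    fix y x assume "y \<in> Y" "x \<in> X"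
    then show "subset_dist d X Y \<le> d y x"
      using subset_dist_le[of x X y Y] d_sym that by (metis subsetD)
  qed
  from le[OF assms] le[OF assms(2,1)] show ?thesis by (rule antisym)
qed

text \<open>A point \<open>(x\<^sub>0, \<dots>, x\<^sub>N\<^sub>-\<^sub>1)\<close> of a power of \<open>G\<close> is represented by the sequence \<open>P\<close> of its partial
  products, starting at the unit; its coordinates are the increments of \<open>P\<close>, and \<open>P N\<close> is the product
  of all coordinates.\<close>

definition increment :: "(nat \<Rightarrow> 'a) \<Rightarrow> nat \<Rightarrow> 'a" where
  "increment P k = inv (P k) \<otimes> P (Suc k)"

lemma increment_closed: "\<forall>k. P k \<in> carrier G \<Longrightarrow> increment P k \<in> carrier G"
  by (simp add: increment_def)

lemma d_mult_le:
  assumes "u \<in> carrier G" "v \<in> carrier G" "u' \<in> carrier G" "v' \<in> carrier G"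
  shows "d (u \<otimes> v) (u' \<otimes> v') \<le> d u u' + d v v'"
  using d_triangle[of "u \<otimes> v" "u' \<otimes> v" "u' \<otimes> v'"] assms by (simp add: d_left d_right)

lemma d_le_sum_increments:
  assumes P: "\<forall>k. P k \<in> carrier G" and Q: "\<forall>k. Q k \<in> carrier G" and "P 0 = Q 0"
  shows "d (P n) (Q n) \<le> (\<Sum>k<n. d (increment P k) (increment Q k))"
proof (induction n)
  case 0
  show ?case using assms by (simp add: d_refl)
next
  case (Suc n)
  have eq: "P (Suc n) = P n \<otimes> increment P n" "Q (Suc n) = Q n \<otimes> increment Q n"
    using P Q by (simp_all add: increment_def m_assoc[symmetric])
  have "d (P (Suc n)) (Q (Suc n)) \<le> d (P n) (Q n) + d (increment P n) (increment Q n)"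
    unfolding eq by (intro d_mult_le increment_closed P Q) (use P Q in auto)
  also have "\<dots> \<le> (\<Sum>k<Suc n. d (increment P k) (increment Q k))"
    using Suc by (simp add: add_right_mono)
  finally show ?case .
qed

text \<open>The product map is a submetry. Subdivide a path from \<open>P N\<close> to \<open>q\<close>, translate it on the right so
  that it starts at the unit, and multiply the partial products by the points \<open>c k\<close> obtained. The
  change of the increment number \<open>k\<close> is then conjugate to \<open>inv (c k) \<otimes> c (Suc k)\<close>, so bi-invariance
  makes it as small as the step of the path.\<close>

lemma lift_to_increments:
  assumes P: "\<forall>k. P k \<in> carrier G" "P 0 = \<one>" and q: "q \<in> carrier G"
    and "0 < N" and less: "d (P N) q < ennreal L"
  shows "\<exists>Q. (\<forall>k. Q k \<in> carrier G) \<and> Q 0 = \<one> \<and> Q N = q \<and>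
      (\<forall>k<N. d (increment P k) (increment Q k) < ennreal (L / N))"
proof -
  obtain s where s: "\<forall>k. s k \<in> carrier G" "s 0 = P N" "s N = q"
    "\<forall>k<N. d (s k) (s (Suc k)) < ennreal (L / real N)"
    using d_subdivide[OF _ q less \<open>0 < N\<close>] P(1) by blast
  define c where "c k = s k \<otimes> inv (P N)" for k
  have c: "c k \<in> carrier G" for k using s(1) P(1) by (simp add: c_def)
  define Q where "Q k = c k \<otimes> P k" for k
  have Q: "Q k \<in> carrier G" for k using c P(1) by (simp add: Q_def)
  have "d (increment P k) (increment Q k) < ennreal (L / N)" if "k < N" for k
  proof -
    have incP: "increment P k = inv (P k) \<otimes> \<one> \<otimes> P (Suc k)"
      using P(1) by (simp add: increment_def)
    have incQ: "increment Q k = inv (P k) \<otimes> (inv (c k) \<otimes> c (Suc k)) \<otimes> P (Suc k)"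
      using P(1) c by (simp add: increment_def Q_def inv_mult_group m_assoc)
    have "d (increment P k) (increment Q k) = d \<one> (inv (c k) \<otimes> c (Suc k))"
      unfolding incP incQ
      using d_right[of "P (Suc k)" "inv (P k) \<otimes> \<one>" "inv (P k) \<otimes> (inv (c k) \<otimes> c (Suc k))"]
        d_left[of "inv (P k)" \<one> "inv (c k) \<otimes> c (Suc k)"] P(1) c by simp
    also have "\<dots> = d (c k \<otimes> \<one>) (c k \<otimes> (inv (c k) \<otimes> c (Suc k)))"
      using d_left[of "c k" \<one> "inv (c k) \<otimes> c (Suc k)"] c by simp
    also have "\<dots> = d (c k) (c (Suc k))"
      using c by (simp add: m_assoc[symmetric])
    also have "\<dots> = d (s k) (s (Suc k))"
      using s(1) P(1) by (simp add: c_def d_right)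
    finally show ?thesis using s(4) that by simp
  qed
  moreover have "Q 0 = \<one>" "Q N = q"
    using P s q by (simp_all add: Q_def c_def m_assoc)
  ultimately show ?thesis using Q by blast
qed

text \<open>Add up the bounds along a path from the root. The constant depends on the tree and on \<open>W\<close>, but not
  on the scale \<open>s\<close>; it bounds the lifted points uniformly when the number of factors grows.\<close>

lemma tree_label_distance_bound:
  fixes W :: "'v \<Rightarrow> 'v \<Rightarrow> real"
  assumes "(r, i) \<in> (adj_rel E)\<^sup>*" and W: "\<And>i j. 0 \<le> W i j"
  shows "\<exists>C\<ge>0. \<forall>s\<ge>0. \<forall>f. (\<forall>i. f i \<in> carrier G) \<longrightarrow>
      (\<forall>(i, j)\<in>adj_rel E. d (f i) (f j) \<le> ennreal (s * W i j)) \<longrightarrow> d (f r) (f i) \<le> ennreal (s * C)"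
  using assms(1)
proof (induction rule: rtrancl_induct)
  case base
  show ?case by (intro exI[of _ 0]) (auto simp: d_refl)
next
  case (step i j)
  then obtain C where C: "C \<ge> 0" "\<And>s f. s \<ge> 0 \<Longrightarrow> (\<forall>i. f i \<in> carrier G) \<Longrightarrow>
      (\<forall>(i, j)\<in>adj_rel E. d (f i) (f j) \<le> ennreal (s * W i j)) \<Longrightarrow> d (f r) (f i) \<le> ennreal (s * C)"
    by blast
  show ?case
  proof (intro exI[of _ "C + W i j"] conjI allI impI)
    show "0 \<le> C + W i j" using C W by simp
    fix s f assume f: "0 \<le> s" "\<forall>i. f i \<in> carrier G" "\<forall>(i, j)\<in>adj_rel E. d (f i) (f j) \<le> ennreal (s * W i j)"
    have "d (f r) (f j) \<le> d (f r) (f i) + d (f i) (f j)" using d_triangle f by blast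
    also have "\<dots> \<le> ennreal (s * C) + ennreal (s * W i j)"
      using C(2)[OF f] f(3) step(2) by (intro add_mono) auto
    also have "\<dots> = ennreal (s * (C + W i j))"
      using f C W by (simp add: distrib_left ennreal_plus)
    finally show "d (f r) (f j) \<le> ennreal (s * (C + W i j))" .
  qed
qed

text \<open>Lift the array to a power of \<open>G\<close> in which all coordinates are close to the unit, and read the
  coordinates in the map \<open>\<phi>\<close>. The bound \<open>K\<close> does not depend on \<open>\<epsilon>\<close>, as
  \<open>gram_of_approximate_gram\<close> requires.\<close>

lemma approximate_gram_biquotient:
  assumes H: "subgroup H (G \<times>\<times> G)" and tree: "finite_tree V E"
    and a: "\<And>i. i \<in> V \<Longrightarrow> a i \<in> biquotient G H"
    and fin: "\<And>i j. i \<in> V \<Longrightarrow> j \<in> V \<Longrightarrow> subset_dist d (a i) (a j) < \<infinity>"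
  defines "D \<equiv> \<lambda>i j. enn2real (subset_dist d (a i) (a j))"
  shows "\<exists>K. \<forall>\<epsilon>. 0 < \<epsilon> \<longrightarrow> \<epsilon> < 1 \<longrightarrow> (\<exists>M. almost_gram V (adj_rel E) D \<epsilon> M \<and> (\<forall>i\<in>V. M i i \<le> K))"
proof -
  have V: "finite V" "V \<noteq> {}" and edge: "\<And>i j. (i, j) \<in> adj_rel E \<Longrightarrow> i \<in> V \<and> j \<in> V"
    and conn: "\<And>i j. i \<in> V \<Longrightarrow> j \<in> V \<Longrightarrow> (i, j) \<in> (adj_rel E)\<^sup>*"
    using tree by (auto simp: finite_tree_def adj_rel_def)
  obtain r where r: "r \<in> V" using V by auto
  have D0: "0 \<le> D i j" for i j by (simp add: D_def)
  have D: "ennreal (D i j) = subset_dist d (a i) (a j)" if "i \<in> V" "j \<in> V" for i j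
    using fin[OF that] by (simp add: D_def)
  have D_sym: "D i j = D j i" if "i \<in> V" "j \<in> V" for i j
    using subset_dist_sym biquotient_subset(1)[OF H a] that by (simp add: D_def)
  obtain p where p: "p \<in> a r" using biquotient_subset(2)[OF H a[OF r]] by auto
  then have p_closed: "p \<in> carrier G" using biquotient_subset(1)[OF H a[OF r]] by auto

  \<comment> \<open>\<open>1\<close> is added to \<open>D\<close> to cover every error \<open>\<epsilon> < 1\<close>; the scale \<open>s\<close> will be \<open>1 / N\<close>.\<close>
  define bounded_by where "bounded_by i C \<longleftrightarrow> (\<forall>s\<ge>0. \<forall>f. (\<forall>i. f i \<in> carrier G) \<longrightarrow>
      (\<forall>(i, j)\<in>adj_rel E. d (f i) (f j) \<le> ennreal (s * (D i j + 1))) \<longrightarrow>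
      d (f r) (f i) \<le> ennreal (s * C))" for i C
  have "\<exists>C\<ge>0. bounded_by i C" if "i \<in> V" for i
    unfolding bounded_by_def
    by (rule tree_label_distance_bound[OF conn[OF r that]]) (use D0 in \<open>simp add: add_nonneg_nonneg\<close>)
  then obtain C where C: "\<And>i. i \<in> V \<Longrightarrow> 0 \<le> C i" and bounded: "\<And>i. i \<in> V \<Longrightarrow> bounded_by i (C i)"
    by metis
  define c where "c = (\<Sum>i\<in>V. C i)"
  have c0: "0 \<le> c" unfolding c_def by (rule sum_nonneg) (rule C)
  have Cc: "C i \<le> c" if "i \<in> V" for i
    unfolding c_def by (rule member_le_sum) (use that C V in auto)

  show ?thesis
  proof (intro exI[of _ "(2 * c)\<^sup>2"] allI impI)
    fix \<epsilon> :: real assume \<epsilon>: "0 < \<epsilon>" "\<epsilon> < 1"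
    obtain \<delta> where \<delta>: "\<delta> > 0" and flat\<delta>: "\<And>p q. p \<in> carrier G \<Longrightarrow> q \<in> carrier G \<Longrightarrow>
        d \<one> p < ennreal \<delta> \<Longrightarrow> d \<one> q < ennreal \<delta> \<Longrightarrow>
        (1 - \<epsilon>) * enn2real (d p q) \<le> sqrt (B (\<phi> p - \<phi> q) (\<phi> p - \<phi> q)) \<and>
        sqrt (B (\<phi> p - \<phi> q) (\<phi> p - \<phi> q)) \<le> (1 + \<epsilon>) * enn2real (d p q)"
      using flat[OF \<epsilon>] by blast
    \<comment> \<open>so many factors that all coordinates of the lifted points lie within \<open>\<delta>\<close> of the unit\<close>
    obtain N where N: "c / \<delta> < real N" "N > 0"
      by (metis gr0I not_less of_nat_0 reals_Archimedean2 c0 \<delta> divide_nonneg_pos)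
    have small: "c / N < \<delta>" using N \<delta> by (simp add: field_simps)

    define S where "S i = {P::nat \<Rightarrow> 'a. (\<forall>k. P k \<in> carrier G) \<and> P 0 = \<one> \<and> p \<otimes> P N \<in> a i}" for i
    define R where "R i j P Q \<longleftrightarrow> (\<forall>k<N. d (increment P k) (increment Q k) < ennreal ((D i j + \<epsilon>) / N))"
      for i j and P Q :: "nat \<Rightarrow> 'a"
    \<comment> \<open>Translating by \<open>p\<close>, the chosen point over the root, places all coordinates of the root at the unit.\<close>
    define P0 where "P0 = (\<lambda>_::nat. \<one>)"
    obtain P where P: "P r = P0" "\<forall>i\<in>V. P i \<in> S i" "\<forall>(i, j)\<in>adj_rel E. R i j (P i) (P j)"
    proof (rule tree_labelling[OF tree r, of P0 S R])
      show "P0 \<in> S r" using p p_closed by (simp add: S_def P0_def)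
    next
      fix i j u assume ij: "(i, j) \<in> adj_rel E" and u: "u \<in> S i"
      then have iV: "i \<in> V" and jV: "j \<in> V" using edge by auto
      have "ennreal (D i j) < ennreal (D i j + \<epsilon>)"
        using D0[of i j] \<epsilon> by (simp add: ennreal_less_iff)
      then have "subset_dist d (a i) (a j) < ennreal (D i j + \<epsilon>)" using D iV jV by simp
      then obtain q where q: "q \<in> a j" "d (p \<otimes> u N) q < ennreal (D i j + \<epsilon>)"
        using biquotient_lift[OF H a a, of i j "p \<otimes> u N"] iV jV u by (auto simp: S_def)
      have q_closed: "q \<in> carrier G" using q(1) biquotient_subset(1)[OF H a[OF jV]] by auto
      have uN: "u N \<in> carrier G" using u by (simp add: S_def)
      have "d (u N) (inv p \<otimes> q) = d (p \<otimes> u N) (p \<otimes> (inv p \<otimes> q))"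
        using p_closed q_closed uN by (simp add: d_left)
      also have "p \<otimes> (inv p \<otimes> q) = q" using p_closed q_closed by (simp add: m_assoc[symmetric])
      finally have "d (u N) (inv p \<otimes> q) < ennreal (D i j + \<epsilon>)" using q(2) by simp
      then obtain Q where Q: "\<forall>k. Q k \<in> carrier G" "Q 0 = \<one>" "Q N = inv p \<otimes> q"
        "\<forall>k<N. d (increment u k) (increment Q k) < ennreal ((D i j + \<epsilon>) / N)"
        using lift_to_increments[of u "inv p \<otimes> q" N "D i j + \<epsilon>"] u N(2) p_closed q_closed
        by (auto simp: S_def)
      have "p \<otimes> Q N = q" using p_closed q_closed by (simp add: Q(3) m_assoc[symmetric])
      then have "Q \<in> S j" using Q q(1) by (simp add: S_def)
      then show "\<exists>w\<in>S j. R i j u w" using Q(4) by (auto simp: R_def)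
    next
      fix i j u w assume ij: "(i, j) \<in> adj_rel E" and uw: "u \<in> S i" "w \<in> S j" and R: "R i j u w"
      have "D i j = D j i" using edge[OF ij] D_sym by blast
      then show "R j i w u"
        using R d_sym increment_closed uw by (simp add: R_def S_def)
    qed
    have P_closed: "\<forall>k. P i k \<in> carrier G" and P_0: "P i 0 = \<one>" and P_N: "p \<otimes> P i N \<in> a i"
      if "i \<in> V" for i
      using P(2) that by (auto simp: S_def)

    \<comment> \<open>The default value keeps \<open>y i k\<close> in the group for every \<open>i\<close>, as \<open>bounded_by\<close> expects.\<close>
    define y where "y i k = (if i \<in> V then increment (P i) k else \<one>)" for i k
    have y_closed: "y i k \<in> carrier G" for i k
      using increment_closed[OF P_closed] by (simp add: y_def)
    have y_r: "y r k = \<one>" for k using P(1) r by (simp add: y_def P0_def increment_def)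
    have y_edge: "d (y i k) (y j k) < ennreal ((D i j + \<epsilon>) / N)"
      if "(i, j) \<in> adj_rel E" "k < N" for i j k
      using P(3) that edge[OF that(1)] by (auto simp: R_def y_def)
    have y_le: "d \<one> (y i k) \<le> ennreal (c / N)" if "i \<in> V" "k < N" for i k
    proof -
      have "d (y r k) (y i k) \<le> ennreal (1 / N * C i)"
      proof -
        have "d (y i k) (y j k) \<le> ennreal (1 / N * (D i j + 1))" if "(i, j) \<in> adj_rel E" for i j
        proof -
          have "(D i j + \<epsilon>) / N \<le> 1 / N * (D i j + 1)"
            using \<epsilon> N(2) by (simp add: divide_right_mono)
          then show ?thesis
            using y_edge[OF that \<open>k < N\<close>] by (meson ennreal_leI less_imp_le order_trans)
        qed
        then show ?thesis
          using bounded[OF \<open>i \<in> V\<close>, unfolded bounded_by_def, rule_format, of "1 / N" "\<lambda>i. y i k"] y_closed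
          by auto
      qed
      also have "\<dots> \<le> ennreal (c / N)"
        using Cc[OF \<open>i \<in> V\<close>] by (intro ennreal_leI) (simp add: divide_right_mono)
      finally show ?thesis by (simp add: y_r)
    qed
    have y_less: "d \<one> (y i k) < ennreal \<delta>" if "i \<in> V" "k < N" for i k
      using y_le[OF that] small \<delta> by (meson ennreal_lessI order_le_less_trans)
    have y_fin: "d (y i k) (y j k) < \<infinity>" if "i \<in> V" "j \<in> V" "k < N" for i j k
    proof -
      have "d (y i k) (y j k) \<le> d \<one> (y i k) + d \<one> (y j k)"
        using d_triangle[OF y_closed one_closed y_closed, of i k j k] d_sym[OF y_closed one_closed, of i k] by simp
      also have "\<dots> < \<infinity>" using y_less[OF that(1,3)] y_less[OF that(2,3)]
        by (metis ennreal_add_eq_top ennreal_less_top infinity_ennreal_def less_top order_less_trans)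
      finally show ?thesis .
    qed

    define nrm where "nrm i j k = sqrt (B (\<phi> (y i k) - \<phi> (y j k)) (\<phi> (y i k) - \<phi> (y j k)))" for i j k
    have nrm0: "0 \<le> nrm i j k" for i j k by (simp add: nrm_def B_nonneg)
    have nrm_lower: "(1 - \<epsilon>) * enn2real (d (y i k) (y j k)) \<le> nrm i j k"
      and nrm_upper: "nrm i j k \<le> (1 + \<epsilon>) * enn2real (d (y i k) (y j k))"
      if "i \<in> V" "j \<in> V" "k < N" for i j k
      using flat\<delta>[OF y_closed y_closed y_less y_less] that unfolding nrm_def by auto

    \<comment> \<open>Gram matrix of the lifted points in the \<open>N\<close>-fold orthogonal sum; the factor \<open>N\<close> is the square of
      the scaling of the distance, and the root is the origin.\<close>
    define M where "M i j = real N * (\<Sum>k<N. B (\<phi> (y i k) - \<phi> \<one>) (\<phi> (y j k) - \<phi> \<one>))" for i j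
    have "psd_on V M"
      unfolding M_def by (intro psd_on_sum_scaled psd_on_bilinear bilinear_B B_sym B_nonneg) simp
    have M_dist: "M i i + M j j - 2 * M i j = real N * (\<Sum>k<N. (nrm i j k)\<^sup>2)" for i j
    proof -
      have nrm2: "(nrm i j k)\<^sup>2 = B (\<phi> (y i k) - \<phi> \<one>) (\<phi> (y i k) - \<phi> \<one>)
          + B (\<phi> (y j k) - \<phi> \<one>) (\<phi> (y j k) - \<phi> \<one>) - 2 * B (\<phi> (y i k) - \<phi> \<one>) (\<phi> (y j k) - \<phi> \<one>)" for k
        using bilinear_diff_self[OF bilinear_B B_sym, of "\<phi> (y i k) - \<phi> \<one>" "\<phi> (y j k) - \<phi> \<one>"]
          B_nonneg[of "\<phi> (y i k) - \<phi> (y j k)"]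
        by (simp add: nrm_def)
      show ?thesis
        unfolding nrm2 by (simp add: M_def sum.distrib sum_subtractf sum_distrib_left algebra_simps)
    qed
    have sum_le: "real N * (\<Sum>k<N. (nrm i j k)\<^sup>2) \<le> L\<^sup>2"
      if "i \<in> V" "j \<in> V" "\<And>k. k < N \<Longrightarrow> nrm i j k \<le> L / N" for i j L
    proof -
      have "(\<Sum>k<N. (nrm i j k)\<^sup>2) \<le> (\<Sum>k<N. (L / N)\<^sup>2)"
        using that(3) nrm0 by (intro sum_mono power_mono) auto
      then have "real N * (\<Sum>k<N. (nrm i j k)\<^sup>2) \<le> real N * (N * (L / N)\<^sup>2)"
        by (intro mult_left_mono) auto
      also have "\<dots> = L\<^sup>2" using N(2) by (simp add: power2_eq_square)
      finally show ?thesis .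
    qed
    have M_le: "M i i \<le> (2 * c)\<^sup>2" if "i \<in> V" for i
    proof -
      have "nrm i r k \<le> 2 * c / N" if "k < N" for k
      proof -
        have "d (y i k) (y r k) \<le> ennreal (c / N)"
          using y_le[OF \<open>i \<in> V\<close> that] d_sym[OF one_closed y_closed, of i k] by (simp add: y_r)
        then have "enn2real (d (y i k) (y r k)) \<le> c / N"
          using c0 by (simp add: enn2real_leI)
        then have "(1 + \<epsilon>) * enn2real (d (y i k) (y r k)) \<le> 2 * (c / N)"
          using \<epsilon> by (intro mult_mono) auto
        then show ?thesis using nrm_upper[OF \<open>i \<in> V\<close> r that] by simp
      qed
      then have "real N * (\<Sum>k<N. (nrm i r k)\<^sup>2) \<le> (2 * c)\<^sup>2"
        using sum_le[OF that r] by blast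
      moreover have "M i r = 0" "M r r = 0"
        by (simp_all add: M_def y_r bilinear_lzero[OF bilinear_B] bilinear_rzero[OF bilinear_B])
      ultimately show ?thesis using M_dist[of i r] by simp
    qed
    have M_lower: "((1 - \<epsilon>) * D i j)\<^sup>2 \<le> M i i + M j j - 2 * M i j" if ij: "i \<in> V" "j \<in> V" for i j
    proof -
      have "ennreal (D i j) \<le> d (p \<otimes> P i N) (p \<otimes> P j N)"
        unfolding D[OF ij] by (intro subset_dist_le P_N ij)
      also have "\<dots> = d (P i N) (P j N)"
        using p_closed P_closed ij by (simp add: d_left)
      also have "\<dots> \<le> (\<Sum>k<N. d (y i k) (y j k))"
        using d_le_sum_increments[OF P_closed P_closed, of i j N] P_0 ij by (simp add: y_def)
      also have "\<dots> = (\<Sum>k<N. ennreal (enn2real (d (y i k) (y j k))))"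
        by (intro sum.cong refl) (use y_fin[OF ij] in simp)
      also have "\<dots> = ennreal (\<Sum>k<N. enn2real (d (y i k) (y j k)))"
        by (rule sum_ennreal) simp
      finally have "D i j \<le> (\<Sum>k<N. enn2real (d (y i k) (y j k)))"
        by (simp add: ennreal_le_iff sum_nonneg)
      then have "(1 - \<epsilon>) * D i j \<le> (1 - \<epsilon>) * (\<Sum>k<N. enn2real (d (y i k) (y j k)))"
        using \<epsilon> by (intro mult_left_mono) auto
      also have "\<dots> \<le> (\<Sum>k<N. nrm i j k)"
        unfolding sum_distrib_left using nrm_lower[OF ij] by (intro sum_mono) auto
      finally have "((1 - \<epsilon>) * D i j)\<^sup>2 \<le> (\<Sum>k<N. nrm i j k)\<^sup>2"
        using \<epsilon> D0 by (intro power_mono) auto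
      also have "\<dots> \<le> (\<Sum>k<N. (nrm i j k)\<^sup>2) * real (card {..<N})"
        by (rule sum_squared_le_sum_of_squares)
      finally show ?thesis unfolding M_dist by (simp add: mult.commute)
    qed
    have M_upper: "M i i + M j j - 2 * M i j \<le> ((1 + \<epsilon>) * (D i j + \<epsilon>))\<^sup>2"
      if ij: "(i, j) \<in> adj_rel E" for i j
    proof -
      have iV: "i \<in> V" and jV: "j \<in> V" using edge[OF ij] by auto
      have "nrm i j k \<le> ((1 + \<epsilon>) * (D i j + \<epsilon>)) / N" if "k < N" for k
      proof -
        have "enn2real (d (y i k) (y j k)) \<le> (D i j + \<epsilon>) / N"
          using y_edge[OF ij that] D0[of i j] \<epsilon> by (intro enn2real_leI) auto
        then have "(1 + \<epsilon>) * enn2real (d (y i k) (y j k)) \<le> (1 + \<epsilon>) * ((D i j + \<epsilon>) / N)"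
          using \<epsilon> by (intro mult_left_mono) auto
        then show ?thesis using nrm_upper[OF iV jV that] by simp
      qed
      then show ?thesis unfolding M_dist by (rule sum_le[OF iV jV])
    qed
    show "\<exists>M. almost_gram V (adj_rel E) D \<epsilon> M \<and> (\<forall>i\<in>V. M i i \<le> (2 * c)\<^sup>2)"
      using \<open>psd_on V M\<close> M_le M_lower M_upper unfolding almost_gram_def by blast
  qed
qed

theorem tree_comparison_biquotient:
  assumes infinite_dim: "\<nexists>B :: 'h::{real_inner, complete_space} set. finite B \<and> span B = UNIV"
    and H: "subgroup H (G \<times>\<times> G)" and tree: "finite_tree V E"
  shows "satisfies_tree_comparison TYPE('h) (biquotient G H) (subset_dist d) V E"
  unfolding satisfies_tree_comparison_def
proof (intro allI impI, elim conjE)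
  fix a assume a: "\<forall>i\<in>V. a i \<in> biquotient G H"
    and fin: "\<forall>i\<in>V. \<forall>j\<in>V. subset_dist d (a i) (a j) < \<infinity>"
  define D where "D i j = enn2real (subset_dist d (a i) (a j))" for i j
  have D: "subset_dist d (a i) (a j) = ennreal (D i j)" if "i \<in> V" "j \<in> V" for i j
    using fin that by (simp add: D_def)
  obtain K where approx: "\<And>\<epsilon>. 0 < \<epsilon> \<Longrightarrow> \<epsilon> < 1 \<Longrightarrow> \<exists>M. almost_gram V (adj_rel E) D \<epsilon> M \<and> (\<forall>i\<in>V. M i i \<le> K)"
    using approximate_gram_biquotient[OF H tree, of a] a fin unfolding D_def by blast
  have "finite V" using tree by (simp add: finite_tree_def)
  then have "\<exists>b::'c \<Rightarrow> 'h. \<forall>i\<in>V. \<forall>j\<in>V. D i j \<le> dist (b i) (b j) \<and>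
      ((i, j) \<in> adj_rel E \<longrightarrow> dist (b i) (b j) = D i j)"
    by (rule gram_of_approximate_gram[OF infinite_dim _ _ approx]) (simp add: D_def)
  then show "\<exists>b::'c \<Rightarrow> 'h. \<forall>i\<in>V. \<forall>j\<in>V. subset_dist d (a i) (a j) \<le> ennreal (dist (b i) (b j)) \<and>
      ((i, j) \<in> adj_rel E \<longrightarrow> ennreal (dist (b i) (b j)) = subset_dist d (a i) (a j))"
    by (metis D ennreal_leI)
qed

end

section \<open>Finite-dimensional normed spaces\<close>

lemma finite_basis_exists:
  assumes "\<exists>B::'e::real_vector set. finite B \<and> span B = UNIV"
  obtains B :: "'e::real_vector set" where "finite B" "independent B" "span B = UNIV"
proof -
  obtain C :: "'e set" where C: "finite C" "span C = UNIV" using assms by blast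
  obtain B where "B \<subseteq> C" "independent B" "C \<subseteq> span B"
    using maximal_independent_subset by blast
  then show ?thesis using C that[of B] finite_subset span_mono span_span by (metis top.extremum_uniqueI)
qed

text \<open>The equivalence of norms on a finite-dimensional space: otherwise there are vectors with
  coordinates of total size 1 and \<open>n\<close> tending to 0, and a limit point of their coordinates contradicts
  independence. The function \<open>n\<close> is left arbitrary because it is used for the norm of the model space
  as well as for the norm of a metric tensor.\<close>

lemma norm_ge_coordinates:
  fixes B :: "'e::real_vector set" and n :: "'e \<Rightarrow> real"
  assumes B: "finite B" "independent B"
    and triangle: "\<And>x y. n (x + y) \<le> n x + n y"
    and scale: "\<And>c x. n (c *\<^sub>R x) = \<bar>c\<bar> * n x"
    and pos: "\<And>x. x \<noteq> 0 \<Longrightarrow> 0 < n x"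
  shows "\<exists>m>0. \<forall>a. m * (\<Sum>b\<in>B. \<bar>a b\<bar>) \<le> n (\<Sum>b\<in>B. a b *\<^sub>R b)"
proof (rule ccontr)
  assume neg: "\<not> ?thesis"
  have n0: "n 0 = 0" using scale[of 0 0] by simp
  have nonneg: "0 \<le> n x" for x using pos[of x] n0 by (cases "x = 0") auto
  have n_sum: "n (\<Sum>b\<in>B. a b *\<^sub>R b) \<le> (\<Sum>b\<in>B. \<bar>a b\<bar> * n b)" for a
  proof -
    have "n (\<Sum>b\<in>C. a b *\<^sub>R b) \<le> (\<Sum>b\<in>C. \<bar>a b\<bar> * n b)" if "finite C" for C
      using that
    proof (induction C rule: finite_induct)
      case empty
      then show ?case using n0 by simp
    next
      case (insert x F)
      then show ?case using triangle[of "a x *\<^sub>R x" "\<Sum>b\<in>F. a b *\<^sub>R b"] scale by simp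
    qed
    then show ?thesis using B(1) .
  qed
  have "\<exists>a. (\<Sum>b\<in>B. \<bar>a b\<bar>) = 1 \<and> n (\<Sum>b\<in>B. a b *\<^sub>R b) < inverse (real (Suc k))" for k
  proof -
    obtain a where a: "n (\<Sum>b\<in>B. a b *\<^sub>R b) < inverse (real (Suc k)) * (\<Sum>b\<in>B. \<bar>a b\<bar>)"
      using neg by (metis inverse_positive_iff_positive not_less of_nat_0_less_iff zero_less_Suc)
    define s where "s = (\<Sum>b\<in>B. \<bar>a b\<bar>)"
    have "0 < inverse (real (Suc k)) * s"
      using a nonneg[of "\<Sum>b\<in>B. a b *\<^sub>R b"] by (simp add: s_def)
    then have s: "0 < s" by (simp add: zero_less_mult_iff)
    have "(\<Sum>b\<in>B. \<bar>a b / s\<bar>) = 1"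
      using s by (simp add: s_def abs_divide sum_divide_distrib[symmetric])
    moreover have "(\<Sum>b\<in>B. (a b / s) *\<^sub>R b) = (1 / s) *\<^sub>R (\<Sum>b\<in>B. a b *\<^sub>R b)"
      by (simp add: scaleR_sum_right)
    then have "n (\<Sum>b\<in>B. (a b / s) *\<^sub>R b) < inverse (real (Suc k))"
      using a s scale by (simp add: s_def[symmetric] field_simps)
    ultimately show ?thesis by (intro exI[of _ "\<lambda>b. a b / s"] conjI)
  qed
  then obtain a where a: "\<And>k. (\<Sum>b\<in>B. \<bar>a k b\<bar>) = 1"
    and na: "\<And>k. n (\<Sum>b\<in>B. a k b *\<^sub>R b) < inverse (real (Suc k))" by metis
  have "bounded (range (\<lambda>k. a k b))" if "b \<in> B" for b
  proof (rule boundedI)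
    fix x assume "x \<in> range (\<lambda>k. a k b)"
    then obtain k where "x = a k b" by auto
    then show "norm x \<le> 1"
      using member_le_sum[of b B "\<lambda>b. \<bar>a k b\<bar>"] that B(1) a[of k] by simp
  qed
  then obtain r where r: "strict_mono r" "\<forall>b\<in>B. convergent ((\<lambda>k. a k b) \<circ> r)"
    using finite_family_convergent_subseq[OF B(1), of "\<lambda>b k. a k b"] by blast
  define l where "l b = lim (\<lambda>k. a (r k) b)" for b
  have l: "(\<lambda>k. a (r k) b) \<longlonglongrightarrow> l b" if "b \<in> B" for b
    using r(2) that by (simp add: l_def convergent_LIMSEQ_iff o_def)
  have "(\<lambda>k. \<Sum>b\<in>B. \<bar>a (r k) b\<bar>) \<longlonglongrightarrow> (\<Sum>b\<in>B. \<bar>l b\<bar>)"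
    by (intro tendsto_sum tendsto_rabs l)
  then have l1: "(\<Sum>b\<in>B. \<bar>l b\<bar>) = 1" using a by (simp add: LIMSEQ_const_iff)
  have "n (\<Sum>b\<in>B. l b *\<^sub>R b) \<le> 0"
  proof (rule LIMSEQ_le_const)
    have "(\<lambda>k. inverse (real (Suc (r k)))) \<longlonglongrightarrow> 0"
      using LIMSEQ_subseq_LIMSEQ[OF LIMSEQ_inverse_real_of_nat r(1)] by (simp add: o_def)
    moreover have "(\<lambda>k. \<Sum>b\<in>B. \<bar>l b - a (r k) b\<bar> * n b) \<longlonglongrightarrow> (\<Sum>b\<in>B. \<bar>l b - l b\<bar> * n b)"
      by (intro tendsto_intros l)
    ultimately show "(\<lambda>k. inverse (real (Suc (r k))) + (\<Sum>b\<in>B. \<bar>l b - a (r k) b\<bar> * n b)) \<longlonglongrightarrow> 0"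
      using tendsto_add by fastforce
    show "\<exists>N. \<forall>k\<ge>N. n (\<Sum>b\<in>B. l b *\<^sub>R b) \<le> inverse (real (Suc (r k))) + (\<Sum>b\<in>B. \<bar>l b - a (r k) b\<bar> * n b)"
    proof (intro exI allI impI)
      fix k
      have "(\<Sum>b\<in>B. l b *\<^sub>R b) = (\<Sum>b\<in>B. a (r k) b *\<^sub>R b) + (\<Sum>b\<in>B. (l b - a (r k) b) *\<^sub>R b)"
        by (simp add: sum.distrib[symmetric] algebra_simps)
      then have "n (\<Sum>b\<in>B. l b *\<^sub>R b)
          = n ((\<Sum>b\<in>B. a (r k) b *\<^sub>R b) + (\<Sum>b\<in>B. (l b - a (r k) b) *\<^sub>R b))"
        by (rule arg_cong)
      then show "n (\<Sum>b\<in>B. l b *\<^sub>R b) \<le> inverse (real (Suc (r k))) + (\<Sum>b\<in>B. \<bar>l b - a (r k) b\<bar> * n b)"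
        using triangle[of "\<Sum>b\<in>B. a (r k) b *\<^sub>R b" "\<Sum>b\<in>B. (l b - a (r k) b) *\<^sub>R b"]
          na[of "r k"] n_sum[of "\<lambda>b. l b - a (r k) b"] by linarith
    qed
  qed
  then have "(\<Sum>b\<in>B. l b *\<^sub>R b) = 0" using pos not_less by blast
  then have "l b = 0" if "b \<in> B" for b
    using independentD[OF B(2,1) subset_refl] that by blast
  then show False using l1 by simp
qed

text \<open>The model space of a manifold is a normed space spanned by a finite set, with no inner product
  given, and it may be the zero space. A basis provides the continuity and compactness facts known for
  Euclidean spaces.\<close>

locale finite_dim_basis =
  fixes B :: "'e::real_normed_vector set"
  assumes finite_B: "finite B" and independent_B: "independent B" and span_B: "span B = UNIV"
begin

lemma expand: "(\<Sum>b\<in>B. representation B v b *\<^sub>R b) = v"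
  by (rule sum_representation_eq) (use finite_B independent_B span_B in auto)

lemma expand_linear:
  assumes "linear f"
  shows "f v = (\<Sum>b\<in>B. representation B v b *\<^sub>R f b)"
proof -
  have "f v = f (\<Sum>b\<in>B. representation B v b *\<^sub>R b)" by (simp add: expand)
  then show ?thesis using assms by (simp add: linear_sum linear_scale)
qed

lemma representation_bound: "\<exists>m>0. \<forall>v. m * (\<Sum>b\<in>B. \<bar>representation B v b\<bar>) \<le> norm v"
proof -
  obtain m where m: "m > 0" "\<And>a. m * (\<Sum>b\<in>B. \<bar>a b\<bar>) \<le> norm (\<Sum>b\<in>B. a b *\<^sub>R b)"
    using norm_ge_coordinates[OF finite_B independent_B, of norm] norm_triangle_ineq by auto
  have "m * (\<Sum>b\<in>B. \<bar>representation B v b\<bar>) \<le> norm v" for v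
    using m(2)[of "representation B v"] by (simp add: expand)
  then show ?thesis using m(1) by blast
qed

lemma bounded_linear_of_linear:
  assumes "linear (f :: 'e \<Rightarrow> 'f::real_normed_vector)"
  shows "bounded_linear f"
proof -
  obtain m where m: "m > 0" "\<And>v. m * (\<Sum>b\<in>B. \<bar>representation B v b\<bar>) \<le> norm v"
    using representation_bound by blast
  define K where "K = (\<Sum>b\<in>B. norm (f b))"
  have K: "norm (f b) \<le> K" if "b \<in> B" for b
    unfolding K_def using that finite_B by (intro member_le_sum) auto
  have "norm (f v) \<le> norm v * (K / m)" for v
  proof -
    have "norm (f v) \<le> (\<Sum>b\<in>B. norm (representation B v b *\<^sub>R f b))"
      unfolding expand_linear[OF assms, of v] by (rule norm_sum)
    also have "\<dots> \<le> (\<Sum>b\<in>B. \<bar>representation B v b\<bar> * K)"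
      by (intro sum_mono) (simp add: K mult_left_mono)
    also have "\<dots> = (\<Sum>b\<in>B. \<bar>representation B v b\<bar>) * K" by (simp add: sum_distrib_right)
    also have "\<dots> \<le> (norm v / m) * K"
      using m by (intro mult_right_mono) (auto simp: K_def sum_nonneg field_simps)
    finally show ?thesis by simp
  qed
  then show ?thesis
    using assms by (intro bounded_linear_intro[of f "K / m"]) (auto simp: linear_add linear_scale)
qed

lemma continuous_on_representation:
  assumes "continuous_on S u"
  shows "continuous_on S (\<lambda>x. representation B (u x) b)"
proof -
  have "linear (\<lambda>v. representation B v b)"
    by (rule linearI) (use independent_B span_B in \<open>auto simp: representation_add representation_scale\<close>)
  from bounded_linear.continuous_on[OF bounded_linear_of_linear[OF this] assms] show ?thesis .
qed

lemma continuous_on_linear_apply: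
  fixes F :: "'x::topological_space \<Rightarrow> 'e \<Rightarrow> 'f::real_normed_vector"
  assumes F: "\<And>v. continuous_on S (\<lambda>x. F x v)" and lin: "\<And>x. x \<in> S \<Longrightarrow> linear (F x)"
    and u: "continuous_on S u"
  shows "continuous_on S (\<lambda>x. F x (u x))"
proof -
  have "continuous_on S (\<lambda>x. \<Sum>b\<in>B. representation B (u x) b *\<^sub>R F x b)"
    by (intro continuous_on_sum continuous_on_scaleR continuous_on_representation u F)
  then show ?thesis
    by (rule continuous_on_eq) (simp add: expand_linear[OF lin, symmetric])
qed

lemma continuous_on_bilinear_apply:
  fixes F :: "'x::topological_space \<Rightarrow> 'e \<Rightarrow> 'e \<Rightarrow> 'f::real_normed_vector"
  assumes F: "\<And>v w. continuous_on S (\<lambda>x. F x v w)" and bilin: "\<And>x. x \<in> S \<Longrightarrow> bilinear (F x)"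
    and u: "continuous_on S u" and w: "continuous_on S w"
  shows "continuous_on S (\<lambda>x. F x (u x) (w x))"
proof (rule continuous_on_linear_apply[where F = "\<lambda>x v. F x v (w x)", OF _ _ u])
  show "continuous_on S (\<lambda>x. F x v (w x))" for v
    by (rule continuous_on_linear_apply[where F = "\<lambda>x. F x v", OF F _ w])
       (use bilin in \<open>auto simp: bilinear_def\<close>)
  show "linear (\<lambda>v. F x v (w x))" if "x \<in> S" for x
    using bilin[OF that] by (auto simp: bilinear_def)
qed

lemma compact_of_closed_bounded:
  assumes "closed (S::'e set)" "bounded S"
  shows "compact S"
  unfolding compact_eq_seq_compact_metric seq_compact_def
proof (intro allI impI)
  fix f :: "nat \<Rightarrow> 'e" assume f: "\<forall>k. f k \<in> S"
  obtain M where M: "\<And>x. x \<in> S \<Longrightarrow> norm x \<le> M" using assms(2) by (auto simp: bounded_iff)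
  obtain m where m: "m > 0" "\<And>v. m * (\<Sum>b\<in>B. \<bar>representation B v b\<bar>) \<le> norm v"
    using representation_bound by blast
  have "bounded (range (\<lambda>k. representation B (f k) b))" if "b \<in> B" for b
  proof (rule boundedI)
    fix x assume "x \<in> range (\<lambda>k. representation B (f k) b)"
    then obtain k where x: "x = representation B (f k) b" by auto
    have "\<bar>x\<bar> \<le> (\<Sum>b\<in>B. \<bar>representation B (f k) b\<bar>)"
      unfolding x using that finite_B by (intro member_le_sum) auto
    also have "\<dots> \<le> norm (f k) / m" using m(1) m(2)[of "f k"] by (simp add: field_simps)
    also have "\<dots> \<le> M / m" using M f m(1) by (intro divide_right_mono) auto
    finally show "norm x \<le> M / m" by simp
  qed
  then obtain r where r: "strict_mono r" "\<forall>b\<in>B. convergent ((\<lambda>k. representation B (f k) b) \<circ> r)"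
    using finite_family_convergent_subseq[OF finite_B, of "\<lambda>b k. representation B (f k) b"] by blast
  define l where "l b = lim (\<lambda>k. representation B (f (r k)) b)" for b
  have l: "(\<lambda>k. representation B (f (r k)) b) \<longlonglongrightarrow> l b" if "b \<in> B" for b
    using r(2) that by (simp add: l_def convergent_LIMSEQ_iff o_def)
  have "(\<lambda>k. \<Sum>b\<in>B. representation B (f (r k)) b *\<^sub>R b) \<longlonglongrightarrow> (\<Sum>b\<in>B. l b *\<^sub>R b)"
    by (intro tendsto_intros l)
  then have "(f \<circ> r) \<longlonglongrightarrow> (\<Sum>b\<in>B. l b *\<^sub>R b)" by (simp add: expand o_def)
  moreover have "(\<Sum>b\<in>B. l b *\<^sub>R b) \<in> S"
    using closed_sequentially[OF assms(1) _ calculation] f by (simp add: o_def)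
  ultimately show "\<exists>l\<in>S. \<exists>r. strict_mono r \<and> (f \<circ> r) \<longlonglongrightarrow> l" using r(1) by blast
qed

end

section \<open>Continuously differentiable maps and curves\<close>

lemma continuous_on_locally:
  fixes f :: "'x::t2_space \<Rightarrow> 'y::topological_space"
  assumes "\<And>x. x \<in> S \<Longrightarrow> \<exists>U. x \<in> U \<and> openin (top_of_set S) U \<and> continuous_on U f"
  shows "continuous_on S f"
  unfolding continuous_on_eq_continuous_within
proof
  fix x assume "x \<in> S"
  then obtain U where U: "x \<in> U" "openin (top_of_set S) U" "continuous_on U f" using assms by blast
  then obtain W where W: "open W" "U = S \<inter> W" by (auto simp: openin_open)
  have "at x within S = at x within U"
    by (rule at_within_nhd[of x W]) (use U W in auto)
  then show "continuous (at x within S) f"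
    using U(1,3) by (simp add: continuous_on_eq_continuous_within)
qed

lemma openin_restrict:
  assumes "openin (top_of_set S) U" "S' \<subseteq> S"
  shows "openin (top_of_set S') (U \<inter> S')"
proof -
  obtain W where "open W" "U = S \<inter> W" using assms(1) by (auto simp: openin_open)
  then have "U \<inter> S' = S' \<inter> W" using assms(2) by auto
  then show ?thesis using \<open>open W\<close> by (auto simp: openin_open)
qed

lemma openin_preimage_interval:
  fixes \<gamma> :: "real \<Rightarrow> 'a"
  assumes "continuous_map (top_of_set S) T \<gamma>" "openin T U"
  shows "openin (top_of_set S) {s\<in>S. \<gamma> s \<in> U}"
  using openin_continuous_map_preimage[OF assms] by simp

context smooth_manifold
begin

lemma finite_dim_basis_exists: "\<exists>B::'e set. finite_dim_basis B"
  using finite_basis_exists[OF finite_dim] by (metis finite_dim_basis.intro)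

lemma chart_inj: "c \<in> A \<Longrightarrow> inj_on (snd c) (fst c)"
proof -
  assume c: "c \<in> A"
  have "topspace (subtopology T (fst c)) = fst c"
    using openin_subset[OF chart_domain[OF c]] by auto
  then show ?thesis using homeomorphic_imp_injective_map[OF chart_homeomorphic[OF c]] by simp
qed

lemma chart_inv_left: "c \<in> A \<Longrightarrow> p \<in> fst c \<Longrightarrow> chart_inv c (snd c p) = p"
  by (simp add: chart_inj)

lemma chart_inv_right: "x \<in> snd c ` fst c \<Longrightarrow> snd c (chart_inv c x) = x"
  by (rule f_inv_into_f)

lemma chart_inv_in: "x \<in> snd c ` fst c \<Longrightarrow> chart_inv c x \<in> fst c"
  by (rule inv_into_into)

lemma chart_domain_subset: "c \<in> A \<Longrightarrow> fst c \<subseteq> topspace T"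
  by (rule openin_subset[OF chart_domain])

lemma chart_exists: "p \<in> topspace T \<Longrightarrow> \<exists>c\<in>A. p \<in> fst c"
  using charts_cover by blast

lemma continuous_map_chart:
  "c \<in> A \<Longrightarrow> continuous_map (subtopology T (fst c)) euclidean (snd c)"
  using homeomorphic_imp_continuous_map[OF chart_homeomorphic] continuous_map_in_subtopology by blast

lemma chart_inv_eq_imp:
  assumes "c \<in> A" "homeomorphic_maps (subtopology T (fst c)) (top_of_set (snd c ` fst c)) (snd c) h"
    and "x \<in> snd c ` fst c"
  shows "h x = chart_inv c x"
proof -
  obtain p where p: "p \<in> fst c" "x = snd c p" using assms(3) by auto
  then show ?thesis
    using assms(2) chart_domain_subset[OF assms(1)] chart_inv_left[OF assms(1) p(1)]
    by (auto simp: homeomorphic_maps_def)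
qed

lemma continuous_map_chart_inv:
  assumes c: "c \<in> A"
  shows "continuous_map (top_of_set (snd c ` fst c)) T (chart_inv c)"
proof -
  obtain h where h: "homeomorphic_maps (subtopology T (fst c)) (top_of_set (snd c ` fst c)) (snd c) h"
    using chart_homeomorphic[OF c] by (auto simp: homeomorphic_map_maps)
  then have "continuous_map (top_of_set (snd c ` fst c)) T h"
    by (auto simp: homeomorphic_maps_def continuous_map_in_subtopology)
  then show ?thesis
    by (rule continuous_map_eq) (use chart_inv_eq_imp[OF c h] in auto)
qed

lemma continuous_on_chart_curve:
  fixes \<gamma> :: "real \<Rightarrow> 'a"
  assumes "c \<in> A" "continuous_map (top_of_set S) T \<gamma>"
  shows "continuous_on {s\<in>S. \<gamma> s \<in> fst c} (snd c \<circ> \<gamma>)"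
proof -
  have "continuous_map (top_of_set {s\<in>S. \<gamma> s \<in> fst c}) (subtopology T (fst c)) \<gamma>"
    using continuous_map_from_subtopology_mono[OF assms(2), of "{s\<in>S. \<gamma> s \<in> fst c}"]
    by (auto simp: continuous_map_in_subtopology)
  from continuous_map_compose[OF this continuous_map_chart[OF assms(1)]]
  show ?thesis by simp
qed

text \<open>The part of smoothness that transports curves and velocities. It holds for the identity, where it
  is the compatibility of charts, and for the translations of a Lie group.\<close>

definition C1_map :: "('a \<Rightarrow> 'a) \<Rightarrow> bool" where
  "C1_map f \<longleftrightarrow> continuous_map T T f \<and>
     (\<forall>c\<in>A. \<forall>c'\<in>A. Ck_on 1 (snd c ` {p \<in> fst c. f p \<in> fst c'}) (in_coords c c' f))"

lemma C1_map_id: "C1_map id"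
proof -
  have "{p \<in> fst c. id p \<in> fst c'} = fst c \<inter> fst c'" for c c' :: "('a, 'e) chart" by auto
  then show ?thesis
    unfolding C1_map_def using charts_compatible by (simp add: smooth_on_def del: Ck_on.simps One_nat_def)
qed

lemma
  assumes "C1_map f" "c \<in> A" "c' \<in> A" "p \<in> fst c" "f p \<in> fst c'"
  shows C1_map_differentiable: "in_coords c c' f differentiable (at (snd c p))"
    and C1_map_continuous_derivative:
      "continuous_on (snd c ` {p \<in> fst c. f p \<in> fst c'}) (\<lambda>x. frechet_derivative (in_coords c c' f) (at x) v)"
proof -
  have "Ck_on (Suc 0) (snd c ` {p \<in> fst c. f p \<in> fst c'}) (in_coords c c' f)"
    using assms by (simp add: C1_map_def)
  then show "in_coords c c' f differentiable (at (snd c p))"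
    "continuous_on (snd c ` {p \<in> fst c. f p \<in> fst c'}) (\<lambda>x. frechet_derivative (in_coords c c' f) (at x) v)"
    using assms by auto
qed

abbreviation differential :: "('a, 'e) chart \<Rightarrow> ('a, 'e) chart \<Rightarrow> ('a \<Rightarrow> 'a) \<Rightarrow> 'a \<Rightarrow> 'e \<Rightarrow> 'e" where
  "differential c c' f p \<equiv> frechet_derivative (in_coords c c' f) (at (snd c p))"

lemma C1_map_has_derivative:
  assumes "C1_map f" "c \<in> A" "c' \<in> A" "p \<in> fst c" "f p \<in> fst c'"
  shows "(in_coords c c' f has_derivative differential c c' f p) (at (snd c p))"
  using C1_map_differentiable[OF assms] by (simp add: frechet_derivative_works)

text \<open>The chain rule in coordinates. With \<open>f = id\<close> it says how a velocity changes between charts.\<close>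

lemma push_velocity:
  assumes f: "C1_map f" and c: "c \<in> A" "c' \<in> A"
    and \<gamma>: "continuous_map (top_of_set {a..b}) T \<gamma>" and r: "r \<in> {a..b}" "\<gamma> r \<in> fst c" "f (\<gamma> r) \<in> fst c'"
    and v: "((snd c \<circ> \<gamma>) has_vector_derivative v) (at r within {a..b})"
  shows "((snd c' \<circ> (f \<circ> \<gamma>)) has_vector_derivative
      differential c c' f (\<gamma> r) v) (at r within {a..b})"
proof -
  let ?F = "in_coords c c' f"
  have F: "(?F has_derivative differential c c' f (\<gamma> r)) (at (snd c (\<gamma> r)))"
    by (rule C1_map_has_derivative[OF f c r(2,3)])
  have "((?F \<circ> (snd c \<circ> \<gamma>)) has_vector_derivative differential c c' f (\<gamma> r) v)
      (at r within {a..b})"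
    by (rule vector_derivative_diff_chain_within[OF v])
       (use has_derivative_at_withinI[OF F] in simp)
  moreover obtain e where e: "e > 0" "\<And>s. s \<in> {a..b} \<Longrightarrow> dist s r < e \<Longrightarrow> \<gamma> s \<in> fst c"
  proof -
    have "openin (top_of_set {a..b}) {s\<in>{a..b}. \<gamma> s \<in> fst c}"
      by (rule openin_preimage_interval[OF \<gamma> chart_domain[OF c(1)]])
    then show ?thesis
      using r that unfolding openin_euclidean_subtopology_iff by (metis (no_types, lifting) mem_Collect_eq)
  qed
  ultimately show ?thesis
    by (elim has_vector_derivative_transform_within[where d = e])
       (use r in \<open>auto simp: in_coords_def chart_inv_left[OF c(1)]\<close>)
qed

text \<open>One-sided at the ends of the interval, where the curve need not extend differentiably.\<close>

definition velocity :: "('a, 'e) chart \<Rightarrow> (real \<Rightarrow> 'a) \<Rightarrow> real \<Rightarrow> real \<Rightarrow> real \<Rightarrow> 'e" where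
  "velocity c \<gamma> a b r = vector_derivative (snd c \<circ> \<gamma>) (at r within {a..b})"

lemma velocity_eq:
  assumes "a < b" "r \<in> {a..b}" "((snd c \<circ> \<gamma>) has_vector_derivative v) (at r within {a..b})"
  shows "velocity c \<gamma> a b r = v"
  using vector_derivative_within_cbox[of a b r "snd c \<circ> \<gamma>" v] assms by (simp add: velocity_def)

lemma
  assumes "a < b" and C1: "C1_curve_on T A a b \<gamma>"
  shows C1_curve_continuous: "continuous_map (top_of_set {a..b}) T \<gamma>"
    and C1_curve_velocity: "c \<in> A \<Longrightarrow> r \<in> {a..b} \<Longrightarrow> \<gamma> r \<in> fst c \<Longrightarrow>
      ((snd c \<circ> \<gamma>) has_vector_derivative velocity c \<gamma> a b r) (at r within {a..b})"
    and C1_curve_velocity_continuous: "c \<in> A \<Longrightarrow>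
      continuous_on {r\<in>{a..b}. \<gamma> r \<in> fst c} (velocity c \<gamma> a b)"
proof -
  show "continuous_map (top_of_set {a..b}) T \<gamma>" using C1 by (simp add: C1_curve_on_def)
  assume c: "c \<in> A"
  obtain D where D: "continuous_on {r\<in>{a..b}. \<gamma> r \<in> fst c} D"
    "\<And>r. r \<in> {a..b} \<Longrightarrow> \<gamma> r \<in> fst c \<Longrightarrow> ((snd c \<circ> \<gamma>) has_vector_derivative D r) (at r within {a..b})"
    using C1 c unfolding C1_curve_on_def by blast
  have eq: "velocity c \<gamma> a b r = D r" if "r \<in> {a..b}" "\<gamma> r \<in> fst c" for r
    by (rule velocity_eq[OF \<open>a < b\<close> that(1) D(2)[OF that]])
  show "continuous_on {r\<in>{a..b}. \<gamma> r \<in> fst c} (velocity c \<gamma> a b)"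
    by (rule continuous_on_eq[OF D(1)]) (simp add: eq)
  show "((snd c \<circ> \<gamma>) has_vector_derivative velocity c \<gamma> a b r) (at r within {a..b})"
    if "r \<in> {a..b}" "\<gamma> r \<in> fst c"
    using D(2)[OF that] eq[OF that] by simp
qed

text \<open>It suffices to know the curve in one chart around each of its points: the velocity of the image in
  any other chart is locally given by the chain rule, and is therefore continuous.\<close>

lemma C1_curve_push:
  assumes f: "C1_map f" and "a < b" and \<gamma>: "continuous_map (top_of_set {a..b}) T \<gamma>"
    and C1: "\<And>r. r \<in> {a..b} \<Longrightarrow> \<exists>c\<in>A. \<gamma> r \<in> fst c \<and>
      continuous_on {s\<in>{a..b}. \<gamma> s \<in> fst c} (velocity c \<gamma> a b) \<and>
      (\<forall>s\<in>{a..b}. \<gamma> s \<in> fst c \<longrightarrow>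
        ((snd c \<circ> \<gamma>) has_vector_derivative velocity c \<gamma> a b s) (at s within {a..b}))"
  shows "C1_curve_on T A a b (f \<circ> \<gamma>)"
  unfolding C1_curve_on_def
proof (intro conjI ballI)
  have "continuous_map T T f" using f by (simp add: C1_map_def)
  with \<gamma> show f\<gamma>: "continuous_map (top_of_set {a..b}) T (f \<circ> \<gamma>)" by (rule continuous_map_compose)
  obtain B :: "'e set" where "finite_dim_basis B" using finite_dim_basis_exists by blast
  then interpret finite_dim_basis B .
  fix c' assume c': "c' \<in> A"
  let ?S' = "{s\<in>{a..b}. (f \<circ> \<gamma>) s \<in> fst c'}"
  have der: "((snd c' \<circ> (f \<circ> \<gamma>)) has_vector_derivative
      differential c c' f (\<gamma> s) (velocity c \<gamma> a b s)) (at s within {a..b})"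
    if "c \<in> A" "s \<in> {a..b}" "\<gamma> s \<in> fst c" "f (\<gamma> s) \<in> fst c'"
      "((snd c \<circ> \<gamma>) has_vector_derivative velocity c \<gamma> a b s) (at s within {a..b})" for c s
    by (rule push_velocity[OF f that(1) c' \<gamma> that(2,3,4,5)])
  have eq: "velocity c' (f \<circ> \<gamma>) a b s =
      differential c c' f (\<gamma> s) (velocity c \<gamma> a b s)"
    if "c \<in> A" "s \<in> {a..b}" "\<gamma> s \<in> fst c" "f (\<gamma> s) \<in> fst c'"
      "((snd c \<circ> \<gamma>) has_vector_derivative velocity c \<gamma> a b s) (at s within {a..b})" for c s
    by (rule velocity_eq[OF \<open>a < b\<close> that(2) der[OF that]])
  show "\<exists>D. continuous_on ?S' D \<and> (\<forall>r\<in>{a..b}. (f \<circ> \<gamma>) r \<in> fst c' \<longrightarrow>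
      ((snd c' \<circ> (f \<circ> \<gamma>)) has_vector_derivative D r) (at r within {a..b}))"
  proof (intro exI[of _ "velocity c' (f \<circ> \<gamma>) a b"] conjI ballI impI)
    fix r assume r: "r \<in> {a..b}" "(f \<circ> \<gamma>) r \<in> fst c'"
    obtain c where c: "c \<in> A" "\<gamma> r \<in> fst c"
      "((snd c \<circ> \<gamma>) has_vector_derivative velocity c \<gamma> a b r) (at r within {a..b})"
      using C1[OF r(1)] r(1) by blast
    have r': "f (\<gamma> r) \<in> fst c'" using r(2) by simp
    show "((snd c' \<circ> (f \<circ> \<gamma>)) has_vector_derivative velocity c' (f \<circ> \<gamma>) a b r) (at r within {a..b})"
      unfolding eq[OF c(1) r(1) c(2) r' c(3)] by (rule der[OF c(1) r(1) c(2) r' c(3)])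
  next
    show "continuous_on ?S' (velocity c' (f \<circ> \<gamma>) a b)"
    proof (rule continuous_on_locally)
      fix r assume r: "r \<in> ?S'"
      then obtain c where c: "c \<in> A" "\<gamma> r \<in> fst c"
        and cont: "continuous_on {s\<in>{a..b}. \<gamma> s \<in> fst c} (velocity c \<gamma> a b)"
        and vel: "\<forall>s\<in>{a..b}. \<gamma> s \<in> fst c \<longrightarrow>
          ((snd c \<circ> \<gamma>) has_vector_derivative velocity c \<gamma> a b s) (at s within {a..b})"
        using C1[of r] by auto
      let ?U = "{s\<in>{a..b}. \<gamma> s \<in> fst c} \<inter> ?S'"
      have "openin (top_of_set {a..b}) {s\<in>{a..b}. \<gamma> s \<in> fst c}"
        by (rule openin_preimage_interval[OF \<gamma> chart_domain[OF c(1)]])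
      then have op: "openin (top_of_set ?S') ?U"
        by (rule openin_restrict) auto
      have "continuous_on ?U (\<lambda>s. differential c c' f (\<gamma> s) (velocity c \<gamma> a b s))"
      proof (rule continuous_on_linear_apply[where F = "\<lambda>s. differential c c' f (\<gamma> s)"])
        show "continuous_on ?U (velocity c \<gamma> a b)"
          by (rule continuous_on_subset[OF cont]) auto
        fix s assume "s \<in> ?U"
        then show "linear (differential c c' f (\<gamma> s))"
          using C1_map_has_derivative[OF f c(1) c', of "\<gamma> s"] by (auto dest: has_derivative_linear)
      next
        fix v
        have "continuous_on ?U (snd c \<circ> \<gamma>)"
          by (rule continuous_on_subset[OF continuous_on_chart_curve[OF c(1) \<gamma>]]) auto
        moreover have "continuous_on ((snd c \<circ> \<gamma>) ` ?U) (\<lambda>x. frechet_derivative (in_coords c c' f) (at x) v)"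
          by (rule continuous_on_subset[OF C1_map_continuous_derivative[OF f c(1) c' c(2)]])
             (use r in auto)
        ultimately show "continuous_on ?U (\<lambda>s. differential c c' f (\<gamma> s) v)"
          using continuous_on_compose by (fastforce simp: o_def)
      qed
      then have "continuous_on ?U (velocity c' (f \<circ> \<gamma>) a b)"
        by (rule continuous_on_eq) (use eq[OF c(1)] vel in auto)
      then show "\<exists>U. r \<in> U \<and> openin (top_of_set ?S') U \<and> continuous_on U (velocity c' (f \<circ> \<gamma>) a b)"
        using op r c(2) by (intro exI[of _ ?U]) auto
    qed
  qed
qed

lemma C1_curve_push':
  assumes "C1_map f" "a < b" "C1_curve_on T A a b \<gamma>"
  shows "C1_curve_on T A a b (f \<circ> \<gamma>)"
proof (rule C1_curve_push[OF assms(1,2) C1_curve_continuous[OF assms(2,3)]])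
  fix r assume r: "r \<in> {a..b}"
  then have "\<gamma> r \<in> topspace T"
    using continuous_map_funspace[OF C1_curve_continuous[OF assms(2,3)]] by auto
  then obtain c where "c \<in> A" "\<gamma> r \<in> fst c" using chart_exists by blast
  then show "\<exists>c\<in>A. \<gamma> r \<in> fst c \<and> continuous_on {s\<in>{a..b}. \<gamma> s \<in> fst c} (velocity c \<gamma> a b) \<and>
      (\<forall>s\<in>{a..b}. \<gamma> s \<in> fst c \<longrightarrow>
        ((snd c \<circ> \<gamma>) has_vector_derivative velocity c \<gamma> a b s) (at s within {a..b}))"
    using C1_curve_velocity[OF assms(2,3)] C1_curve_velocity_continuous[OF assms(2,3)] by blast
qed

lemma C1_curve_restrict:
  assumes "C1_curve_on T A a b \<gamma>" "a \<le> s" "t \<le> b"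
  shows "C1_curve_on T A s t \<gamma>"
  unfolding C1_curve_on_def
proof (intro conjI ballI)
  have sub: "{s..t} \<subseteq> {a..b}" using assms by auto
  show "continuous_map (top_of_set {s..t}) T \<gamma>"
    using assms(1) sub unfolding C1_curve_on_def by (blast intro: continuous_map_from_subtopology_mono)
  fix c assume "c \<in> A"
  then obtain D where D: "continuous_on {r\<in>{a..b}. \<gamma> r \<in> fst c} D"
    "\<And>r. r \<in> {a..b} \<Longrightarrow> \<gamma> r \<in> fst c \<Longrightarrow> ((snd c \<circ> \<gamma>) has_vector_derivative D r) (at r within {a..b})"
    using assms(1) unfolding C1_curve_on_def by blast
  show "\<exists>D. continuous_on {r\<in>{s..t}. \<gamma> r \<in> fst c} D \<and> (\<forall>r\<in>{s..t}. \<gamma> r \<in> fst c \<longrightarrow>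
      ((snd c \<circ> \<gamma>) has_vector_derivative D r) (at r within {s..t}))"
  proof (intro exI[of _ D] conjI ballI impI)
    show "continuous_on {r\<in>{s..t}. \<gamma> r \<in> fst c} D"
      by (rule continuous_on_subset[OF D(1)]) (use sub in auto)
    show "((snd c \<circ> \<gamma>) has_vector_derivative D r) (at r within {s..t})"
      if "r \<in> {s..t}" "\<gamma> r \<in> fst c" for r
      by (rule has_vector_derivative_within_subset[OF D(2)]) (use that sub in auto)
  qed
qed

lemma C1_curve_affine:
  assumes C1: "C1_curve_on T A a b \<gamma>"
    and h: "\<And>r. r \<in> {a'..b'} \<Longrightarrow> m * r + k \<in> {a..b} \<and> \<gamma>' r = \<gamma> (m * r + k)"
  shows "C1_curve_on T A a' b' \<gamma>'"
  unfolding C1_curve_on_def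
proof (intro conjI ballI)
  have "continuous_map (top_of_set {a'..b'}) (top_of_set {a..b}) (\<lambda>r. m * r + k)"
    using h by (auto intro!: continuous_intros)
  from continuous_map_compose[OF this] C1 have "continuous_map (top_of_set {a'..b'}) T (\<gamma> \<circ> (\<lambda>r. m * r + k))"
    unfolding C1_curve_on_def by blast
  then show "continuous_map (top_of_set {a'..b'}) T \<gamma>'"
    by (rule continuous_map_eq) (use h in auto)
  fix c assume "c \<in> A"
  then obtain D where D: "continuous_on {r\<in>{a..b}. \<gamma> r \<in> fst c} D"
    "\<And>r. r \<in> {a..b} \<Longrightarrow> \<gamma> r \<in> fst c \<Longrightarrow> ((snd c \<circ> \<gamma>) has_vector_derivative D r) (at r within {a..b})"
    using C1 unfolding C1_curve_on_def by blast
  show "\<exists>D. continuous_on {r\<in>{a'..b'}. \<gamma>' r \<in> fst c} D \<and> (\<forall>r\<in>{a'..b'}. \<gamma>' r \<in> fst c \<longrightarrow>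
      ((snd c \<circ> \<gamma>') has_vector_derivative D r) (at r within {a'..b'}))"
  proof (intro exI[of _ "\<lambda>r. m *\<^sub>R D (m * r + k)"] conjI ballI impI)
    have "continuous_on {r\<in>{a'..b'}. \<gamma>' r \<in> fst c} (D \<circ> (\<lambda>r. m * r + k))"
      by (rule continuous_on_compose[OF _ continuous_on_subset[OF D(1)]])
         (use h in \<open>auto intro!: continuous_intros\<close>)
    then show "continuous_on {r\<in>{a'..b'}. \<gamma>' r \<in> fst c} (\<lambda>r. m *\<^sub>R D (m * r + k))"
      by (intro continuous_intros) (simp add: o_def)
    fix r assume r: "r \<in> {a'..b'}" "\<gamma>' r \<in> fst c"
    have "((\<lambda>r. m * r + k) has_vector_derivative m) (at r within {a'..b'})"
      by (auto intro!: derivative_eq_intros simp: has_real_derivative_iff_has_vector_derivative[symmetric])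
    moreover have "((snd c \<circ> \<gamma>) has_vector_derivative D (m * r + k)) (at (m * r + k) within (\<lambda>r. m * r + k) ` {a'..b'})"
      by (rule has_vector_derivative_within_subset[OF D(2)]) (use h r in auto)
    ultimately have "(((snd c \<circ> \<gamma>) \<circ> (\<lambda>r. m * r + k)) has_vector_derivative m *\<^sub>R D (m * r + k)) (at r within {a'..b'})"
      by (rule vector_diff_chain_within)
    then show "((snd c \<circ> \<gamma>') has_vector_derivative m *\<^sub>R D (m * r + k)) (at r within {a'..b'})"
      by (rule has_vector_derivative_transform[rotated 2]) (use h r in auto)
  qed
qed

end

section \<open>Length and distance\<close>

lemma affine_image_Icc_pos:
  fixes m :: real
  assumes "0 < m"
  shows "(\<lambda>r. m * r + k) ` {(a - k) / m..(b - k) / m} = {a..b}"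
proof -
  have "y \<in> (\<lambda>r. m * r + k) ` {(a - k) / m..(b - k) / m}" if "y \<in> {a..b}" for y
    using that assms by (intro image_eqI[of _ _ "(y - k) / m"]) (auto simp: divide_right_mono)
  then show ?thesis using assms by (auto simp: field_simps)
qed

lemma affine_image_Icc_neg:
  fixes m :: real
  assumes "m < 0"
  shows "(\<lambda>r. m * r + k) ` {(b - k) / m..(a - k) / m} = {a..b}"
proof -
  have "y \<in> (\<lambda>r. m * r + k) ` {(b - k) / m..(a - k) / m}" if "y \<in> {a..b}" for y
    using that assms by (intro image_eqI[of _ _ "(y - k) / m"]) (auto simp: divide_right_mono_neg)
  then show ?thesis using assms by (auto simp: field_simps)
qed

context riemannian_manifold
begin

lemma metric_nonneg:
  assumes "c \<in> A" "p \<in> fst c"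
  shows "0 \<le> g c p v v"
proof (cases "v = 0")
  case True
  then show ?thesis using bilinear_lzero[OF metric_bilinear[OF assms]] by simp
next
  case False
  then show ?thesis using metric_pos_def[OF assms] by (simp add: less_imp_le)
qed

lemma preserves_metricD:
  assumes "preserves_metric A g f" "c \<in> A" "c' \<in> A" "p \<in> fst c" "f p \<in> fst c'"
  shows "g c' (f p) (differential c c' f p v)
      (differential c c' f p w) = g c p v w"
  using assms unfolding preserves_metric_def Let_def by blast

text \<open>The speed is defined with an arbitrarily chosen chart. A map that preserves the metric tensor lets
  it be computed in any chart around the original point; \<open>f = id\<close> gives independence of the chart.\<close>

lemma speed_push:
  assumes f: "C1_map f" "preserves_metric A g f" and c: "c \<in> A" "\<gamma> r \<in> fst c"
    and \<gamma>: "continuous_map (top_of_set {a..b}) T \<gamma>" and r: "r \<in> {a<..<b}"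
    and v: "((snd c \<circ> \<gamma>) has_vector_derivative v) (at r within {a..b})"
  shows "speed A g (f \<circ> \<gamma>) r = sqrt (g c (\<gamma> r) v v)"
proof -
  have "\<gamma> r \<in> topspace T" using chart_domain_subset c by blast
  then have "f (\<gamma> r) \<in> topspace T"
    using f(1) continuous_map_funspace unfolding C1_map_def by blast
  then have ex: "\<exists>c. c \<in> A \<and> (f \<circ> \<gamma>) r \<in> fst c" using chart_exists[of "(f \<circ> \<gamma>) r"] by (simp add: Bex_def)
  define c' where "c' = (SOME c. c \<in> A \<and> (f \<circ> \<gamma>) r \<in> fst c)"
  have c': "c' \<in> A" "f (\<gamma> r) \<in> fst c'" using someI_ex[OF ex] by (auto simp: c'_def)
  have "((snd c' \<circ> (f \<circ> \<gamma>)) has_vector_derivative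
      differential c c' f (\<gamma> r) v) (at r within {a..b})"
    by (rule push_velocity[OF f(1) c(1) c'(1) \<gamma> _ c(2) c'(2) v]) (use r in auto)
  then have "vector_derivative (snd c' \<circ> (f \<circ> \<gamma>)) (at r)
      = differential c c' f (\<gamma> r) v"
    using r at_within_Icc_at[of a r b] by (auto intro: vector_derivative_at)
  then show ?thesis
    unfolding speed_def Let_def c'_def[symmetric]
    using preserves_metricD[OF f(2) c(1) c'(1) c(2) c'(2)] by simp
qed

lemma speed_eq:
  assumes "c \<in> A" "\<gamma> r \<in> fst c" "continuous_map (top_of_set {a..b}) T \<gamma>" "r \<in> {a<..<b}"
    and "((snd c \<circ> \<gamma>) has_vector_derivative v) (at r within {a..b})"
  shows "speed A g \<gamma> r = sqrt (g c (\<gamma> r) v v)"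
  using speed_push[OF C1_map_id metric_transforms assms] by simp

lemma speed_nonneg:
  assumes "\<gamma> r \<in> topspace T"
  shows "0 \<le> speed A g \<gamma> r"
proof -
  have "\<exists>c. c \<in> A \<and> \<gamma> r \<in> fst c" using chart_exists[OF assms] by auto
  from someI_ex[OF this] show ?thesis
    unfolding speed_def Let_def by (simp add: metric_nonneg)
qed

lemma metric_velocity_chart_independent:
  assumes ab: "a < b" and C1: "C1_curve_on T A a b \<gamma>" and r: "r \<in> {a..b}"
    and c: "c \<in> A" "\<gamma> r \<in> fst c" and c': "c' \<in> A" "\<gamma> r \<in> fst c'"
  shows "g c' (\<gamma> r) (velocity c' \<gamma> a b r) (velocity c' \<gamma> a b r)
    = g c (\<gamma> r) (velocity c \<gamma> a b r) (velocity c \<gamma> a b r)"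
proof -
  have "((snd c' \<circ> (id \<circ> \<gamma>)) has_vector_derivative
      differential c c' id (\<gamma> r) (velocity c \<gamma> a b r)) (at r within {a..b})"
    by (rule push_velocity[OF C1_map_id c(1) c'(1) C1_curve_continuous[OF ab C1] r c(2) _
          C1_curve_velocity[OF ab C1 c(1) r c(2)]]) (use c' in simp)
  then have "velocity c' \<gamma> a b r = differential c c' id (\<gamma> r) (velocity c \<gamma> a b r)"
    by (intro velocity_eq[OF ab r]) simp
  then show ?thesis
    using preserves_metricD[OF metric_transforms c(1) c'(1) c(2), of "velocity c \<gamma> a b r"] c'(2) by simp
qed

lemma metric_continuous:
  assumes "c \<in> A"
  shows "continuous_on (snd c ` fst c) (\<lambda>x. g c (chart_inv c x) v w)"
  using metric_smooth[OF assms, of v w] unfolding smooth_on_def by (metis Ck_on.simps(1))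

text \<open>The extension to the closed interval uses one-sided velocities. It matters for integrability only,
  since \<open>speed\<close> itself takes arbitrary values at the ends.\<close>

lemma C1_curve_speed_continuous:
  assumes ab: "a < b" and C1: "C1_curve_on T A a b \<gamma>"
  shows "\<exists>\<sigma>. continuous_on {a..b} \<sigma> \<and> (\<forall>r\<in>{a<..<b}. speed A g \<gamma> r = \<sigma> r)"
proof -
  note \<gamma> = C1_curve_continuous[OF ab C1]
  obtain B :: "'e set" where "finite_dim_basis B" using finite_dim_basis_exists by blast
  then interpret finite_dim_basis B .
  have top: "\<gamma> r \<in> topspace T" if "r \<in> {a..b}" for r
    using continuous_map_funspace[OF \<gamma>] that by auto
  define ch where "ch r = (SOME c. c \<in> A \<and> \<gamma> r \<in> fst c)" for r
  have ch: "ch r \<in> A" "\<gamma> r \<in> fst (ch r)" if "r \<in> {a..b}" for r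
  proof -
    have "\<exists>c. c \<in> A \<and> \<gamma> r \<in> fst c" using chart_exists[OF top[OF that]] by auto
    from someI_ex[OF this] show "ch r \<in> A" "\<gamma> r \<in> fst (ch r)" by (auto simp: ch_def)
  qed
  define \<sigma> where "\<sigma> r = sqrt (g (ch r) (\<gamma> r) (velocity (ch r) \<gamma> a b r) (velocity (ch r) \<gamma> a b r))" for r
  have \<sigma>: "\<sigma> r = sqrt (g c (\<gamma> r) (velocity c \<gamma> a b r) (velocity c \<gamma> a b r))"
    if "r \<in> {a..b}" "c \<in> A" "\<gamma> r \<in> fst c" for r c
    unfolding \<sigma>_def using metric_velocity_chart_independent[OF ab C1 that(1) that(2,3) ch[OF that(1)]] by simp
  show ?thesis
  proof (intro exI[of _ \<sigma>] conjI ballI)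
    fix r assume r: "r \<in> {a<..<b}"
    then have r': "r \<in> {a..b}" by simp
    show "speed A g \<gamma> r = \<sigma> r"
      unfolding \<sigma>_def
      by (rule speed_eq[OF ch[OF r'] \<gamma> r C1_curve_velocity[OF ab C1 ch(1)[OF r'] r' ch(2)[OF r']]])
  next
    show "continuous_on {a..b} \<sigma>"
    proof (rule continuous_on_locally)
      fix r assume r: "r \<in> {a..b}"
      define c where "c = ch r"
      have c: "c \<in> A" "\<gamma> r \<in> fst c" using ch[OF r] by (auto simp: c_def)
      let ?U = "{s\<in>{a..b}. \<gamma> s \<in> fst c}"
      have "continuous_on ?U (\<lambda>s. g c (\<gamma> s) (velocity c \<gamma> a b s) (velocity c \<gamma> a b s))"
      proof (rule continuous_on_bilinear_apply[where F = "\<lambda>s. g c (\<gamma> s)"])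
        show "continuous_on ?U (velocity c \<gamma> a b)"
          by (rule C1_curve_velocity_continuous[OF ab C1 c(1)])
        then show "continuous_on ?U (velocity c \<gamma> a b)" .
        show "bilinear (g c (\<gamma> s))" if "s \<in> ?U" for s using metric_bilinear[OF c(1)] that by blast
        fix v w
        have "continuous_on ?U ((\<lambda>x. g c (chart_inv c x) v w) \<circ> (snd c \<circ> \<gamma>))"
          by (rule continuous_on_compose[OF continuous_on_chart_curve[OF c(1) \<gamma>]
                continuous_on_subset[OF metric_continuous[OF c(1)]]]) auto
        then show "continuous_on ?U (\<lambda>s. g c (\<gamma> s) v w)"
          by (rule continuous_on_eq) (simp add: chart_inv_left[OF c(1)])
      qed
      then have "continuous_on ?U (\<lambda>s. sqrt (g c (\<gamma> s) (velocity c \<gamma> a b s) (velocity c \<gamma> a b s)))"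
        by (intro continuous_intros)
      then have "continuous_on ?U \<sigma>"
        by (rule continuous_on_eq) (use \<sigma> c in auto)
      moreover have "openin (top_of_set {a..b}) ?U"
        by (rule openin_preimage_interval[OF \<gamma> chart_domain[OF c(1)]])
      ultimately show "\<exists>U. r \<in> U \<and> openin (top_of_set {a..b}) U \<and> continuous_on U \<sigma>"
        using r c by (intro exI[of _ ?U]) auto
    qed
  qed
qed

abbreviation length_on :: "(real \<Rightarrow> 'a) \<Rightarrow> real \<Rightarrow> real \<Rightarrow> real" where
  "length_on \<gamma> a b \<equiv> integral {a..b} (speed A g \<gamma>)"

lemma C1_curve_speed_integrable:
  assumes ab: "a < b" and C1: "C1_curve_on T A a b \<gamma>"
  shows "speed A g \<gamma> integrable_on {a..b}"
proof -
  obtain \<sigma> where \<sigma>: "continuous_on {a..b} \<sigma>" "\<forall>r\<in>{a<..<b}. speed A g \<gamma> r = \<sigma> r"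
    using C1_curve_speed_continuous[OF assms] by blast
  show ?thesis
    by (rule integrable_spike_finite[of "{a, b}" _ _ \<sigma>])
       (use \<sigma> integrable_continuous_real in auto)
qed

text \<open>Piecewise \<open>C\<^sup>1\<close> curves with their lengths, built by concatenation. Compared with a finite set of
  breakpoints, this gives an induction principle that reduces statements about curves to \<open>C\<^sup>1\<close>
  pieces; the two descriptions agree by \<open>piecewise_C1_curve_iff_has_length\<close>.\<close>

inductive has_length :: "(real \<Rightarrow> 'a) \<Rightarrow> real \<Rightarrow> real \<Rightarrow> real \<Rightarrow> bool" for \<gamma> where
  piece: "a < b \<Longrightarrow> C1_curve_on T A a b \<gamma> \<Longrightarrow> has_length \<gamma> a b (length_on \<gamma> a b)"
| join: "has_length \<gamma> a b l \<Longrightarrow> has_length \<gamma> b c m \<Longrightarrow> has_length \<gamma> a c (l + m)"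

lemma has_length_less: "has_length \<gamma> a b l \<Longrightarrow> a < b"
  by (induction rule: has_length.induct) auto

lemma continuous_map_join_intervals:
  fixes \<gamma> :: "real \<Rightarrow> 'a"
  assumes "a \<le> b" "b \<le> c"
    and "continuous_map (top_of_set {a..b}) T \<gamma>" "continuous_map (top_of_set {b..c}) T \<gamma>"
  shows "continuous_map (top_of_set {a..c}) T \<gamma>"
  unfolding continuous_map_closedin
proof (intro conjI allI impI)
  have ac: "{a..c} = {a..b} \<union> {b..c}" using assms by auto
  show "\<gamma> \<in> topspace (top_of_set {a..c}) \<rightarrow> topspace T"
    using assms(3,4) ac by (auto simp: continuous_map_def)
  fix C assume C: "closedin T C"
  have "closed {x\<in>{s..t}. \<gamma> x \<in> C}" if "continuous_map (top_of_set {s..t}) T \<gamma>" for s t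
  proof -
    have "closedin (top_of_set {s..t}) {x\<in>{s..t}. \<gamma> x \<in> C}"
      using closedin_continuous_map_preimage[OF that C] by simp
    then show ?thesis using closedin_closed_eq[of "{s..t}"] by simp
  qed
  from this[OF assms(3)] this[OF assms(4)]
  have "closed ({x\<in>{a..b}. \<gamma> x \<in> C} \<union> {x\<in>{b..c}. \<gamma> x \<in> C})" by (rule closed_Un)
  also have "{x\<in>{a..b}. \<gamma> x \<in> C} \<union> {x\<in>{b..c}. \<gamma> x \<in> C} = {x\<in>{a..c}. \<gamma> x \<in> C}"
    unfolding ac by auto
  finally show "closedin (top_of_set {a..c}) {x \<in> topspace (top_of_set {a..c}). \<gamma> x \<in> C}"
    using closedin_closed_eq[of "{a..c}"] by auto
qed

lemma has_length_continuous: "has_length \<gamma> a b l \<Longrightarrow> continuous_map (top_of_set {a..b}) T \<gamma>"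
proof (induction rule: has_length.induct)
  case (piece a b)
  then show ?case by (simp add: C1_curve_continuous)
next
  case (join a b l c m)
  then show ?case
    using continuous_map_join_intervals[of a b c] has_length_less[OF join.hyps(1)] has_length_less[OF join.hyps(2)] by simp
qed

lemma has_length_topspace: "has_length \<gamma> a b l \<Longrightarrow> r \<in> {a..b} \<Longrightarrow> \<gamma> r \<in> topspace T"
  using continuous_map_funspace[OF has_length_continuous] by fastforce

lemma has_length_integral: "has_length \<gamma> a b l \<Longrightarrow> (speed A g \<gamma> has_integral l) {a..b}"
proof (induction rule: has_length.induct)
  case (piece a b)
  then show ?case using C1_curve_speed_integrable by (simp add: integrable_integral)
next
  case (join a b l c m)
  then show ?case
    using has_integral_combine[of a b c] has_length_less[OF join.hyps(1)] has_length_less[OF join.hyps(2)] by simp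
qed

lemma has_length_nonneg:
  assumes "has_length \<gamma> a b l"
  shows "0 \<le> l"
  by (rule has_integral_nonneg[OF has_length_integral[OF assms]]) (rule speed_nonneg[where \<gamma> = \<gamma>, OF has_length_topspace[OF assms]])

lemma has_length_restrict:
  "has_length \<gamma> a b l \<Longrightarrow> a \<le> s \<Longrightarrow> s < t \<Longrightarrow> t \<le> b \<Longrightarrow> has_length \<gamma> s t (length_on \<gamma> s t)"
proof (induction arbitrary: s t rule: has_length.induct)
  case (piece a b)
  then show ?case using C1_curve_restrict by (intro has_length.piece) auto
next
  case (join a b l c m)
  consider "t \<le> b" | "b \<le> s" | "s < b" "b < t" by linarith
  then show ?case
  proof cases
    case 1 then show ?thesis using join by simp
  next
    case 2 then show ?thesis using join by simp
  next
    case 3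
    then have 1: "has_length \<gamma> s b (length_on \<gamma> s b)"
      and 2: "has_length \<gamma> b t (length_on \<gamma> b t)"
      using join has_length_less by auto
    have 12: "has_length \<gamma> s t (length_on \<gamma> s b + length_on \<gamma> b t)"
      by (rule has_length.join[OF 1 2])
    then show ?thesis using has_length_integral[OF 12] by (simp add: integral_unique)
  qed
qed

lemma has_length_push:
  assumes f: "C1_map f" "preserves_metric A g f"
  shows "has_length \<gamma> a b l \<Longrightarrow> has_length (f \<circ> \<gamma>) a b l"
proof (induction rule: has_length.induct)
  case (piece a b)
  have "has_length (f \<circ> \<gamma>) a b (length_on (f \<circ> \<gamma>) a b)"
    by (rule has_length.piece[OF piece.hyps(1) C1_curve_push'[OF f(1) piece.hyps]])
  moreover have eq: "length_on (f \<circ> \<gamma>) a b = length_on \<gamma> a b"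
  proof (rule integral_spike[of "{a, b}"])
    fix r assume r: "r \<in> {a..b} - {a, b}"
    then have r': "r \<in> {a..b}" "r \<in> {a<..<b}" by auto
    obtain c where c: "c \<in> A" "\<gamma> r \<in> fst c"
      using chart_exists has_length_topspace[OF has_length.piece[OF piece.hyps] r'(1)] by blast
    note vel = C1_curve_velocity[OF piece.hyps c(1) r'(1) c(2)]
    note \<gamma> = C1_curve_continuous[OF piece.hyps]
    show "speed A g \<gamma> r = speed A g (f \<circ> \<gamma>) r"
      unfolding speed_push[OF f c \<gamma> r'(2) vel] by (rule speed_eq[OF c \<gamma> r'(2) vel])
  qed simp
  ultimately show ?case by (simp only: eq)
next
  case (join a b l c m)
  then show ?case by (blast intro: has_length.join)
qed

text \<open>Length is invariant under affine changes of parameter, including reversal: the speed is multiplied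
  by \<open>\<bar>m\<bar>\<close>, which the substitution in the integral compensates.\<close>

lemma C1_curve_affine_length:
  assumes C1: "C1_curve_on T A a b \<gamma>" and "a < b" "m \<noteq> 0" and ab': "a' < b'"
    and im: "(\<lambda>r. m * r + k) ` {a'..b'} = {a..b}"
    and \<gamma>': "\<And>r. r \<in> {a'..b'} \<Longrightarrow> \<gamma>' r = \<gamma> (m * r + k)"
  shows "has_length \<gamma>' a' b' (length_on \<gamma> a b)"
proof -
  have h: "m * r + k \<in> {a..b}" if "r \<in> {a'..b'}" for r using im that by blast
  have C1': "C1_curve_on T A a' b' \<gamma>'"
    by (rule C1_curve_affine[OF C1]) (use h \<gamma>' in auto)
  have "speed A g \<gamma>' r = \<bar>m\<bar> * speed A g \<gamma> (m * r + k)" if r: "r \<in> {a'<..<b'}" for r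
  proof -
    have r': "r \<in> {a'..b'}" using r by simp
    have inj: "m * r + k \<noteq> m * r1 + k" if "r1 \<in> {a', b'}" for r1
      using that r \<open>m \<noteq> 0\<close> by auto
    have ends: "a \<in> (\<lambda>r. m * r + k) ` {a', b'}" "b \<in> (\<lambda>r. m * r + k) ` {a', b'}"
    proof -
      obtain ra rb where ra: "ra \<in> {a'..b'}" "a = m * ra + k" and rb: "rb \<in> {a'..b'}" "b = m * rb + k"
        using im \<open>a < b\<close> by (metis (no_types, lifting) atLeastAtMost_iff imageE less_imp_le order_refl)
      have le: "a \<le> m * a' + k" "m * a' + k \<le> b" "a \<le> m * b' + k" "m * b' + k \<le> b"
        using h[of a'] h[of b'] ab' by auto
      have "a \<in> (\<lambda>r. m * r + k) ` {a', b'} \<and> b \<in> (\<lambda>r. m * r + k) ` {a', b'}"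
      proof (cases "m > 0")
        case True
        then have "ra = a'" "rb = b'" using ra rb le by auto
        then show ?thesis using ra rb by auto
      next
        case False
        then have "ra = b'" "rb = a'" using ra rb le \<open>m \<noteq> 0\<close> by (auto simp: not_less)
        then show ?thesis using ra rb by auto
      qed
      then show "a \<in> (\<lambda>r. m * r + k) ` {a', b'}" "b \<in> (\<lambda>r. m * r + k) ` {a', b'}" by auto
    qed
    have "m * r + k \<noteq> a" "m * r + k \<noteq> b" using ends inj by blast+
    then have hr: "m * r + k \<in> {a<..<b}" using h[OF r'] by auto
    then have hr': "m * r + k \<in> {a..b}" by simp
    obtain c where c: "c \<in> A" "\<gamma> (m * r + k) \<in> fst c"
      using chart_exists has_length_topspace[OF has_length.piece[OF \<open>a < b\<close> C1] hr'] by blast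
    define v where "v = velocity c \<gamma> a b (m * r + k)"
    have v: "((snd c \<circ> \<gamma>) has_vector_derivative v) (at (m * r + k) within {a..b})"
      unfolding v_def by (rule C1_curve_velocity[OF \<open>a < b\<close> C1 c(1) hr' c(2)])
    have "((\<lambda>r. m * r + k) has_vector_derivative m) (at r within {a'..b'})"
      by (auto intro!: derivative_eq_intros simp: has_real_derivative_iff_has_vector_derivative[symmetric])
    moreover have "((snd c \<circ> \<gamma>) has_vector_derivative v) (at (m * r + k) within (\<lambda>r. m * r + k) ` {a'..b'})"
      using v im by simp
    ultimately have "(((snd c \<circ> \<gamma>) \<circ> (\<lambda>r. m * r + k)) has_vector_derivative m *\<^sub>R v) (at r within {a'..b'})"
      by (rule vector_diff_chain_within)
    then have "((snd c \<circ> \<gamma>') has_vector_derivative m *\<^sub>R v) (at r within {a'..b'})"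
      by (rule has_vector_derivative_transform[rotated 2]) (use \<gamma>' r' in auto)
    then have "speed A g \<gamma>' r = sqrt (g c (\<gamma> (m * r + k)) (m *\<^sub>R v) (m *\<^sub>R v))"
      using speed_eq[of c \<gamma>' r a' b' "m *\<^sub>R v"] c r \<gamma>'[OF r'] C1_curve_continuous[OF ab' C1'] by simp
    also have "g c (\<gamma> (m * r + k)) (m *\<^sub>R v) (m *\<^sub>R v) = m ^ 2 * g c (\<gamma> (m * r + k)) v v"
      using metric_bilinear[OF c]
      by (simp add: bilinear_lmul bilinear_rmul power2_eq_square)
    also have "sqrt \<dots> = \<bar>m\<bar> * speed A g \<gamma> (m * r + k)"
      unfolding speed_eq[OF c C1_curve_continuous[OF \<open>a < b\<close> C1] hr v] by (simp add: real_sqrt_mult)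
    finally show ?thesis .
  qed
  note speed' = this
  have inv_im: "(\<lambda>x. (1 / m) * x + - ((1 / m) * k)) ` {a..b} = {a'..b'}"
    unfolding im[symmetric] image_image using \<open>m \<noteq> 0\<close> by (simp add: field_simps)
  have "(speed A g \<gamma> has_integral length_on \<gamma> a b) (cbox a b)"
    using C1_curve_speed_integrable[OF \<open>a < b\<close> C1] by (simp add: integrable_integral)
  from has_integral_affinity[OF this \<open>m \<noteq> 0\<close>, of k]
  have "((\<lambda>r. speed A g \<gamma> (m * r + k)) has_integral (1 / \<bar>m\<bar>) * length_on \<gamma> a b) {a'..b'}"
    by (simp add: inv_im[simplified])
  from has_integral_mult_right[OF this, of "\<bar>m\<bar>"]
  have "((\<lambda>r. \<bar>m\<bar> * speed A g \<gamma> (m * r + k)) has_integral length_on \<gamma> a b) {a'..b'}"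
    using \<open>m \<noteq> 0\<close> by simp
  then have "(speed A g \<gamma>' has_integral length_on \<gamma> a b) {a'..b'}"
    by (rule has_integral_spike_finite[of "{a', b'}", rotated 2]) (use speed' in auto)
  then show ?thesis
    using has_length.piece[OF ab' C1'] by (simp add: integral_unique)
qed

lemma has_length_affine_pos:
  assumes "0 < m"
  shows "has_length \<gamma> a b l \<Longrightarrow> (\<And>r. m * r + k \<in> {a..b} \<Longrightarrow> \<gamma>' r = \<gamma> (m * r + k)) \<Longrightarrow>
    has_length \<gamma>' ((a - k) / m) ((b - k) / m) l"
proof (induction rule: has_length.induct)
  case (piece a b)
  have im: "(\<lambda>r. m * r + k) ` {(a - k) / m..(b - k) / m} = {a..b}"
    by (rule affine_image_Icc_pos[OF assms])
  show ?case
  proof (rule C1_curve_affine_length[where m = m and k = k, OF piece.hyps(2,1) _ _ im])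
    show "\<gamma>' r = \<gamma> (m * r + k)" if "r \<in> {(a - k) / m..(b - k) / m}" for r
      by (rule piece.prems) (use im that in blast)
  qed (use assms piece.hyps(1) in \<open>auto simp: divide_strict_right_mono\<close>)
next
  case (join a b l c n)
  then show ?case
    using has_length_less[OF join.hyps(1)] has_length_less[OF join.hyps(2)] by (intro has_length.join[of _ _ "(b - k) / m"]) auto
qed

lemma has_length_affine_neg:
  assumes "m < 0"
  shows "has_length \<gamma> a b l \<Longrightarrow> (\<And>r. m * r + k \<in> {a..b} \<Longrightarrow> \<gamma>' r = \<gamma> (m * r + k)) \<Longrightarrow>
    has_length \<gamma>' ((b - k) / m) ((a - k) / m) l"
proof (induction rule: has_length.induct)
  case (piece a b)
  have im: "(\<lambda>r. m * r + k) ` {(b - k) / m..(a - k) / m} = {a..b}"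
    by (rule affine_image_Icc_neg[OF assms])
  show ?case
  proof (rule C1_curve_affine_length[where m = m and k = k, OF piece.hyps(2,1) _ _ im])
    show "\<gamma>' r = \<gamma> (m * r + k)" if "r \<in> {(b - k) / m..(a - k) / m}" for r
      by (rule piece.prems) (use im that in blast)
  qed (use assms piece.hyps(1) in \<open>auto simp: divide_strict_right_mono_neg\<close>)
next
  case (join a b l c n)
  have "has_length \<gamma>' ((c - k) / m) ((a - k) / m) (n + l)"
    using has_length_less[OF join.hyps(1)] has_length_less[OF join.hyps(2)] join
    by (intro has_length.join[of _ _ "(b - k) / m"]) auto
  then show ?case by (simp add: add.commute)
qed

lemma has_length_imp_piecewise_C1:
  assumes "has_length \<gamma> a b l"
  shows "\<exists>P. finite P \<and> {a, b} \<subseteq> P \<and> P \<subseteq> {a..b} \<and>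
    (\<forall>s\<in>P. \<forall>t\<in>P. s < t \<and> P \<inter> {s<..<t} = {} \<longrightarrow> C1_curve_on T A s t \<gamma>)"
  using assms
proof (induction rule: has_length.induct)
  case (piece a b)
  then show ?case by (intro exI[of _ "{a, b}"]) auto
next
  case (join a b l c m)
  then obtain P Q where P: "finite P" "{a, b} \<subseteq> P" "P \<subseteq> {a..b}"
      "\<forall>s\<in>P. \<forall>t\<in>P. s < t \<and> P \<inter> {s<..<t} = {} \<longrightarrow> C1_curve_on T A s t \<gamma>"
    and Q: "finite Q" "{b, c} \<subseteq> Q" "Q \<subseteq> {b..c}"
      "\<forall>s\<in>Q. \<forall>t\<in>Q. s < t \<and> Q \<inter> {s<..<t} = {} \<longrightarrow> C1_curve_on T A s t \<gamma>"
    by metis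
  show ?case
  proof (intro exI[of _ "P \<union> Q"] conjI ballI impI)
    show "finite (P \<union> Q)" "{a, c} \<subseteq> P \<union> Q" using P Q by auto
    show "P \<union> Q \<subseteq> {a..c}"
      using P Q has_length_less[OF join.hyps(1)] has_length_less[OF join.hyps(2)] by fastforce
    fix s t assume st: "s \<in> P \<union> Q" "t \<in> P \<union> Q" "s < t \<and> (P \<union> Q) \<inter> {s<..<t} = {}"
    have "b \<notin> {s<..<t}" using st(3) P(2) by auto
    then consider "t \<le> b" | "b \<le> s" by fastforce
    then show "C1_curve_on T A s t \<gamma>"
    proof cases
      case 1
      then have "s \<in> P" "t \<in> P" using st P(2,3) Q(3) by (auto simp: subset_iff dest!: order_antisym)
      then show ?thesis using P(4) st(3) by blast
    next
      case 2
      then have "s \<in> Q" "t \<in> Q" using st Q(2,3) P(3) by (auto simp: subset_iff dest!: order_antisym)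
      then show ?thesis using Q(4) st(3) by blast
    qed
  qed
qed

text \<open>Split off the first piece, which ends at the smallest breakpoint after \<open>a\<close>.\<close>

lemma piecewise_C1_imp_has_length:
  assumes "finite P" "{a, b} \<subseteq> P" "P \<subseteq> {a..b}" "a < b"
    "\<forall>s\<in>P. \<forall>t\<in>P. s < t \<and> P \<inter> {s<..<t} = {} \<longrightarrow> C1_curve_on T A s t \<gamma>"
  shows "\<exists>l. has_length \<gamma> a b l"
  using assms
proof (induction "card P" arbitrary: P a rule: less_induct)
  case less
  define t where "t = Min (P - {a})"
  have fin: "finite (P - {a})" "P - {a} \<noteq> {}" using less.prems by auto
  have t: "t \<in> P - {a}" unfolding t_def by (rule Min_in[OF fin])
  have t_le: "t \<le> s" if "s \<in> P - {a}" for s unfolding t_def by (rule Min_le[OF fin(1) that])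
  have "a < t" using t less.prems(3) by fastforce
  have "P \<inter> {a<..<t} = {}" using t_le by fastforce
  then have "C1_curve_on T A a t \<gamma>" using less.prems(2,5) t \<open>a < t\<close> by auto
  then have at: "has_length \<gamma> a t (length_on \<gamma> a t)" by (rule has_length.piece[OF \<open>a < t\<close>])
  show ?case
  proof (cases "t = b")
    case True
    then show ?thesis using at by blast
  next
    case False
    have "\<exists>l. has_length \<gamma> t b l"
    proof (rule less.hyps[of "P - {a}"])
      show "card (P - {a}) < card P"
        by (rule psubset_card_mono) (use less.prems in auto)
      show "{t, b} \<subseteq> P - {a}" using t less.prems by auto
      show "t < b" using False t less.prems(3) by fastforce
      show "P - {a} \<subseteq> {t..b}" using t_le less.prems(3) by fastforce
      show "\<forall>s\<in>P - {a}. \<forall>u\<in>P - {a}. s < u \<and> (P - {a}) \<inter> {s<..<u} = {} \<longrightarrow> C1_curve_on T A s u \<gamma>"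
      proof (intro ballI impI)
        fix s u assume su: "s \<in> P - {a}" "u \<in> P - {a}" "s < u \<and> (P - {a}) \<inter> {s<..<u} = {}"
        have "a \<notin> {s<..<u}" using t_le[OF su(1)] \<open>a < t\<close> by auto
        then have "P \<inter> {s<..<u} = (P - {a}) \<inter> {s<..<u}" by blast
        then have "s < u \<and> P \<inter> {s<..<u} = {}" using su(3) by simp
        moreover have "s \<in> P" "u \<in> P" using su by auto
        ultimately show "C1_curve_on T A s u \<gamma>" using less.prems(5) by (metis (no_types, lifting))
      qed
    qed (use fin in auto)
    then show ?thesis using has_length.join[OF at] by blast
  qed
qed

lemma piecewise_C1_curve_iff_has_length:
  "piecewise_C1_curve T A \<gamma> \<longleftrightarrow> has_length \<gamma> 0 1 (curve_length A g \<gamma>)"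
proof
  assume "piecewise_C1_curve T A \<gamma>"
  then obtain P where "finite P" "{0, 1} \<subseteq> P" "P \<subseteq> {0..1}"
    "\<forall>s\<in>P. \<forall>t\<in>P. s < t \<and> P \<inter> {s<..<t} = {} \<longrightarrow> C1_curve_on T A s t \<gamma>"
    unfolding piecewise_C1_curve_def by (elim exE conjE)
  then obtain l where l: "has_length \<gamma> 0 1 l"
    using piecewise_C1_imp_has_length[of P 0 1 \<gamma>] by (metis zero_less_one)
  then show "has_length \<gamma> 0 1 (curve_length A g \<gamma>)"
    using has_length_integral[OF l] by (simp add: curve_length_def integral_unique)
next
  assume "has_length \<gamma> 0 1 (curve_length A g \<gamma>)"
  then show "piecewise_C1_curve T A \<gamma>"
    unfolding piecewise_C1_curve_def using has_length_imp_piecewise_C1 by auto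
qed

abbreviation rdist :: "'a \<Rightarrow> 'a \<Rightarrow> ennreal" where
  "rdist \<equiv> riemannian_dist T A g"

text \<open>Lengths of curves between two points, detached from their parametrisations; the distance is the
  infimum of these lengths.\<close>

definition joined :: "'a \<Rightarrow> 'a \<Rightarrow> real \<Rightarrow> bool" where
  "joined p q l \<longleftrightarrow> (\<exists>\<gamma>. has_length \<gamma> 0 1 l \<and> \<gamma> 0 = p \<and> \<gamma> 1 = q)"

lemma joined_nonneg: "joined p q l \<Longrightarrow> 0 \<le> l"
  by (auto simp: joined_def has_length_nonneg)

lemma joined_of_has_length:
  assumes "has_length \<gamma> a b l"
  shows "joined (\<gamma> a) (\<gamma> b) l"
proof -
  have "0 < b - a" using has_length_less[OF assms] by simp
  from has_length_affine_pos[OF this assms, where k = a and \<gamma>' = "\<lambda>r. \<gamma> ((b - a) * r + a)"]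
  have "has_length (\<lambda>r. \<gamma> ((b - a) * r + a)) 0 1 l" using \<open>0 < b - a\<close> by simp
  then show ?thesis unfolding joined_def by (intro exI[of _ "\<lambda>r. \<gamma> ((b - a) * r + a)"]) auto
qed

lemma joined_sym:
  assumes "joined p q l"
  shows "joined q p l"
proof -
  obtain \<gamma> where \<gamma>: "has_length \<gamma> 0 1 l" "\<gamma> 0 = p" "\<gamma> 1 = q" using assms by (auto simp: joined_def)
  have "has_length (\<lambda>r. \<gamma> (- 1 * r + 1)) 0 1 l"
    using has_length_affine_neg[of "- 1" \<gamma> 0 1 l 1 "\<lambda>r. \<gamma> (- 1 * r + 1)"] \<gamma>(1) by simp
  then show ?thesis unfolding joined_def using \<gamma> by (intro exI[of _ "\<lambda>r. \<gamma> (- 1 * r + 1)"]) auto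
qed

lemma joined_trans:
  assumes "joined p q l" "joined q s m"
  shows "joined p s (l + m)"
proof -
  obtain \<gamma> where \<gamma>: "has_length \<gamma> 0 1 l" "\<gamma> 0 = p" "\<gamma> 1 = q" using assms by (auto simp: joined_def)
  obtain \<eta> where \<eta>: "has_length \<eta> 0 1 m" "\<eta> 0 = q" "\<eta> 1 = s" using assms by (auto simp: joined_def)
  define \<kappa> where "\<kappa> r = (if r \<le> 1 then \<gamma> r else \<eta> (r - 1))" for r
  have "has_length \<kappa> 0 1 l"
    using has_length_affine_pos[of 1 \<gamma> 0 1 l 0 \<kappa>] \<gamma>(1) by (simp add: \<kappa>_def)
  moreover have "has_length \<kappa> 1 2 m"
  proof -
    have "\<kappa> r = \<eta> (1 * r + - 1)" if "1 * r + - 1 \<in> {0..1}" for r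
      using that \<gamma>(3) \<eta>(2) by (cases "r = 1") (auto simp: \<kappa>_def)
    from has_length_affine_pos[OF zero_less_one \<eta>(1), of "- 1" \<kappa>, OF this] show ?thesis by simp
  qed
  ultimately have "has_length \<kappa> 0 2 (l + m)" by (rule has_length.join)
  from joined_of_has_length[OF this] show ?thesis using \<gamma> \<eta> by (simp add: \<kappa>_def)
qed

lemma joined_push:
  assumes "C1_map f" "preserves_metric A g f" "joined p q l"
  shows "joined (f p) (f q) l"
  using assms has_length_push unfolding joined_def by (metis comp_apply)

lemma riemannian_dist_eq_INF_joined:
  "rdist p q = (INF l\<in>{l. joined p q l}. ennreal l)"
proof -
  have len: "curve_length A g \<gamma> = l" if "has_length \<gamma> 0 1 l" for \<gamma> l
    using has_length_integral[OF that] by (simp add: curve_length_def integral_unique)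
  have "(curve_length A g) ` {\<gamma>. piecewise_C1_curve T A \<gamma> \<and> \<gamma> 0 = p \<and> \<gamma> 1 = q} = {l. joined p q l}"
  proof (intro Set.set_eqI iffI)
    fix l assume "l \<in> {l. joined p q l}"
    then obtain \<gamma> where \<gamma>: "has_length \<gamma> 0 1 l" "\<gamma> 0 = p" "\<gamma> 1 = q" by (auto simp: joined_def)
    then show "l \<in> (curve_length A g) ` {\<gamma>. piecewise_C1_curve T A \<gamma> \<and> \<gamma> 0 = p \<and> \<gamma> 1 = q}"
      using len[OF \<gamma>(1)] by (intro image_eqI[of _ _ \<gamma>]) (auto simp: piecewise_C1_curve_iff_has_length)
  qed (auto simp: joined_def piecewise_C1_curve_iff_has_length)
  from this[symmetric] show ?thesis
    unfolding riemannian_dist_def by (simp only: image_image)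
qed

lemma riemannian_dist_le: "joined p q l \<Longrightarrow> rdist p q \<le> ennreal l"
  unfolding riemannian_dist_eq_INF_joined by (rule INF_lower) simp

lemma riemannian_dist_less:
  "rdist p q < L \<longleftrightarrow> (\<exists>l. joined p q l \<and> ennreal l < L)"
  unfolding riemannian_dist_eq_INF_joined INF_less_iff by auto

lemma riemannian_dist_sym: "rdist p q = rdist q p"
proof -
  have "joined p q = joined q p" using joined_sym by blast
  then show ?thesis by (simp add: riemannian_dist_eq_INF_joined)
qed

lemma riemannian_dist_triangle:
  "rdist p s \<le> rdist p q + rdist q s"
proof (rule ennreal_le_epsilon)
  fix e :: real
  assume fin: "rdist p q + rdist q s < Orderings.top" and e: "0 < e"
  have less: "\<exists>l. joined x y l \<and> ennreal l < rdist x y + ennreal (e / 2)"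
    if "rdist x y < Orderings.top" for x y
  proof -
    have "rdist x y < rdist x y + ennreal (e / 2)"
      using that e by (simp add: ennreal_add_left_cancel_less[of _ 0, simplified])
    then show ?thesis using riemannian_dist_less by blast
  qed
  obtain l where l: "joined p q l" "ennreal l < rdist p q + ennreal (e / 2)"
    using less[of p q] fin by (auto simp: less_top)
  obtain m where m: "joined q s m" "ennreal m < rdist q s + ennreal (e / 2)"
    using less[of q s] fin by (auto simp: less_top)
  have "rdist p s \<le> ennreal (l + m)"
    by (rule riemannian_dist_le[OF joined_trans[OF l(1) m(1)]])
  also have "\<dots> = ennreal l + ennreal m"
    using joined_nonneg[OF l(1)] joined_nonneg[OF m(1)] by (simp add: ennreal_plus)
  also have "\<dots> \<le> (rdist p q + ennreal (e / 2)) + (rdist q s + ennreal (e / 2))"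
    using l(2) m(2) by (intro add_mono) auto
  also have "\<dots> = rdist p q + rdist q s + (ennreal (e / 2) + ennreal (e / 2))"
    by (simp add: ac_simps)
  also have "ennreal (e / 2) + ennreal (e / 2) = ennreal e"
    using e by (simp add: ennreal_plus[symmetric] del: ennreal_plus)
  finally show "rdist p s \<le> rdist p q + rdist q s + ennreal e" .
qed

lemma riemannian_dist_push_le:
  assumes "C1_map f" "preserves_metric A g f"
  shows "rdist (f p) (f q) \<le> rdist p q"
  unfolding riemannian_dist_eq_INF_joined[of p q]
  by (rule INF_greatest) (use joined_push[OF assms] riemannian_dist_le in blast)

end

section \<open>Almost flat balls\<close>

locale pos_def_form =
  fixes Q :: "'e::real_vector \<Rightarrow> 'e \<Rightarrow> real"
  assumes bilinear_Q: "bilinear Q" and Q_sym: "Q v w = Q w v" and Q_pos: "v \<noteq> 0 \<Longrightarrow> 0 < Q v v"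
begin

definition nrm :: "'e \<Rightarrow> real" where
  "nrm v = sqrt (Q v v)"

lemma Q_nonneg: "0 \<le> Q v v"
  using Q_pos[of v] bilinear_lzero[OF bilinear_Q] by (cases "v = 0") auto

lemma nrm_nonneg: "0 \<le> nrm v"
  by (simp add: nrm_def Q_nonneg)

lemma nrm_power2: "(nrm v)\<^sup>2 = Q v v"
  by (simp add: nrm_def Q_nonneg)

lemma nrm_pos: "v \<noteq> 0 \<Longrightarrow> 0 < nrm v"
  by (simp add: nrm_def Q_pos)

lemma nrm_scale: "nrm (r *\<^sub>R v) = \<bar>r\<bar> * nrm v"
proof -
  have "Q (r *\<^sub>R v) (r *\<^sub>R v) = r\<^sup>2 * Q v v"
    by (simp add: bilinear_lmul[OF bilinear_Q] bilinear_rmul[OF bilinear_Q] power2_eq_square)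
  then show ?thesis by (simp add: nrm_def real_sqrt_mult)
qed

lemma nrm_minus_commute: "nrm (v - w) = nrm (w - v)"
  using nrm_scale[of "-1" "v - w"] by simp

lemma Cauchy_Schwarz_form: "Q v w \<le> nrm v * nrm w"
proof (cases "w = 0")
  case True
  then show ?thesis using bilinear_rzero[OF bilinear_Q] by (simp add: nrm_def)
next
  case False
  \<comment> \<open>\<open>t *\<^sub>R w\<close> is the projection of \<open>v\<close> to the line of \<open>w\<close>\<close>
  define t where "t = Q v w / Q w w"
  have "0 \<le> Q (v - t *\<^sub>R w) (v - t *\<^sub>R w)" by (rule Q_nonneg)
  also have "\<dots> = Q v v + t * t * Q w w - 2 * t * Q v w"
    using bilinear_diff_self[OF bilinear_Q Q_sym, of v "t *\<^sub>R w"]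
    by (simp add: bilinear_lmul[OF bilinear_Q] bilinear_rmul[OF bilinear_Q])
  also have "\<dots> = Q v v - (Q v w)\<^sup>2 / Q w w"
    using Q_pos[OF False] by (simp add: t_def power2_eq_square)
  finally have "(Q v w)\<^sup>2 \<le> Q v v * Q w w"
    using Q_pos[OF False] by (simp add: field_simps)
  then have "(Q v w)\<^sup>2 \<le> (nrm v * nrm w)\<^sup>2" by (simp add: power_mult_distrib nrm_power2)
  then show ?thesis by (rule power2_le_imp_le) (simp add: nrm_nonneg)
qed

lemma nrm_triangle: "nrm (v + w) \<le> nrm v + nrm w"
proof -
  have "(nrm (v + w))\<^sup>2 = Q v v + Q w w + 2 * Q v w"
    using Q_sym[of w v] unfolding nrm_power2
    by (simp add: bilinear_ladd[OF bilinear_Q] bilinear_radd[OF bilinear_Q])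
  also have "\<dots> \<le> (nrm v + nrm w)\<^sup>2"
    using Cauchy_Schwarz_form[of v w] by (simp add: power2_sum nrm_power2)
  finally show ?thesis by (rule power2_le_imp_le) (simp add: nrm_nonneg)
qed

lemma nrm_triangle_diff: "nrm (u - w) \<le> nrm (u - v) + nrm (v - w)"
  using nrm_triangle[of "u - v" "v - w"] by simp

lemma nrm_ge_coordinates:
  assumes "finite B" "independent B"
  shows "\<exists>m>0. \<forall>a. m * (\<Sum>b\<in>B. \<bar>a b\<bar>) \<le> nrm (\<Sum>b\<in>B. a b *\<^sub>R b)"
  by (rule norm_ge_coordinates[OF assms nrm_triangle nrm_scale nrm_pos])

end

context riemannian_manifold
begin

lemma pos_def_form_metric: "c \<in> A \<Longrightarrow> p \<in> fst c \<Longrightarrow> pos_def_form (g c p)"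
  by (rule pos_def_form.intro[OF metric_bilinear metric_symmetric metric_pos_def])

lemma joined_refl:
  assumes "p \<in> topspace T"
  shows "joined p p 0"
proof -
  have C1: "C1_curve_on T A 0 1 (\<lambda>_. p)"
    unfolding C1_curve_on_def
    using assms by (auto intro!: exI[of _ "\<lambda>_. 0"] simp: comp_def)
  obtain c where c: "c \<in> A" "p \<in> fst c" using chart_exists[OF assms] by blast
  have "speed A g (\<lambda>_. p) r = 0" if "r \<in> {0<..<1}" for r
    using speed_eq[of c "\<lambda>_. p" r 0 1 0] c that C1_curve_continuous[OF _ C1] bilinear_lzero[OF metric_bilinear[OF c]]
    by (simp add: comp_def)
  then have "length_on (\<lambda>_. p) 0 1 = integral {0..1} (\<lambda>_::real. 0::real)"
    by (intro integral_spike[of "{0, 1}"]) auto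
  then have "has_length (\<lambda>_. p) 0 1 0" using has_length.piece[OF _ C1] by simp
  then show ?thesis unfolding joined_def by (intro exI[of _ "\<lambda>_. p"]) simp
qed

lemma riemannian_dist_refl: "p \<in> topspace T \<Longrightarrow> rdist p p = 0"
  using riemannian_dist_le[OF joined_refl] by simp

lemma has_length_dist_le:
  assumes "has_length \<gamma> a b l" "s \<in> {a..b}" "t \<in> {a..b}"
  shows "rdist (\<gamma> s) (\<gamma> t)
    \<le> ennreal \<bar>length_on \<gamma> a s - length_on \<gamma> a t\<bar>"
proof -
  have le: "rdist (\<gamma> s) (\<gamma> t)
      \<le> ennreal \<bar>length_on \<gamma> a s - length_on \<gamma> a t\<bar>"
    if st: "a \<le> s" "s < t" "t \<le> b" for s t
  proof -
    have st_length: "has_length \<gamma> s t (length_on \<gamma> s t)" by (rule has_length_restrict[OF assms(1) st])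
    have "speed A g \<gamma> integrable_on {a..t}"
      using integrable_on_subinterval[OF has_integral_integrable[OF has_length_integral[OF assms(1)]]] st by auto
    then have "length_on \<gamma> a s + length_on \<gamma> s t = length_on \<gamma> a t"
      by (intro Henstock_Kurzweil_Integration.integral_combine) (use st in auto)
    then have "\<bar>length_on \<gamma> a s - length_on \<gamma> a t\<bar> = length_on \<gamma> s t"
      using has_length_nonneg[OF st_length] by linarith
    then show ?thesis
      using riemannian_dist_le[OF joined_of_has_length[OF st_length]] by (simp only:)
  qed
  consider "s < t" | "s = t" | "t < s" by linarith
  then show ?thesis
  proof cases
    case 1 then show ?thesis using le assms by simp
  next
    case 2
    then show ?thesis using riemannian_dist_refl has_length_topspace[OF assms(1,2)] by simp
  next
    case 3
    then show ?thesis
      using le[of t s] assms riemannian_dist_sym[of "\<gamma> s"] by (simp add: abs_minus_commute)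
  qed
qed

text \<open>Cut the curve where the length covered so far is a multiple of \<open>l / N\<close>. The parameters found by
  the intermediate value theorem need not be increasing where the curve rests, which
  \<open>has_length_dist_le\<close> allows.\<close>

lemma joined_subdivide:
  assumes "joined p q l" "0 < (N::nat)"
  shows "\<exists>x. (\<forall>k. x k \<in> topspace T) \<and> x 0 = p \<and> x N = q \<and>
    (\<forall>k<N. rdist (x k) (x (Suc k)) \<le> ennreal (l / N))"
proof -
  obtain \<gamma> where \<gamma>: "has_length \<gamma> 0 1 l" "\<gamma> 0 = p" "\<gamma> 1 = q" using assms by (auto simp: joined_def)
  define I where "I t = length_on \<gamma> 0 t" for t
  have int: "(speed A g \<gamma> has_integral l) {0..1}" by (rule has_length_integral[OF \<gamma>(1)])
  have I: "I 0 = 0" "I 1 = l" "continuous_on {0..1} I"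
    using int unfolding I_def
    by (auto simp: integral_unique intro!: indefinite_integral_continuous_1 has_integral_integrable[OF int])
  have "\<exists>t\<in>{0..1}. I t = k * (l / N) \<and> (k = 0 \<longrightarrow> t = 0) \<and> (k = N \<longrightarrow> t = 1)" if "k \<le> N" for k :: nat
  proof -
    have l0: "0 \<le> l" by (rule has_length_nonneg[OF \<gamma>(1)])
    have "k * (l / N) \<le> l"
      using that assms(2) l0 mult_right_mono[of "real k" "real N" "l"] by (simp add: field_simps)
    then obtain t where t: "0 \<le> t" "t \<le> 1" "I t = k * (l / N)"
      using IVT'[of I 0 "k * (l / N)" 1] I l0 by auto
    consider "k = 0" | "k = N" "k \<noteq> 0" | "k \<noteq> 0" "k \<noteq> N" by blast
    then show ?thesis
    proof cases
      case 1 then show ?thesis using I assms(2) by (intro bexI[of _ 0]) auto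
    next
      case 2 then show ?thesis using I assms(2) by (intro bexI[of _ 1]) auto
    next
      case 3 then show ?thesis using t by (intro bexI[of _ t]) auto
    qed
  qed
  then have "\<forall>k. \<exists>t. k \<le> N \<longrightarrow> t \<in> {0..1} \<and> I t = k * (l / N) \<and> (k = 0 \<longrightarrow> t = 0) \<and> (k = N \<longrightarrow> t = 1)"
    by blast
  then obtain t where t: "\<And>k. k \<le> N \<Longrightarrow> t k \<in> {0..1} \<and> I (t k) = k * (l / N) \<and> (k = 0 \<longrightarrow> t k = 0) \<and> (k = N \<longrightarrow> t k = 1)"
    by metis
  show ?thesis
  proof (intro exI[of _ "\<lambda>k. \<gamma> (t (min k N))"] conjI allI impI)
    show "\<gamma> (t (min k N)) \<in> topspace T" for k
      using has_length_topspace[OF \<gamma>(1)] t[of "min k N"] by simp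
    show "\<gamma> (t (min 0 N)) = p" "\<gamma> (t (min N N)) = q"
      using t[of 0] t[of N] \<gamma> by simp_all
    fix k assume k: "k < N"
    have t1: "t k \<in> {0..1}" "I (t k) = k * (l / N)" using t[of k] k by auto
    have t2: "t (Suc k) \<in> {0..1}" "I (t (Suc k)) = (k + 1) * (l / N)" using t[of "Suc k"] k by auto
    have "\<bar>I (t k) - I (t (Suc k))\<bar> = l / N"
    proof -
      have "k * (l / N) - (k + 1) * (l / N) = - (l / N)" by (simp add: distrib_right add_divide_distrib)
      then show ?thesis unfolding t1(2) t2(2) using has_length_nonneg[OF \<gamma>(1)] by simp
    qed
    then show "rdist (\<gamma> (t (min k N))) (\<gamma> (t (min (Suc k) N))) \<le> ennreal (l / N)"
      using has_length_dist_le[OF \<gamma>(1) t1(1) t2(1)] k by (simp add: I_def)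
  qed
qed

end

text \<open>A chart around \<open>p0\<close>; the model space carries the norm \<open>nrm\<close> of the metric tensor at \<open>p0\<close>.\<close>

locale riemannian_chart = riemannian_manifold T A g
  for T :: "'a topology" and A :: "('a, 'e::real_normed_vector) chart set" and g +
  fixes c :: "('a, 'e) chart" and p0 :: 'a
  assumes chart: "c \<in> A" and base: "p0 \<in> fst c"
begin

sublocale pos_def_form "g c p0"
  by (rule pos_def_form_metric[OF chart base])

definition radius :: "'a \<Rightarrow> real" where
  "radius p = nrm (snd c p - snd c p0)"

lemma norm_le_nrm: "\<exists>K>0. \<forall>v. norm v \<le> K * nrm v"
proof -
  obtain B :: "'e set" where "finite_dim_basis B" using finite_dim_basis_exists by blast
  then interpret finite_dim_basis B .
  obtain m where m: "m > 0" "\<And>a. m * (\<Sum>b\<in>B. \<bar>a b\<bar>) \<le> nrm (\<Sum>b\<in>B. a b *\<^sub>R b)"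
    using nrm_ge_coordinates[OF finite_B independent_B] by blast
  define K where "K = (\<Sum>b\<in>B. norm b) + 1"
  have K: "norm b \<le> K" if "b \<in> B" for b
  proof -
    have "norm b \<le> (\<Sum>b\<in>B. norm b)" using that finite_B by (intro member_le_sum) auto
    then show ?thesis by (simp add: K_def)
  qed
  have K0: "K > 0" unfolding K_def by (intro add_nonneg_pos sum_nonneg) auto
  have "norm v \<le> K / m * nrm v" for v
  proof -
    have "norm v = norm (\<Sum>b\<in>B. representation B v b *\<^sub>R b)" by (simp add: expand)
    also have "\<dots> \<le> (\<Sum>b\<in>B. norm (representation B v b *\<^sub>R b))" by (rule norm_sum)
    also have "\<dots> \<le> (\<Sum>b\<in>B. \<bar>representation B v b\<bar> * K)"
      by (intro sum_mono) (simp add: K mult_left_mono)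
    also have "\<dots> = K * (\<Sum>b\<in>B. \<bar>representation B v b\<bar>)" by (simp add: sum_distrib_left mult.commute)
    also have "\<dots> \<le> K * (nrm v / m)"
      using m(1) m(2)[of "representation B v"] K0
      by (intro mult_left_mono) (auto simp: expand field_simps)
    finally show ?thesis by simp
  qed
  then show ?thesis using K0 m(1) by (intro exI[of _ "K / m"]) auto
qed

lemma continuous_on_nrm: "continuous_on S u \<Longrightarrow> continuous_on S (\<lambda>x. nrm (u x - v))"
proof -
  obtain B :: "'e set" where "finite_dim_basis B" using finite_dim_basis_exists by blast
  then interpret finite_dim_basis B .
  assume "continuous_on S u"
  then have u: "continuous_on S (\<lambda>x. u x - v)" by (rule continuous_on_diff[OF _ continuous_on_const])
  have "continuous_on S (\<lambda>x. g c p0 (u x - v) (u x - v))"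
    by (rule continuous_on_bilinear_apply[where F = "\<lambda>x. g c p0", OF continuous_on_const bilinear_Q u u])
  then show "continuous_on S (\<lambda>x. nrm (u x - v))"
    unfolding nrm_def by (rule continuous_on_real_sqrt)
qed

text \<open>The entries of the metric tensor in a fixed basis are continuous, and there are finitely many. The
  equivalence of \<open>nrm\<close> with the sum of coordinates turns closeness of the entries into closeness of the
  forms relative to \<open>nrm\<close>.\<close>

lemma metric_comparison:
  assumes \<epsilon>: "0 < \<epsilon>" "\<epsilon> < 1"
  shows "\<exists>\<rho>>0. \<forall>x. nrm (x - snd c p0) < \<rho> \<longrightarrow> x \<in> snd c ` fst c \<and>
    (\<forall>v. (1 - \<epsilon>) * nrm v \<le> sqrt (g c (chart_inv c x) v v) \<and>
         sqrt (g c (chart_inv c x) v v) \<le> (1 + \<epsilon>) * nrm v)"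
proof -
  obtain B :: "'e set" where "finite_dim_basis B" using finite_dim_basis_exists by blast
  then interpret finite_dim_basis B .
  obtain m where m: "m > 0" "\<And>a. m * (\<Sum>b\<in>B. \<bar>a b\<bar>) \<le> nrm (\<Sum>b\<in>B. a b *\<^sub>R b)"
    using nrm_ge_coordinates[OF finite_B independent_B] by blast
  obtain K where K: "K > 0" "\<And>v. norm v \<le> K * nrm v" using norm_le_nrm by blast
  define \<eta> where "\<eta> = \<epsilon> * m\<^sup>2"
  have \<eta>: "\<eta> > 0" using \<epsilon> m by (simp add: \<eta>_def)
  define x0 where "x0 = snd c p0"
  have x0: "x0 \<in> snd c ` fst c" using base by (simp add: x0_def)
  have inv_x0: "chart_inv c x0 = p0" unfolding x0_def by (rule chart_inv_left[OF chart base])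
  have ev: "\<forall>\<^sub>F x in nhds x0. \<bar>g c (chart_inv c x) b b' - g c p0 b b'\<bar> < \<eta>" for b b'
  proof -
    have "continuous (at x0) (\<lambda>x. g c (chart_inv c x) b b')"
      using metric_continuous[OF chart] x0 chart_image[OF chart] continuous_on_eq_continuous_at by blast
    then have "((\<lambda>x. g c (chart_inv c x) b b') \<longlongrightarrow> g c (chart_inv c x0) b b') (nhds x0)"
      unfolding continuous_at by (rule tendsto_at_iff_tendsto_nhds[THEN iffD1])
    then have "((\<lambda>x. g c (chart_inv c x) b b') \<longlongrightarrow> g c p0 b b') (nhds x0)"
      unfolding inv_x0 .
    from tendstoD[OF this \<eta>] show ?thesis by (simp add: dist_real_def)
  qed
  have "\<forall>\<^sub>F x in nhds x0. x \<in> snd c ` fst c \<and> (\<forall>b\<in>B. \<forall>b'\<in>B. \<bar>g c (chart_inv c x) b b' - g c p0 b b'\<bar> < \<eta>)"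
    by (intro eventually_conj eventually_nhds_in_open chart_image[OF chart] x0 eventually_ball_finite
        finite_B ballI ev)
  then obtain r where r: "r > 0" "\<And>x. dist x x0 < r \<Longrightarrow> x \<in> snd c ` fst c \<and>
      (\<forall>b\<in>B. \<forall>b'\<in>B. \<bar>g c (chart_inv c x) b b' - g c p0 b b'\<bar> < \<eta>)"
    unfolding eventually_nhds_metric by blast
  show ?thesis
  proof (intro exI[of _ "r / K"] conjI allI impI)
    show "0 < r / K" using r K by simp
    fix x assume "nrm (x - snd c p0) < r / K"
    then have "K * nrm (x - x0) < r" using K by (simp add: x0_def field_simps)
    then have "dist x x0 < r" using K(2)[of "x - x0"] by (simp add: dist_norm)
    from r(2)[OF this] have x: "x \<in> snd c ` fst c"
      and close: "\<And>b b'. b \<in> B \<Longrightarrow> b' \<in> B \<Longrightarrow> \<bar>g c (chart_inv c x) b b' - g c p0 b b'\<bar> < \<eta>" by auto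
    show "x \<in> snd c ` fst c" by (rule x)
    fix v
    define a where "a = representation B v"
    define G where "G = g c (chart_inv c x)"
    have bilin: "bilinear G" unfolding G_def by (rule metric_bilinear[OF chart chart_inv_in[OF x]])
    have G0: "0 \<le> G v v" unfolding G_def by (rule metric_nonneg[OF chart chart_inv_in[OF x]])
    have v: "(\<Sum>b\<in>B. a b *\<^sub>R b) = v" unfolding a_def by (rule expand)
    have "G v v - g c p0 v v = (\<Sum>b\<in>B. \<Sum>b'\<in>B. a b * a b' * (G b b' - g c p0 b b'))"
      using bilinear_sum_scaled[OF bilin, of a "\<lambda>b. b" B a "\<lambda>b. b" B]
        bilinear_sum_scaled[OF bilinear_Q, of a "\<lambda>b. b" B a "\<lambda>b. b" B]
      unfolding v by (simp add: sum_subtractf right_diff_distrib)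
    then have "\<bar>G v v - g c p0 v v\<bar> \<le> (\<Sum>b\<in>B. \<Sum>b'\<in>B. \<bar>a b * a b' * (G b b' - g c p0 b b')\<bar>)"
      using order_trans[OF sum_abs sum_mono[OF sum_abs]] by simp
    also have "\<dots> \<le> (\<Sum>b\<in>B. \<Sum>b'\<in>B. \<bar>a b\<bar> * \<bar>a b'\<bar> * \<eta>)"
      using close unfolding abs_mult G_def[symmetric] by (intro sum_mono mult_left_mono) (auto simp: less_imp_le)
    also have "\<dots> = \<eta> * (\<Sum>b\<in>B. \<bar>a b\<bar>)\<^sup>2"
      unfolding power2_eq_square sum_product by (simp add: sum_distrib_left mult_ac)
    also have "\<dots> \<le> \<eta> * (nrm v / m)\<^sup>2"
    proof (intro mult_left_mono power_mono)
      show "(\<Sum>b\<in>B. \<bar>a b\<bar>) \<le> nrm v / m" using m(1) m(2)[of a] unfolding v by (simp add: field_simps)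
    qed (use \<eta> in \<open>auto simp: sum_nonneg\<close>)
    also have "\<dots> = \<epsilon> * (nrm v)\<^sup>2" using m by (simp add: \<eta>_def field_simps)
    finally have "\<bar>G v v - (nrm v)\<^sup>2\<bar> \<le> \<epsilon> * (nrm v)\<^sup>2" by (simp add: nrm_power2)
    then have lo: "(1 - \<epsilon>) * (nrm v)\<^sup>2 \<le> G v v" and up: "G v v \<le> (1 + \<epsilon>) * (nrm v)\<^sup>2"
      by (auto simp: algebra_simps abs_le_iff)
    have "((1 - \<epsilon>) * nrm v)\<^sup>2 \<le> (1 - \<epsilon>) * (nrm v)\<^sup>2"
      unfolding power_mult_distrib
      by (intro mult_right_mono) (use \<epsilon> in \<open>auto simp: power2_eq_square mult_left_le\<close>)
    then have "(1 - \<epsilon>) * nrm v \<le> sqrt (G v v)"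
      using lo by (intro real_le_rsqrt) simp
    moreover have "(1 + \<epsilon>) * (nrm v)\<^sup>2 \<le> ((1 + \<epsilon>) * nrm v)\<^sup>2"
      unfolding power_mult_distrib
      by (intro mult_right_mono) (use \<epsilon> in \<open>auto simp: power2_eq_square\<close>)
    then have "sqrt (G v v) \<le> (1 + \<epsilon>) * nrm v"
      using up \<epsilon> nrm_nonneg[of v] by (intro real_le_lsqrt G0) auto
    ultimately show "(1 - \<epsilon>) * nrm v \<le> sqrt (g c (chart_inv c x) v v)"
      "sqrt (g c (chart_inv c x) v v) \<le> (1 + \<epsilon>) * nrm v" unfolding G_def by auto
  qed
qed

end

text \<open>A coordinate ball on which the metric tensor differs from its value at the centre by at most the
  factors \<open>1 \<plusminus> \<epsilon>\<close>.\<close>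

locale riemannian_chart_ball = riemannian_chart T A g c p0
  for T :: "'a topology" and A :: "('a, 'e::real_normed_vector) chart set" and g and c and p0 +
  fixes \<epsilon> \<rho> :: real
  assumes eps: "0 < \<epsilon>" "\<epsilon> < 1"
    and ball_in_chart: "nrm (x - snd c p0) < \<rho> \<Longrightarrow> x \<in> snd c ` fst c"
    and metric_lower: "nrm (x - snd c p0) < \<rho> \<Longrightarrow> (1 - \<epsilon>) * nrm v \<le> sqrt (g c (chart_inv c x) v v)"
    and metric_upper: "nrm (x - snd c p0) < \<rho> \<Longrightarrow> sqrt (g c (chart_inv c x) v v) \<le> (1 + \<epsilon>) * nrm v"
begin

lemma metric_lower': "p \<in> fst c \<Longrightarrow> radius p < \<rho> \<Longrightarrow> (1 - \<epsilon>) * nrm v \<le> sqrt (g c p v v)"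
  using metric_lower[of "snd c p" v] by (simp add: radius_def chart_inv_left[OF chart])

text \<open>A curve inside the ball is at least as long, up to the factor \<open>1 - \<epsilon>\<close>, as the segment between its
  ends. On a \<open>C\<^sup>1\<close> piece, integrate the component of the velocity in the direction \<open>w\<close> of the
  segment; pieces are combined by the triangle inequality.\<close>

lemma has_length_ge_in_chart:
  "has_length \<gamma> a b l \<Longrightarrow> (\<And>t. t \<in> {a..b} \<Longrightarrow> \<gamma> t \<in> fst c \<and> radius (\<gamma> t) < \<rho>) \<Longrightarrow>
    (1 - \<epsilon>) * nrm (snd c (\<gamma> b) - snd c (\<gamma> a)) \<le> l"
proof (induction rule: has_length.induct)
  case (piece a b)
  note ab = piece.hyps(1) and C1 = piece.hyps(2)
  obtain B :: "'e set" where "finite_dim_basis B" using finite_dim_basis_exists by blast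
  then interpret finite_dim_basis B .
  define w where "w = snd c (\<gamma> b) - snd c (\<gamma> a)"
  define l where "l = length_on \<gamma> a b"
  have has_length: "has_length \<gamma> a b l" unfolding l_def by (rule has_length.piece[OF piece.hyps])
  have lin: "linear (\<lambda>v. g c p0 v w)" using bilinear_Q by (simp add: bilinear_def)
  have bl: "bounded_linear (\<lambda>v. g c p0 v w)" by (rule bounded_linear_of_linear[OF lin])
  have vel: "((snd c \<circ> \<gamma>) has_vector_derivative velocity c \<gamma> a b t) (at t within {a..b})"
    if "t \<in> {a..b}" for t
    by (rule C1_curve_velocity[OF ab C1 chart that]) (use piece.prems that in blast)
  have "((\<lambda>t. g c p0 (velocity c \<gamma> a b t) w) has_integral
      g c p0 (snd c (\<gamma> b)) w - g c p0 (snd c (\<gamma> a)) w) {a..b}"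
  proof (rule fundamental_theorem_of_calculus)
    fix t assume "t \<in> {a..b}"
    from bounded_linear.has_vector_derivative[OF bl vel[OF this]]
    show "((\<lambda>t. g c p0 (snd c (\<gamma> t)) w) has_vector_derivative g c p0 (velocity c \<gamma> a b t) w) (at t within {a..b})"
      by simp
  qed (use ab in simp)
  moreover have "g c p0 (snd c (\<gamma> b)) w - g c p0 (snd c (\<gamma> a)) w = (nrm w)\<^sup>2"
    unfolding nrm_power2 by (simp add: w_def bilinear_lsub[OF bilinear_Q])
  ultimately have int1: "((\<lambda>t. g c p0 (velocity c \<gamma> a b t) w) has_integral (nrm w)\<^sup>2) {a..b}" by simp
  \<comment> \<open>Redefined at the ends, where \<open>speed\<close> has arbitrary values that need not satisfy the bound.\<close>
  define h where "h t = (if t \<in> {a<..<b} then nrm w / (1 - \<epsilon>) * speed A g \<gamma> t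
      else g c p0 (velocity c \<gamma> a b t) w)" for t
  have "((\<lambda>t. nrm w / (1 - \<epsilon>) * speed A g \<gamma> t) has_integral nrm w / (1 - \<epsilon>) * l) {a..b}"
    by (rule has_integral_mult_right[OF has_length_integral[OF has_length]])
  then have int2: "(h has_integral nrm w / (1 - \<epsilon>) * l) {a..b}"
    by (rule has_integral_spike_finite[of "{a, b}", rotated 2]) (auto simp: h_def)
  have "(nrm w)\<^sup>2 \<le> nrm w / (1 - \<epsilon>) * l"
  proof (rule has_integral_le[OF int1 int2])
    fix t assume t: "t \<in> {a..b}"
    show "g c p0 (velocity c \<gamma> a b t) w \<le> h t"
    proof (cases "t \<in> {a<..<b}")
      case True
      have \<gamma>t: "\<gamma> t \<in> fst c" "radius (\<gamma> t) < \<rho>" using piece.prems t by auto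
      have sp: "speed A g \<gamma> t = sqrt (g c (\<gamma> t) (velocity c \<gamma> a b t) (velocity c \<gamma> a b t))"
        by (rule speed_eq[OF chart \<gamma>t(1) C1_curve_continuous[OF ab C1] True vel[OF t]])
      have "g c p0 (velocity c \<gamma> a b t) w \<le> nrm (velocity c \<gamma> a b t) * nrm w" by (rule Cauchy_Schwarz_form)
      also have "\<dots> \<le> (speed A g \<gamma> t / (1 - \<epsilon>)) * nrm w"
        using metric_lower'[OF \<gamma>t, of "velocity c \<gamma> a b t"] eps nrm_nonneg unfolding sp
        by (intro mult_right_mono) (auto simp: field_simps)
      finally show ?thesis using True by (simp add: h_def mult.commute)
    qed (auto simp: h_def)
  qed
  then have "(1 - \<epsilon>) * nrm w \<le> l"
  proof (cases "nrm w = 0")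
    case False
    then have "nrm w > 0" using nrm_nonneg[of w] by simp
    moreover assume "(nrm w)\<^sup>2 \<le> nrm w / (1 - \<epsilon>) * l"
    ultimately have "nrm w * nrm w \<le> nrm w * (l / (1 - \<epsilon>))" by (simp add: power2_eq_square)
    then have "nrm w \<le> l / (1 - \<epsilon>)" using \<open>nrm w > 0\<close> by (rule mult_left_le_imp_le)
    then show ?thesis using eps by (simp add: field_simps)
  qed (use has_length_nonneg[OF has_length] in simp)
  then show ?case by (simp add: w_def l_def)
next
  case (join a b l d m)
  have "(1 - \<epsilon>) * nrm (snd c (\<gamma> b) - snd c (\<gamma> a)) \<le> l" "(1 - \<epsilon>) * nrm (snd c (\<gamma> d) - snd c (\<gamma> b)) \<le> m"
    using join has_length_less[OF join.hyps(1)] has_length_less[OF join.hyps(2)] by auto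
  moreover have "(1 - \<epsilon>) * nrm (snd c (\<gamma> d) - snd c (\<gamma> a))
      \<le> (1 - \<epsilon>) * (nrm (snd c (\<gamma> d) - snd c (\<gamma> b)) + nrm (snd c (\<gamma> b) - snd c (\<gamma> a)))"
    using eps nrm_triangle_diff by (intro mult_left_mono) auto
  ultimately show ?case by (simp add: algebra_simps)
qed

lemma openin_open_ball: "openin T {p \<in> fst c. radius p < s}"
proof -
  have "open {x. nrm (x - snd c p0) < s}"
    using continuous_on_nrm[OF continuous_on_id, of UNIV "snd c p0"]
    by (simp add: open_Collect_less)
  from openin_continuous_map_preimage[OF continuous_map_chart[OF chart], of "{x. nrm (x - snd c p0) < s}"] this
  have "openin (subtopology T (fst c)) {p \<in> topspace (subtopology T (fst c)). radius p < s}"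
    by (simp add: radius_def)
  moreover have "topspace (subtopology T (fst c)) = fst c"
    using chart_domain_subset[OF chart] by auto
  ultimately have "openin (subtopology T (fst c)) {p \<in> fst c. radius p < s}" by (simp only:)
  then show ?thesis using openin_trans_full[OF _ chart_domain[OF chart]] by blast
qed

text \<open>A coordinate ball that is closed in the model space is compact, so it is closed in the manifold
  because the manifold is Hausdorff. This forces a curve that leaves a ball to cross its boundary
  inside the chart.\<close>

lemma closedin_closed_ball:
  assumes "s < \<rho>"
  shows "closedin T {p \<in> fst c. radius p \<le> s}"
proof -
  obtain B :: "'e set" where "finite_dim_basis B" using finite_dim_basis_exists by blast
  then interpret finite_dim_basis B .
  define C where "C = {x. nrm (x - snd c p0) \<le> s}"
  obtain K where K: "K > 0" "\<And>v. norm v \<le> K * nrm v" using norm_le_nrm by blast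
  have "closed C"
    unfolding C_def using continuous_on_nrm[OF continuous_on_id, of UNIV "snd c p0"]
    by (simp add: closed_Collect_le)
  moreover have "bounded C"
  proof (rule boundedI)
    fix x assume "x \<in> C"
    then have "K * nrm (x - snd c p0) \<le> K * s" using K by (simp add: C_def)
    then have "norm (x - snd c p0) \<le> K * s" using K(2)[of "x - snd c p0"] by simp
    then show "norm x \<le> K * s + norm (snd c p0)" using norm_triangle_sub[of x "snd c p0"] by simp
  qed
  ultimately have "compact C" by (rule compact_of_closed_bounded)
  moreover have sub: "C \<subseteq> snd c ` fst c"
    using ball_in_chart assms by (auto simp: C_def)
  ultimately have "compactin (top_of_set (snd c ` fst c)) C"
    by (simp add: compactin_subtopology)
  from image_compactin[OF this continuous_map_chart_inv[OF chart]]
  have "closedin T (chart_inv c ` C)" by (rule compactin_imp_closedin[OF Hausdorff])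
  also have "chart_inv c ` C = {p \<in> fst c. radius p \<le> s}"
  proof (intro subset_antisym subsetI)
    fix p assume "p \<in> chart_inv c ` C"
    then obtain x where x: "x \<in> C" "p = chart_inv c x" by blast
    then have "x \<in> snd c ` fst c" using sub by blast
    then show "p \<in> {p \<in> fst c. radius p \<le> s}"
      using x chart_inv_right[of x c] chart_inv_in[of x c] by (simp add: radius_def C_def)
  next
    fix p assume p: "p \<in> {p \<in> fst c. radius p \<le> s}"
    then show "p \<in> chart_inv c ` C"
      by (intro image_eqI[of _ _ "snd c p"]) (auto simp: C_def radius_def chart_inv_left[OF chart])
  qed
  finally show ?thesis .
qed

lemma first_exit:
  assumes \<gamma>: "continuous_map (top_of_set {0..1::real}) T \<gamma>" and s: "s < \<rho>"
    and start: "\<gamma> 0 \<in> fst c" "radius (\<gamma> 0) < s"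
    and exits: "\<exists>t\<in>{0..1}. \<not> (\<gamma> t \<in> fst c \<and> radius (\<gamma> t) < s)"
  shows "\<exists>t\<in>{0<..1}. (\<forall>r\<in>{0..t}. \<gamma> r \<in> fst c \<and> radius (\<gamma> r) \<le> s) \<and> radius (\<gamma> t) = s"
proof -
  define U where "U = {p \<in> fst c. radius p < s}"
  define X where "X = {t\<in>{0..1}. \<gamma> t \<in> topspace T - U}"
  have top: "\<gamma> t \<in> topspace T" if "t \<in> {0..1}" for t
    using continuous_map_funspace[OF \<gamma>] that by auto
  have closed_preimage: "closed {t\<in>{0..1}. \<gamma> t \<in> C}" if "closedin T C" for C
    using closedin_continuous_map_preimage[OF \<gamma> that] closedin_closed_eq[of "{0..1::real}"] by simp
  have "closedin T (topspace T - U)"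
    using openin_open_ball[of s] by (auto simp: U_def)
  then have "closed X" unfolding X_def by (rule closed_preimage)
  moreover have "X \<noteq> {}" using exits top unfolding X_def U_def by blast
  moreover have bdd: "bdd_below X" by (rule bdd_belowI[of _ 0]) (auto simp: X_def)
  ultimately have tX: "Inf X \<in> X" by (intro closed_contains_Inf)
  define t where "t = Inf X"
  have t: "t \<in> {0..1}" "\<gamma> t \<notin> U" using tX by (auto simp: t_def X_def)
  have "t \<noteq> 0" using t start by (auto simp: U_def)
  then have t0: "0 < t" using t by simp
  have before: "\<gamma> r \<in> U" if "0 \<le> r" "r < t" for r
  proof (rule ccontr)
    assume "\<gamma> r \<notin> U"
    then have "r \<in> X" using that t top by (auto simp: X_def)
    then have "t \<le> r" unfolding t_def by (rule cInf_lower[OF _ bdd])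
    then show False using that by simp
  qed
  define Y where "Y = {t\<in>{0..1}. \<gamma> t \<in> {p \<in> fst c. radius p \<le> s}}"
  have "closed Y" unfolding Y_def by (rule closed_preimage[OF closedin_closed_ball[OF s]])
  moreover have "{0..<t} \<subseteq> Y" using before t by (auto simp: Y_def U_def less_imp_le)
  ultimately have "closure {0..<t} \<subseteq> Y" by (rule closure_minimal[rotated])
  then have Y: "{0..t} \<subseteq> Y" using t0 by (simp add: closure_atLeastLessThan)
  have "t \<in> Y" using Y t0 by auto
  then have "radius (\<gamma> t) = s" using t by (auto simp: Y_def U_def)
  then show ?thesis using Y t t0 by (intro bexI[of _ t]) (auto simp: Y_def)
qed

text \<open>Either the curve stays in the ball and is compared with a segment, or its part up to the first exit
  already travels from \<open>p\<close> to the sphere of radius \<open>s\<close>.\<close>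

lemma joined_length_ge:
  assumes "joined p q l" and s: "s < \<rho>" and p: "p \<in> fst c" "radius p < s"
  shows "(q \<in> fst c \<and> radius q < s \<and> (1 - \<epsilon>) * nrm (snd c q - snd c p) \<le> l) \<or>
    (1 - \<epsilon>) * (s - radius p) \<le> l"
proof -
  obtain \<gamma> where \<gamma>: "has_length \<gamma> 0 1 l" "\<gamma> 0 = p" "\<gamma> 1 = q" using assms by (auto simp: joined_def)
  show ?thesis
  proof (cases "\<exists>t\<in>{0..1}. \<not> (\<gamma> t \<in> fst c \<and> radius (\<gamma> t) < s)")
    case False
    then have "\<gamma> t \<in> fst c \<and> radius (\<gamma> t) < s" if "t \<in> {0..1}" for t using that by blast
    then have "q \<in> fst c \<and> radius q < s" "(1 - \<epsilon>) * nrm (snd c q - snd c p) \<le> l"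
      using has_length_ge_in_chart[OF \<gamma>(1)] \<gamma> s by force+
    then show ?thesis by blast
  next
    case True
    then obtain t where t: "t \<in> {0<..1}" "\<forall>r\<in>{0..t}. \<gamma> r \<in> fst c \<and> radius (\<gamma> r) \<le> s" "radius (\<gamma> t) = s"
      using first_exit[OF has_length_continuous[OF \<gamma>(1)] s] \<gamma> p by blast
    have has_length_t: "has_length \<gamma> 0 t (length_on \<gamma> 0 t)"
      by (rule has_length_restrict[OF \<gamma>(1)]) (use t in auto)
    have "(1 - \<epsilon>) * (s - radius p) \<le> (1 - \<epsilon>) * nrm (snd c (\<gamma> t) - snd c p)"
      using nrm_triangle_diff[of "snd c (\<gamma> t)" "snd c p0" "snd c p"] t(3) eps
      by (intro mult_left_mono) (auto simp: radius_def)
    also have "\<dots> \<le> length_on \<gamma> 0 t"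
      using has_length_ge_in_chart[OF has_length_t] t s \<gamma>(2) by fastforce
    also have "\<dots> \<le> length_on \<gamma> 0 1"
    proof (rule integral_subset_le)
      show "speed A g \<gamma> integrable_on {0..1}"
        using has_length_integral[OF \<gamma>(1)] by (rule has_integral_integrable)
      show "speed A g \<gamma> integrable_on {0..t}"
        using has_length_integral[OF has_length_t] by (rule has_integral_integrable)
      show "\<forall>x\<in>{0..1}. 0 \<le> speed A g \<gamma> x" using speed_nonneg has_length_topspace[OF \<gamma>(1)] by blast
    qed (use t in auto)
    also have "\<dots> = l" using has_length_integral[OF \<gamma>(1)] by (rule integral_unique)
    finally show ?thesis by blast
  qed
qed

text \<open>The coordinate segment stays in the ball by convexity and provides a short curve.\<close>

lemma joined_segment:
  assumes p: "p \<in> fst c" "radius p < \<rho>" and q: "q \<in> fst c" "radius q < \<rho>"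
  shows "\<exists>l. joined p q l \<and> l \<le> (1 + \<epsilon>) * nrm (snd c q - snd c p)"
proof -
  define w where "w = snd c q - snd c p"
  define u where "u t = snd c p + t *\<^sub>R w" for t :: real
  have u_ball: "nrm (u t - snd c p0) < \<rho>" if "t \<in> {0..1}" for t
  proof -
    have "u t - snd c p0 = (1 - t) *\<^sub>R (snd c p - snd c p0) + t *\<^sub>R (snd c q - snd c p0)"
      by (simp add: u_def w_def algebra_simps)
    then have "nrm (u t - snd c p0) \<le> (1 - t) * radius p + t * radius q"
      using nrm_triangle[of "(1 - t) *\<^sub>R (snd c p - snd c p0)" "t *\<^sub>R (snd c q - snd c p0)"] that
      by (simp add: nrm_scale radius_def)
    also have "\<dots> < \<rho>" using p q that by (intro convex_bound_lt) auto
    finally show ?thesis .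
  qed
  define \<gamma> where "\<gamma> t = chart_inv c (u t)" for t
  have \<gamma>_in: "\<gamma> t \<in> fst c" "snd c (\<gamma> t) = u t" if "t \<in> {0..1}" for t
    unfolding \<gamma>_def using ball_in_chart[OF u_ball[OF that]] by (rule chart_inv_in, rule chart_inv_right)
  have cont: "continuous_map (top_of_set {0..1}) T \<gamma>"
  proof -
    have "continuous_map (top_of_set {0..1}) (top_of_set (snd c ` fst c)) u"
      using ball_in_chart[OF u_ball] by (auto simp: u_def[abs_def] intro!: continuous_intros)
    from continuous_map_compose[OF this continuous_map_chart_inv[OF chart]]
    show ?thesis by (simp add: \<gamma>_def[abs_def] comp_def)
  qed
  have vel: "((snd c \<circ> \<gamma>) has_vector_derivative w) (at t within {0..1})" if "t \<in> {0..1}" for t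
  proof -
    have "(u has_vector_derivative w) (at t within {0..1})"
      unfolding u_def[abs_def] by (auto intro!: derivative_eq_intros)
    then show ?thesis
      by (rule has_vector_derivative_transform[rotated 2]) (use that \<gamma>_in in auto)
  qed
  then have vel_eq: "velocity c \<gamma> 0 1 t = w" if "t \<in> {0..1}" for t
    using that by (intro velocity_eq) auto
  have "C1_curve_on T A 0 1 (id \<circ> \<gamma>)"
  proof (rule C1_curve_push[OF C1_map_id _ cont])
    fix r :: real assume "r \<in> {0..1}"
    have "continuous_on {s\<in>{0..1}. \<gamma> s \<in> fst c} (velocity c \<gamma> 0 1)"
      by (rule continuous_on_eq[OF continuous_on_const[of _ w]]) (simp add: vel_eq)
    then show "\<exists>c\<in>A. \<gamma> r \<in> fst c \<and> continuous_on {s\<in>{0..1}. \<gamma> s \<in> fst c} (velocity c \<gamma> 0 1) \<and>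
        (\<forall>s\<in>{0..1}. \<gamma> s \<in> fst c \<longrightarrow>
          ((snd c \<circ> \<gamma>) has_vector_derivative velocity c \<gamma> 0 1 s) (at s within {0..1}))"
      using chart \<gamma>_in(1)[OF \<open>r \<in> {0..1}\<close>] vel vel_eq by (intro bexI[of _ c]) auto
  qed simp
  then have C1: "C1_curve_on T A 0 1 \<gamma>" by simp
  define l where "l = length_on \<gamma> 0 1"
  have has_length: "has_length \<gamma> 0 1 l" unfolding l_def by (rule has_length.piece[OF _ C1]) simp
  have "\<gamma> 0 = p" "\<gamma> 1 = q"
    using chart_inv_left[OF chart] p q by (auto simp: \<gamma>_def u_def w_def)
  with has_length have "joined p q l" unfolding joined_def by blast
  moreover have "l \<le> (1 + \<epsilon>) * nrm w"
  proof -
    define h where "h t = (if t \<in> {0<..<1} then speed A g \<gamma> t else 0)" for t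
    have "(h has_integral l) {0..1}"
      by (rule has_integral_spike_finite[of "{0, 1}", OF _ _ has_length_integral[OF has_length]]) (auto simp: h_def)
    moreover have "((\<lambda>_. (1 + \<epsilon>) * nrm w) has_integral (1 + \<epsilon>) * nrm w) {0..1::real}"
      using has_integral_const_real[of "(1 + \<epsilon>) * nrm w" 0 1] by simp
    ultimately show ?thesis
    proof (rule has_integral_le)
      fix t :: real assume t: "t \<in> {0..1}"
      show "h t \<le> (1 + \<epsilon>) * nrm w"
      proof (cases "t \<in> {0<..<1}")
        case True
        have "speed A g \<gamma> t = sqrt (g c (\<gamma> t) w w)"
          by (rule speed_eq[OF chart \<gamma>_in(1)[OF t] cont True vel[OF t]])
        also have "\<dots> \<le> (1 + \<epsilon>) * nrm w"
          using metric_upper[OF u_ball[OF t], of w] by (simp add: \<gamma>_def)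
        finally show ?thesis using True by (simp add: h_def)
      qed (use eps nrm_nonneg[of w] in \<open>auto simp: h_def\<close>)
    qed
  qed
  ultimately show ?thesis unfolding w_def by blast
qed

end

context riemannian_chart
begin

text \<open>Between points within a quarter of the radius of the centre, a curve that leaves the ball
  travels at least as far as the segment is long, so \<open>joined_length_ge\<close> bounds the distance from below in either case, and
  \<open>joined_segment\<close> bounds it from above.\<close>

lemma locally_flat:
  assumes \<epsilon>: "0 < \<epsilon>" "\<epsilon> < 1"
  shows "\<exists>\<delta>>0. \<forall>p q. rdist p0 p < ennreal \<delta> \<longrightarrow> rdist p0 q < ennreal \<delta> \<longrightarrow>
    (1 - \<epsilon>) * enn2real (rdist p q) \<le> nrm (snd c p - snd c q) \<and>
    nrm (snd c p - snd c q) \<le> (1 + \<epsilon>) * enn2real (rdist p q)"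
proof -
  \<comment> \<open>chosen so that \<open>1 / (1 - e) \<le> 1 + \<epsilon>\<close>\<close>
  define e where "e = \<epsilon> / 2"
  have e: "0 < e" "e < 1" using \<epsilon> by (auto simp: e_def)
  obtain \<rho> where \<rho>: "\<rho> > 0" "\<And>x. nrm (x - snd c p0) < \<rho> \<Longrightarrow> x \<in> snd c ` fst c \<and>
    (\<forall>v. (1 - e) * nrm v \<le> sqrt (g c (chart_inv c x) v v) \<and>
         sqrt (g c (chart_inv c x) v v) \<le> (1 + e) * nrm v)"
    using metric_comparison[OF e] by blast
  interpret riemannian_chart_ball T A g c p0 e \<rho>
    by unfold_locales (use e \<rho> in auto)
  define s where "s = \<rho> / 2"
  have s: "0 < s" "s < \<rho>" using \<rho> by (auto simp: s_def)
  define \<delta> where "\<delta> = (1 - e) * (s / 4)"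
  have \<delta>: "\<delta> > 0" using e s by (simp add: \<delta>_def)
  have rad0: "radius p0 = 0"
    by (simp add: radius_def nrm_def bilinear_lzero[OF bilinear_Q])
  have near: "p \<in> fst c" "radius p < s / 4" if "rdist p0 p < ennreal \<delta>" for p
  proof -
    obtain l where l: "joined p0 p l" "ennreal l < ennreal \<delta>"
      using \<open>rdist p0 p < ennreal \<delta>\<close> riemannian_dist_less by blast
    have "l < \<delta>" using l(2) joined_nonneg[OF l(1)] by (simp add: ennreal_less_iff)
    moreover have "(1 - e) * (s / 4) \<le> (1 - e) * (s - radius p0)"
      using rad0 s e by (intro mult_left_mono) auto
    ultimately have "p \<in> fst c" "(1 - e) * radius p \<le> l"
      using joined_length_ge[OF l(1) s(2) base] rad0 s(1) by (auto simp: \<delta>_def radius_def)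
    with \<open>l < \<delta>\<close> have "(1 - e) * radius p < (1 - e) * (s / 4)" by (simp add: \<delta>_def)
    then show "p \<in> fst c" "radius p < s / 4" using \<open>p \<in> fst c\<close> e by auto
  qed
  show ?thesis
  proof (intro exI[of _ \<delta>] conjI allI impI)
    show "0 < \<delta>" by (rule \<delta>)
    fix p q assume "rdist p0 p < ennreal \<delta>" "rdist p0 q < ennreal \<delta>"
    note p = near[OF this(1)] and q = near[OF this(2)]
    define D where "D = enn2real (rdist p q)"
    define n where "n = nrm (snd c p - snd c q)"
    have n: "nrm (snd c q - snd c p) = n" unfolding n_def by (rule nrm_minus_commute)
    have "n \<le> radius p + radius q"
      using nrm_triangle_diff[of "snd c p" "snd c q" "snd c p0"] nrm_minus_commute[of "snd c q"]
      by (simp add: n_def radius_def)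
    then have n_le: "n \<le> s - radius p" using p q s by simp
    have n0: "0 \<le> n" unfolding n_def by (rule nrm_nonneg)
    obtain l where l: "joined p q l" "l \<le> (1 + e) * n"
      using joined_segment[of p q] p q s n by auto
    have d_le: "rdist p q \<le> ennreal l" by (rule riemannian_dist_le[OF l(1)])
    then have "D \<le> l" unfolding D_def using joined_nonneg[OF l(1)] by (rule enn2real_leI[rotated])
    with l(2) have D_le: "D \<le> (1 + e) * n" by simp
    have "ennreal ((1 - e) * n) \<le> rdist p q"
      unfolding riemannian_dist_eq_INF_joined
    proof (rule INF_greatest)
      fix l assume "l \<in> {l. joined p q l}"
      then have "(1 - e) * n \<le> l \<or> (1 - e) * (s - radius p) \<le> l"
        using joined_length_ge[of p q l s] p s n by auto
      moreover have "(1 - e) * n \<le> (1 - e) * (s - radius p)"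
        using n_le e by (intro mult_left_mono) auto
      ultimately show "ennreal ((1 - e) * n) \<le> ennreal l" by (intro ennreal_leI) auto
    qed
    moreover have "rdist p q < Orderings.top"
      using d_le by (meson ennreal_less_top order_le_less_trans)
    ultimately have le_D: "(1 - e) * n \<le> D"
      unfolding D_def using n0 e by (metis ennreal_enn2real ennreal_le_iff enn2real_nonneg)
    have D0: "0 \<le> D" by (simp add: D_def)
    have "(1 - \<epsilon>) * D \<le> (1 - \<epsilon>) * ((1 + e) * n)" using D_le \<epsilon> by (intro mult_left_mono) auto
    also have "\<dots> = ((1 - \<epsilon>) * (1 + e)) * n" by simp
    also have "\<dots> \<le> 1 * n"
      using \<epsilon> n0 by (intro mult_right_mono) (auto simp: e_def algebra_simps)
    finally show "(1 - \<epsilon>) * enn2real (rdist p q) \<le> nrm (snd c p - snd c q)"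
      by (simp add: D_def n_def)
    have "\<epsilon> * \<epsilon> \<le> \<epsilon>" using \<epsilon> by (simp add: mult_left_le)
    then have "1 \<le> (1 + \<epsilon>) * (1 - e)" by (simp add: e_def algebra_simps)
    then have "1 * n \<le> ((1 + \<epsilon>) * (1 - e)) * n" using n0 by (rule mult_right_mono)
    also have "\<dots> = (1 + \<epsilon>) * ((1 - e) * n)" by simp
    also have "\<dots> \<le> (1 + \<epsilon>) * D" using le_D \<epsilon> by (intro mult_left_mono) auto
    finally show "nrm (snd c p - snd c q) \<le> (1 + \<epsilon>) * enn2real (rdist p q)"
      by (simp add: D_def n_def)
  qed
qed

end

section \<open>Lie groups\<close>

text \<open>Used with \<open>j\<close> the embedding of one factor into a product, to obtain the differentiability of a
  translation from that of the multiplication.\<close>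

lemma Ck_on_1_compose_affine:
  fixes M :: "'e::real_normed_vector \<Rightarrow> 'f::real_normed_vector" and j :: "'d::real_normed_vector \<Rightarrow> 'e"
  assumes M: "Ck_on 1 W M" and j: "\<And>v. (j has_derivative L) (at v)"
    and S: "S \<subseteq> U" "open U" "j ` S \<subseteq> W" and F: "\<And>v. v \<in> U \<Longrightarrow> F v = M (j v)"
  shows "Ck_on 1 S F"
proof -
  have M1: "\<And>x. x \<in> W \<Longrightarrow> M differentiable (at x)"
    and M2: "\<And>v. continuous_on W (\<lambda>x. frechet_derivative M (at x) v)"
    using M by auto
  have der: "(F has_derivative (\<lambda>h. frechet_derivative M (at (j v)) (L h))) (at v)" if "v \<in> S" for v
  proof -
    have "(M has_derivative frechet_derivative M (at (j v))) (at (j v))"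
      using M1[of "j v"] that S(3) by (auto simp: frechet_derivative_works)
    from has_derivative_compose[OF j this]
    show ?thesis
      by (rule has_derivative_transform_within_open[OF _ S(2)]) (use that S F in auto)
  qed
  have eq: "frechet_derivative F (at v) h = frechet_derivative M (at (j v)) (L h)" if "v \<in> S" for v h
    using frechet_derivative_at[OF der[OF that]] by (metis (no_types))
  have contj: "continuous_on S j"
    by (meson continuous_at_imp_continuous_on has_derivative_continuous j)
  have "continuous_on S (\<lambda>v. frechet_derivative F (at v) h)" for h
  proof (rule continuous_on_eq)
    show "continuous_on S ((\<lambda>x. frechet_derivative M (at x) (L h)) \<circ> j)"
      by (rule continuous_on_compose[OF contj continuous_on_subset[OF M2 S(3)]])
  qed (simp add: eq)
  moreover have "F differentiable (at v)" if "v \<in> S" for v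
    using der[OF that] by (auto simp: differentiable_def)
  ultimately show ?thesis by simp
qed

locale bi_invariant_lie_group = lie_group G T A + riemannian_manifold T A g
  for G :: "('a, 'b) monoid_scheme" (structure)
    and T :: "'a topology" and A :: "('a, 'e::real_normed_vector) chart set" and g +
  assumes bi_invariant: "bi_invariant G A g"
begin

lemma continuous_mult: "continuous_map (prod_topology T T) T (\<lambda>(x, y). x \<otimes> y)"
  using smooth_mult by (simp add: smooth_map_def)

lemma prod_chart_inv:
  assumes c: "c1 \<in> A" "c2 \<in> A" and "x \<in> snd c1 ` fst c1" "y \<in> snd c2 ` fst c2"
  shows "inv_into (fst c1 \<times> fst c2) (map_prod (snd c1) (snd c2)) (x, y) = (chart_inv c1 x, chart_inv c2 y)"
proof -
  have inj: "inj_on (map_prod (snd c1) (snd c2)) (fst c1 \<times> fst c2)"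
    by (rule map_prod_inj_on[OF chart_inj[OF c(1)] chart_inj[OF c(2)]])
  have mem: "(chart_inv c1 x, chart_inv c2 y) \<in> fst c1 \<times> fst c2"
    using chart_inv_in[OF assms(3)] chart_inv_in[OF assms(4)] by simp
  have "map_prod (snd c1) (snd c2) (chart_inv c1 x, chart_inv c2 y) = (x, y)"
    using chart_inv_right[OF assms(3)] chart_inv_right[OF assms(4)] by simp
  then show ?thesis using inv_into_f_f[OF inj mem] by (simp only:)
qed

lemma mult_in_coords_C1:
  assumes c: "c1 \<in> A" "c2 \<in> A" "c' \<in> A"
  defines "M \<equiv> in_coords (fst c1 \<times> fst c2, map_prod (snd c1) (snd c2)) c' (\<lambda>(x, y). x \<otimes> y)"
  shows "Ck_on 1 (map_prod (snd c1) (snd c2) ` {(x, y). x \<in> fst c1 \<and> y \<in> fst c2 \<and> x \<otimes> y \<in> fst c'}) M"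
    and "u \<in> snd c1 ` fst c1 \<Longrightarrow> v \<in> snd c2 ` fst c2 \<Longrightarrow>
      M (u, v) = snd c' (chart_inv c1 u \<otimes> chart_inv c2 v)"
proof -
  have "(fst c1 \<times> fst c2, map_prod (snd c1) (snd c2)) \<in> prod_atlas A A"
    unfolding prod_atlas_def using c by (intro image_eqI[of _ _ "(c1, c2)"]) auto
  then have "smooth_on (map_prod (snd c1) (snd c2) ` {p \<in> fst c1 \<times> fst c2. (case p of (x, y) \<Rightarrow> x \<otimes> y) \<in> fst c'}) M"
    using smooth_mult c(3) unfolding smooth_map_def M_def by fastforce
  moreover have "{p \<in> fst c1 \<times> fst c2. (case p of (x, y) \<Rightarrow> x \<otimes> y) \<in> fst c'}
      = {(x, y). x \<in> fst c1 \<and> y \<in> fst c2 \<and> x \<otimes> y \<in> fst c'}" by auto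
  ultimately show "Ck_on 1 (map_prod (snd c1) (snd c2) ` {(x, y). x \<in> fst c1 \<and> y \<in> fst c2 \<and> x \<otimes> y \<in> fst c'}) M"
    unfolding smooth_on_def by (simp only:)
  show "M (u, v) = snd c' (chart_inv c1 u \<otimes> chart_inv c2 v)"
    if "u \<in> snd c1 ` fst c1" "v \<in> snd c2 ` fst c2"
    using prod_chart_inv[OF c(1,2) that] by (simp add: M_def in_coords_def)
qed

lemma C1_map_left_mult:
  assumes a: "a \<in> carrier G"
  shows "C1_map (\<lambda>x. a \<otimes> x)"
  unfolding C1_map_def
proof (intro conjI ballI)
  have "continuous_map T (prod_topology T T) (\<lambda>x. (a, x))"
    using a topspace_eq_carrier by (simp add: continuous_map_pairedI)
  from continuous_map_compose[OF this continuous_mult]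
  show "continuous_map T T (\<lambda>x. a \<otimes> x)" by (simp add: comp_def)
  fix c c' assume c: "c \<in> A" "c' \<in> A"
  obtain c1 where c1: "c1 \<in> A" "a \<in> fst c1" using chart_exists a topspace_eq_carrier by blast
  note M = mult_in_coords_C1[OF c1(1) c]
  show "Ck_on 1 (snd c ` {p \<in> fst c. a \<otimes> p \<in> fst c'}) (in_coords c c' (\<lambda>x. a \<otimes> x))"
  proof (rule Ck_on_1_compose_affine[OF M(1) _ _ chart_image[OF c(1)]])
    show "((\<lambda>v. (snd c1 a, v)) has_derivative (\<lambda>h. (0, h))) (at v)" for v
      by (auto intro!: derivative_eq_intros)
    show "(\<lambda>v. (snd c1 a, v)) ` snd c ` {p \<in> fst c. a \<otimes> p \<in> fst c'} \<subseteq>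
        map_prod (snd c1) (snd c) ` {(x, y). x \<in> fst c1 \<and> y \<in> fst c \<and> x \<otimes> y \<in> fst c'}"
      using c1 by force
    show "in_coords c c' (\<lambda>x. a \<otimes> x) v
        = in_coords (fst c1 \<times> fst c, map_prod (snd c1) (snd c)) c' (\<lambda>(x, y). x \<otimes> y) (snd c1 a, v)"
      if "v \<in> snd c ` fst c" for v
      using M(2)[of "snd c1 a" v] that c1 chart_inv_left[OF c1] by (simp add: in_coords_def[of c])
  qed auto
qed

lemma C1_map_right_mult:
  assumes a: "a \<in> carrier G"
  shows "C1_map (\<lambda>x. x \<otimes> a)"
  unfolding C1_map_def
proof (intro conjI ballI)
  have "continuous_map T (prod_topology T T) (\<lambda>x. (x, a))"
    using a topspace_eq_carrier by (simp add: continuous_map_pairedI)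
  from continuous_map_compose[OF this continuous_mult]
  show "continuous_map T T (\<lambda>x. x \<otimes> a)" by (simp add: comp_def)
  fix c c' assume c: "c \<in> A" "c' \<in> A"
  obtain c1 where c1: "c1 \<in> A" "a \<in> fst c1" using chart_exists a topspace_eq_carrier by blast
  note M = mult_in_coords_C1[OF c(1) c1(1) c(2)]
  show "Ck_on 1 (snd c ` {p \<in> fst c. p \<otimes> a \<in> fst c'}) (in_coords c c' (\<lambda>x. x \<otimes> a))"
  proof (rule Ck_on_1_compose_affine[OF M(1) _ _ chart_image[OF c(1)]])
    show "((\<lambda>v. (v, snd c1 a)) has_derivative (\<lambda>h. (h, 0))) (at v)" for v
      by (auto intro!: derivative_eq_intros)
    show "(\<lambda>v. (v, snd c1 a)) ` snd c ` {p \<in> fst c. p \<otimes> a \<in> fst c'} \<subseteq>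
        map_prod (snd c) (snd c1) ` {(x, y). x \<in> fst c \<and> y \<in> fst c1 \<and> x \<otimes> y \<in> fst c'}"
      using c1 by force
    show "in_coords c c' (\<lambda>x. x \<otimes> a) v
        = in_coords (fst c \<times> fst c1, map_prod (snd c) (snd c1)) c' (\<lambda>(x, y). x \<otimes> y) (v, snd c1 a)"
      if "v \<in> snd c ` fst c" for v
      using M(2)[of v "snd c1 a"] that c1 chart_inv_left[OF c1] by (simp add: in_coords_def[of c])
  qed auto
qed

lemma dist_left_mult:
  assumes "a \<in> carrier G" "x \<in> carrier G" "y \<in> carrier G"
  shows "rdist (a \<otimes> x) (a \<otimes> y) = rdist x y"
proof -
  have le: "rdist (b \<otimes> x) (b \<otimes> y) \<le> rdist x y" if "b \<in> carrier G" for b x y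
    using riemannian_dist_push_le[OF C1_map_left_mult[OF that]] bi_invariant that
    by (simp add: bi_invariant_def)
  show ?thesis
    using le[of a x y] le[of "inv a" "a \<otimes> x" "a \<otimes> y"] assms by (simp add: m_assoc[symmetric])
qed

lemma dist_right_mult:
  assumes "a \<in> carrier G" "x \<in> carrier G" "y \<in> carrier G"
  shows "rdist (x \<otimes> a) (y \<otimes> a) = rdist x y"
proof -
  have le: "rdist (x \<otimes> b) (y \<otimes> b) \<le> rdist x y" if "b \<in> carrier G" for b x y
    using riemannian_dist_push_le[OF C1_map_right_mult[OF that]] bi_invariant that
    by (simp add: bi_invariant_def)
  show ?thesis
    using le[of a x y] le[of "inv a" "x \<otimes> a" "y \<otimes> a"] assms by (simp add: m_assoc)
qed

text \<open>Right and left invariance come from applying the fact that metric-preserving maps do not increase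
  distances to a translation and its inverse; flatness and subdivision hold in every Riemannian
  manifold.\<close>

lemma locally_flat_length_group_of_chart:
  assumes c: "c \<in> A" "\<one> \<in> fst c"
  shows "locally_flat_length_group G rdist (snd c) (g c \<one>)"
proof -
  interpret riemannian_chart T A g c \<one> by unfold_locales (use c in auto)
  show ?thesis
  proof unfold_locales
    show "rdist x z \<le> rdist x y + rdist y z" for x y z
      by (rule riemannian_dist_triangle)
  next
    fix x y :: 'a and L and N :: nat
    assume xy: "x \<in> carrier G" "y \<in> carrier G" and less: "rdist x y < ennreal L" and N: "0 < N"
    obtain l where l: "joined x y l" "ennreal l < ennreal L"
      using less riemannian_dist_less by blast
    have "l < L" using l(2) joined_nonneg[OF l(1)] by (simp add: ennreal_less_iff)
    then have lN: "ennreal (l / N) < ennreal (L / N)"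
      using N joined_nonneg[OF l(1)] by (simp add: ennreal_less_iff divide_strict_right_mono)
    obtain q where q: "\<forall>k. q k \<in> topspace T" "q 0 = x" "q N = y"
      "\<forall>k<N. rdist (q k) (q (Suc k)) \<le> ennreal (l / N)"
      using joined_subdivide[OF l(1) N] by blast
    show "\<exists>q. (\<forall>k. q k \<in> carrier G) \<and> q 0 = x \<and> q N = y \<and>
        (\<forall>k<N. rdist (q k) (q (Suc k)) < ennreal (L / real N))"
      using q lN topspace_eq_carrier by (intro exI[of _ q]) (auto intro: order_le_less_trans)
  next
    fix \<epsilon> :: real assume "0 < \<epsilon>" "\<epsilon> < 1"
    from locally_flat[OF this] show "\<exists>\<delta>>0. \<forall>p\<in>carrier G. \<forall>q\<in>carrier G.
      rdist \<one> p < ennreal \<delta> \<longrightarrow> rdist \<one> q < ennreal \<delta> \<longrightarrow>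
        (1 - \<epsilon>) * enn2real (rdist p q) \<le> sqrt (g c \<one> (snd c p - snd c q) (snd c p - snd c q)) \<and>
        sqrt (g c \<one> (snd c p - snd c q) (snd c p - snd c q)) \<le> (1 + \<epsilon>) * enn2real (rdist p q)"
      unfolding nrm_def by blast
  qed (use riemannian_dist_refl riemannian_dist_sym dist_left_mult dist_right_mult
        topspace_eq_carrier bilinear_Q Q_sym Q_nonneg in auto)
qed

end

theorem proposition1p7:
  fixes G :: "('a, 'b) monoid_scheme"
    and T :: "'a topology"
    and A :: "('a, 'e::real_normed_vector) chart set"
    and g :: "('a, 'e) metric_tensor"
    and H :: "('a \<times> 'a) set"
    and V :: "'v set" and E :: "'v set set"
  assumes "lie_group G T A" and "compact_space T"
    and "riemannian_manifold T A g" and "bi_invariant G A g"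
    and "subgroup H (G \<times>\<times> G)" and "closedin (prod_topology T T) H"
    and infinite_dim: "\<nexists>B :: 'h::{real_inner, complete_space} set. finite B \<and> span B = UNIV"
    and "finite_tree V E"
  shows "satisfies_tree_comparison TYPE('h)
           (biquotient G H) (subset_dist (riemannian_dist T A g)) V E"
proof -
  interpret bi_invariant_lie_group G T A g
    using assms by (intro bi_invariant_lie_group.intro bi_invariant_lie_group_axioms.intro)
  obtain c where "c \<in> A" "\<one>\<^bsub>G\<^esub> \<in> fst c"
    using chart_exists[of "\<one>\<^bsub>G\<^esub>"] topspace_eq_carrier by auto
  then interpret locally_flat_length_group G "riemannian_dist T A g" "snd c" "g c \<one>\<^bsub>G\<^esub>"
    by (rule locally_flat_length_group_of_chart)
  show ?thesis
    by (rule tree_comparison_biquotient[OF infinite_dim]) (use assms in auto)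
qed

end
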